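(* Let $\lambda>0$ and $f\in L^1(\mathbb{R}_+,dm_\lambda)$. Then the following assertions are equivalent: (ii) $f\in H^1_{\Delta_\lambda,\max}(\mathbb{R}_+,dm_\lambda)$; (iii) $f\in H^1_{\Delta_\lambda,n\text{-}\max}(\mathbb{R}_+,dm_\lambda)$. Moreover, the corresponding norms are equivalent, i.e. there is a constant $C\ge1$, independent of $f$, such that $C^{-1}\|f\|_{H^1_{\Delta_\lambda,\max}(\mathbb{R}_+,dm_\lambda)}\le\|f\|_{H^1_{\Delta_\lambda,n\text{-}\max}(\mathbb{R}_+,dm_\lambda)}\le C\|f\|_{H^1_{\Delta_\lambda,\max}(\mathbb{R}_+,dm_\lambda)}$.
   Context: $\mathbb{R}_+:=(0,\infty)$ and $dm_\lambda(x):=x^{2\lambda}\,dx$. The Bessel operator is $\Delta_\lambda f(x):=\frac{d^2}{dx^2}f(x)+\frac{2\lambda}{x}\frac{d}{dx}f(x)$, $x\in\mathbb{R}_+$. The Poisson semigroup $\{P^{[\lambda]}_t\}_{t>0}$ associated with the Bessel operator (the semigroup $e^{-t\sqrt{-\Delta_\lambda}}$) is given by $$P^{[\lambda]}_tf(x)=\int_0^\infty P^{[\lambda]}_t(x,y)f(y)\,y^{2\lambda}\,dy,\qquad P^{[\lambda]}_t(x,y)=\frac{2\lambda t}{\pi}\int_0^\pi\frac{(\sin\theta)^{2\lambda-1}}{(x^2+y^2+t^2-2xy\cos\theta)^{\lambda+1}}\,d\theta,\qquad t,x,y\in\mathbb{R}_+ .$$ For $f\in L^1(\mathbb{R}_+,dm_\lambda)$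 define the radial and non-tangential maximal functions, for $x\in\mathbb{R}_+$, by $$\mathcal{R}(f)(x):=\sup_{t>0}|P^{[\lambda]}_tf(x)|,\qquad \mathcal{N}(f)(x):=\sup_{\substack{y\in\mathbb{R}_+,\ t>0\\ |x-y|<t}}|P^{[\lambda]}_tf(y)|.$$ The Hardy spaces are $$H^1_{\Delta_\lambda,\max}(\mathbb{R}_+,dm_\lambda):=\{f\in L^1(\mathbb{R}_+,dm_\lambda):\ \mathcal{R}(f)\in L^1(\mathbb{R}_+,dm_\lambda)\},$$ with norm $\|f\|_{H^1_{\Delta_\lambda,\max}(\mathbb{R}_+,dm_\lambda)}:=\|f\|_{L^1(\mathbb{R}_+,dm_\lambda)}+\|\mathcal{R}(f)\|_{L^1(\mathbb{R}_+,dm_\lambda)}$, and $$H^1_{\Delta_\lambda,n\text{-}\max}(\mathbb{R}_+,dm_\lambda):=\{f\in L^1(\mathbb{R}_+,dm_\lambda):\ \mathcal{N}(f)\in L^1(\mathbb{R}_+,dm_\lambda)\},$$ with norm $\|f\|_{H^1_{\Delta_\lambda,n\text{-}\max}(\mathbb{R}_+,dm_\lambda)}:=\|f\|_{L^1(\mathbb{R}_+,dm_\lambda)}+\|\mathcal{N}(f)\|_{L^1(\mathbb{R}_+,dm_\lambda)}$. *)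

theory Defs
  imports "HOL-Analysis.Analysis"
begin

definition bessel_measure :: "real \<Rightarrow> real measure" where
  "bessel_measure lam = density (lebesgue_on {0<..}) (\<lambda>x. ennreal (x powr (2 * lam)))"

definition poisson_kernel :: "real \<Rightarrow> real \<Rightarrow> real \<Rightarrow> real \<Rightarrow> real" where
  "poisson_kernel lam t x y =
     2 * lam * t / pi *
     (LBINT \<theta>:{0<..<pi}.
        (sin \<theta>) powr (2 * lam - 1) / (x^2 + y^2 + t^2 - 2 * x * y * cos \<theta>) powr (lam + 1))"

definition poisson :: "real \<Rightarrow> real \<Rightarrow> (real \<Rightarrow> complex) \<Rightarrow> real \<Rightarrow> complex" where
  "poisson lam t f x = (LINT y|bessel_measure lam. poisson_kernel lam t x y *\<^sub>R f y)"

text \<open>The maximal functions take values in \<^typ>\<open>ennreal\<close>, because the suprema may be infinite.\<close>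

definition radial_max :: "real \<Rightarrow> (real \<Rightarrow> complex) \<Rightarrow> real \<Rightarrow> ennreal" where
  "radial_max lam f x = (SUP t\<in>{0<..}. ennreal (norm (poisson lam t f x)))"

definition nontangential_max :: "real \<Rightarrow> (real \<Rightarrow> complex) \<Rightarrow> real \<Rightarrow> ennreal" where
  "nontangential_max lam f x =
     (SUP (y, t)\<in>{(y, t). 0 < y \<and> 0 < t \<and> \<bar>x - y\<bar> < t}. ennreal (norm (poisson lam t f y)))"

text \<open>Members of the spaces below are functions rather than classes modulo null sets; their
  values outside the half-line are irrelevant.\<close>

definition L1_bessel :: "real \<Rightarrow> (real \<Rightarrow> complex) set" where
  "L1_bessel lam = {f. integrable (bessel_measure lam) f}"

definition L1_norm :: "real \<Rightarrow> (real \<Rightarrow> complex) \<Rightarrow> ennreal" where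
  "L1_norm lam f = (\<integral>\<^sup>+ x. ennreal (norm (f x)) \<partial>bessel_measure lam)"

definition H1_max :: "real \<Rightarrow> (real \<Rightarrow> complex) set" where
  "H1_max lam = {f \<in> L1_bessel lam.
     radial_max lam f \<in> borel_measurable (bessel_measure lam) \<and>
     (\<integral>\<^sup>+ x. radial_max lam f x \<partial>bessel_measure lam) < \<infinity>}"

definition H1_max_norm :: "real \<Rightarrow> (real \<Rightarrow> complex) \<Rightarrow> ennreal" where
  "H1_max_norm lam f =
     L1_norm lam f + (\<integral>\<^sup>+ x. radial_max lam f x \<partial>bessel_measure lam)"

definition H1_nmax :: "real \<Rightarrow> (real \<Rightarrow> complex) set" where
  "H1_nmax lam = {f \<in> L1_bessel lam.
     nontangential_max lam f \<in> borel_measurable (bessel_measure lam) \<and>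
     (\<integral>\<^sup>+ x. nontangential_max lam f x \<partial>bessel_measure lam) < \<infinity>}"

definition H1_nmax_norm :: "real \<Rightarrow> (real \<Rightarrow> complex) \<Rightarrow> ennreal" where
  "H1_nmax_norm lam f =
     L1_norm lam f + (\<integral>\<^sup>+ x. nontangential_max lam f x \<partial>bessel_measure lam)"

end

theory Submission
  imports Defs
begin

text \<open>The argument avoids the elliptic equation and its mean value property. The Poisson kernels form a
  semigroup (up to a constant, which is all that is needed): they are mixtures of heat kernels, for
  which the semigroup law is a power series identity resting on Vandermonde's convolution, and the mixing
  densities convolve correctly by the substitution \<open>w = a / sqrt p - b sqrt p\<close>. Hence
  \<open>u(y, 2s) = \<integral> P\<^sub>s(y, z) u(z, s) dm(z)\<close>. Writing \<open>\<bar>u\<bar> = \<bar>u\<bar>\<^bsup>r\<^esup> \<bar>u\<bar>\<^bsup>1-r\<^esup>\<close> with \<open>r\<close> slightly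
  below \<open>1\<close>, the first factor is bounded by the radial maximal function and the second by a tangential
  maximal function of \<open>u\<close> which can be absorbed. The decay of the kernel then bounds the nontangential maximal
  function by \<open>M((R f)\<^bsup>r\<^esup>)\<^bsup>1/r\<^esup>\<close>, where \<open>M\<close> is the Hardy-Littlewood maximal operator of the doubling
  measure, and \<open>M\<close> is bounded on \<open>L\<^bsup>1/r\<^esup>\<close>.\<close>

section \<open>The measure and a change of variables\<close>

text \<open>The exponent r must be below 1 because the maximal operator fails on \<open>L^1\<close>:
  bounding the whole of \<bar>u(z, s)\<bar> by R f(z) would give only M(R f), which need not be
  integrable. The power 1 - r left over has to be estimated at all points z, however far from the
  cone at x, and this is why a tangential rather than a nontangential supremum appears; its weight
  grows with the distance and uses up part of the kernel's decay, so that 1 - r has to be small.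
  Absorption divides by a power of that supremum, hence needs it finite, although u blows up as t
  tends to 0 for general integrable f. Everything is therefore done for u shifted upwards, with
  constants independent of the shift. The pointwise argument fixes x and a number M bounding the
  averages over balls centred at x; the maximal function itself is never formed. The kernel
  identities are stated with extended nonnegative integrals, where interchanging integrals and
  series requires measurability alone.\<close>

lemma space_bessel [simp]: "space (bessel_measure lam) = {0<..}"
  by (simp add: bessel_measure_def)

lemma borel_measurable_bessel_of_borel:
  assumes "f \<in> borel_measurable borel"
  shows "f \<in> borel_measurable (bessel_measure lam)"
proof -
  have "f \<in> borel_measurable (lebesgue_on {0<..})"
    using assms by (intro measurable_restrict_space1) (simp add: measurable_completion)
  thus ?thesis by (simp add: bessel_measure_def)
qed

lemma borel_measurable_bessel_id: "(\<lambda>x. x) \<in> measurable (bessel_measure lam) borel"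
  by (rule borel_measurable_bessel_of_borel) simp

lemma nn_integral_bessel:
  assumes "f \<in> borel_measurable borel"
  shows "(\<integral>\<^sup>+x. f x \<partial>bessel_measure lam) =
    (\<integral>\<^sup>+x. ennreal (x powr (2 * lam)) * f x * indicator {0<..} x \<partial>lborel)"
proof -
  have [measurable]: "f \<in> borel_measurable lborel" using assms by simp
  have m: "f \<in> borel_measurable (lebesgue_on {0<..})"
    using assms by (intro measurable_restrict_space1) (simp add: measurable_completion)
  have m2: "(\<lambda>x. ennreal (x powr (2*lam))) \<in> borel_measurable (lebesgue_on {0<..})"
    by (intro measurable_restrict_space1 measurable_completion) auto
  show ?thesis
    unfolding bessel_measure_def
    by (subst nn_integral_density[OF m2 m], subst nn_integral_restrict_space)
       (simp_all add: nn_integral_completion)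
qed

lemma sigma_finite_measure_completion:
  assumes "sigma_finite_measure M"
  shows "sigma_finite_measure (completion M)"
proof -
  interpret sigma_finite_measure M by fact
  obtain A where "countable A" "A \<subseteq> sets M" "\<Union>A = space M" "\<forall>a\<in>A. emeasure M a \<noteq> \<infinity>"
    using sigma_finite_countable by blast
  thus ?thesis
    by (intro sigma_finite_measure.intro exI[of _ A]) auto
qed

lemma sigma_finite_bessel: "sigma_finite_measure (bessel_measure lam)"
proof -
  have "{0<..} \<in> sets (lebesgue :: real measure)"
    by (rule sets_completionI_sets) simp
  note S = this
  interpret L: sigma_finite_measure "lebesgue_on {0::real<..}"
    by (rule sigma_finite_measure_restrict_space)
       (auto intro!: sigma_finite_measure_completion lborel.sigma_finite_measure_axioms S)
  have m2: "(\<lambda>x. ennreal (x powr (2*lam))) \<in> borel_measurable (lebesgue_on {0<..})"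
    by (intro measurable_restrict_space1 measurable_completion) auto
  show ?thesis unfolding bessel_measure_def
    by (subst L.sigma_finite_iff_density_finite[OF m2]) auto
qed

text \<open>The theorem for absolutely integrable functions settles the case where one side is
  integrable. Otherwise neither is, and a nonnegative measurable function that is not integrable has
  integral \<infinity>, so both sides agree again; this is where \<open>m\<close> enters.\<close>

lemma nn_integral_change_of_variables:
  fixes f g g' :: "real \<Rightarrow> real"
  assumes S: "S \<in> sets borel" and T: "g ` S \<in> sets borel"
    and der: "\<And>x. x \<in> S \<Longrightarrow> (g has_field_derivative g' x) (at x)"
    and inj: "inj_on g S"
    and f[measurable]: "f \<in> borel_measurable borel" and nn: "\<And>x. 0 \<le> f x"
    and m: "(\<lambda>x. \<bar>g' x\<bar> * f (g x) * indicator S x) \<in> borel_measurable borel"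
  shows "(\<integral>\<^sup>+x. ennreal (f x) * indicator (g ` S) x \<partial>lborel)
       = (\<integral>\<^sup>+x. ennreal (\<bar>g' x\<bar> * f (g x)) * indicator S x \<partial>lborel)"
proof -
  have key: "(\<lambda>x. \<bar>g' x\<bar> * f(g x)) absolutely_integrable_on S \<and>
           integral S (\<lambda>x. \<bar>g' x\<bar> * f (g x)) = b
     \<longleftrightarrow> f absolutely_integrable_on (g ` S) \<and> integral (g ` S) f = b" for b
    by (rule has_absolute_integral_change_of_variables_1')
       (use S der inj in \<open>auto intro: has_field_derivative_at_within\<close>)
  have conv: "(\<integral>\<^sup>+x. ennreal (h x) * indicator U x \<partial>lborel) = ennreal (integral U h)"
    if "h absolutely_integrable_on U" "\<And>x. 0 \<le> h x" for h :: "real \<Rightarrow> real" and U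
    by (rule nn_integral_has_integral_lebesgue')
       (use that in \<open>auto simp: absolutely_integrable_on_def has_integral_iff\<close>)
  have conv2: "h absolutely_integrable_on U"
    if "(\<integral>\<^sup>+x. ennreal (h x) * indicator U x \<partial>lborel) < \<infinity>" "\<And>x. 0 \<le> h x"
      "(\<lambda>x. h x * indicator U x) \<in> borel_measurable borel" for h :: "real \<Rightarrow> real" and U
  proof -
    have "integrable lborel (\<lambda>x. h x * indicator U x)"
    proof (rule integrableI_bounded)
      show "(\<lambda>x. h x * indicator U x) \<in> borel_measurable lborel" using that(3) by simp
      have "(\<integral>\<^sup>+x. ennreal (norm (h x * indicator U x)) \<partial>lborel) =
         (\<integral>\<^sup>+x. ennreal (h x) * indicator U x \<partial>lborel)"
        by (intro nn_integral_cong) (auto simp: indicator_def that(2))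
      thus "(\<integral>\<^sup>+x. ennreal (norm (h x * indicator U x)) \<partial>lborel) < \<infinity>" using that(1) by simp
    qed
    hence "integrable lebesgue (\<lambda>x. h x * indicator U x)"
      by (rule integrable_completion[THEN iffD2, rotated]) (use that(3) in simp)
    thus ?thesis unfolding set_integrable_def by (simp add: mult.commute)
  qed
  have m2: "(\<lambda>x. f x * indicator (g ` S) x) \<in> borel_measurable borel"
    using T by measurable
  show ?thesis
  proof (cases "f absolutely_integrable_on (g ` S)")
    case True
    with key[of "integral (g ` S) f"] conv[of "g ` S" f] conv[of S "\<lambda>x. \<bar>g' x\<bar> * f (g x)"]
    show ?thesis using nn by auto
  next
    case False
    with key have "\<not> (\<lambda>x. \<bar>g' x\<bar> * f(g x)) absolutely_integrable_on S" by blast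
    with conv2[of "\<lambda>x. \<bar>g' x\<bar> * f (g x)" S, OF _ _ m] nn
    have "(\<integral>\<^sup>+x. ennreal (\<bar>g' x\<bar> * f (g x)) * indicator S x \<partial>lborel) = \<infinity>"
      by (metis (no_types, lifting) top.not_eq_extremum infinity_ennreal_def abs_ge_zero mult_nonneg_nonneg)
    moreover from False conv2[of f "g ` S", OF _ _ m2] nn
    have "(\<integral>\<^sup>+x. ennreal (f x) * indicator (g ` S) x \<partial>lborel) = \<infinity>"
      by (metis (no_types, lifting) top.not_eq_extremum infinity_ennreal_def abs_ge_zero mult_nonneg_nonneg)
    ultimately show ?thesis by simp
  qed
qed

section \<open>Size of the Poisson kernel\<close>

text \<open>By the law of cosines, \<open>t^2\<close> plus the squared distance of two points of the
  plane at radii \<open>x\<close> and \<open>y\<close> that enclose the angle \<theta>.\<close>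

definition poisson_denom :: "real \<Rightarrow> real \<Rightarrow> real \<Rightarrow> real \<Rightarrow> real" where
  "poisson_denom t x y \<theta> = x^2 + y^2 + t^2 - 2 * x * y * cos \<theta>"

lemma poisson_denom_ge: "t^2 \<le> poisson_denom t x y \<theta>"
proof -
  have "x^2 + y^2 - 2 * x * y * cos \<theta> = (x - y * cos \<theta>)^2 + (y * sin \<theta>)^2"
    by (simp add: power2_diff power_mult_distrib sin_squared_eq algebra_simps)
  thus ?thesis unfolding poisson_denom_def by (smt (verit) zero_le_power2)
qed

lemma poisson_denom_pos: "t > 0 \<Longrightarrow> 0 < poisson_denom t x y \<theta>"
  using poisson_denom_ge[of t x y \<theta>] zero_less_power[of t 2] by linarith

text \<open>Trading \<open>2 * (1 - cos \<theta>)\<close> for \<open>(sin \<theta>)^2\<close> gives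
  up only the square of \<open>1 - cos \<theta>\<close> and leads to a denominator for which the
  integrand times \<open>cos \<theta>\<close> has an explicit primitive.\<close>

lemma poisson_denom_ge_sin:
  assumes "0 \<le> x * y"
  shows "(x - y)^2 + t^2 + x * y * (sin \<theta>)^2 \<le> poisson_denom t x y \<theta>"
proof -
  have "2 * (1 - cos \<theta>) - (sin \<theta>)^2 = (1 - cos \<theta>)^2"
    by (simp add: power2_diff sin_squared_eq)
  hence "(sin \<theta>)^2 \<le> 2 * (1 - cos \<theta>)" by (smt (verit) zero_le_power2)
  hence "x * y * (sin \<theta>)^2 \<le> x * y * (2 * (1 - cos \<theta>))" by (intro mult_left_mono assms)
  thus ?thesis by (simp add: poisson_denom_def power2_diff algebra_simps)
qed

context
  fixes lam :: real
  assumes lam: "lam > 0"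
begin

text \<open>Away from the middle of the interval one may insert a factor \<open>2 \<bar>cos \<theta>\<bar>\<close>, which makes
  the integrand the derivative of a multiple of \<open>((sin \<theta>)\<^sup>2 / (E + c (sin \<theta>)\<^sup>2)) powr lam\<close>.\<close>

lemma nn_integral_sin_quotient_le:
  assumes E: "E > 0" and c: "c \<ge> 0"
  shows "(\<integral>\<^sup>+\<theta>. ennreal (sin \<theta> powr (2 * lam - 1) / (E + c * (sin \<theta>)^2) powr (lam + 1))
            * indicator {0<..<pi} \<theta> \<partial>lborel)
         \<le> ennreal ((2 / lam + 2 * pi * 4 powr (lam + 1)) / (E * (E + c) powr lam))"
proof -
  let ?d = "\<lambda>\<theta>. E + c * (sin \<theta>)^2"
  define G where "G = (\<lambda>\<theta>. ((sin \<theta>)^2 / ?d \<theta>) powr lam)"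
  define h where "h = (\<lambda>\<theta>. sin \<theta> powr (2 * lam - 1) / ?d \<theta> powr (lam + 1))"
  have d: "?d \<theta> > 0" for \<theta> using E c by (simp add: add_pos_nonneg)
  have contG: "continuous_on A G" for A
    unfolding G_def using d lam E c
    by (intro continuous_on_powr' continuous_intros) (auto simp: less_imp_le less_imp_neq[THEN not_sym])
  have derG: "(G has_field_derivative 2 * lam * E * (h \<theta> * cos \<theta>)) (at \<theta>)"
    if "0 < \<theta>" "\<theta> < pi" for \<theta>
  proof -
    have s: "sin \<theta> > 0" using that by (rule sin_gt_zero)
    have q: "(sin \<theta>)^2 / ?d \<theta> > 0" using s d[of \<theta>] by simp
    have "((\<lambda>\<theta>. (sin \<theta>)^2 / ?d \<theta>) has_field_derivative
        2 * sin \<theta> * cos \<theta> * E / (?d \<theta>)^2) (at \<theta>)"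
      using d[of \<theta>] by (auto intro!: derivative_eq_intros simp: power2_eq_square field_simps)
    from DERIV_fun_powr[OF this q, of lam]
    have D: "(G has_field_derivative lam * ((sin \<theta>)^2 / ?d \<theta>) powr (lam - 1)
        * (2 * sin \<theta> * cos \<theta> * E / (?d \<theta>)^2)) (at \<theta>)"
      by (simp add: G_def)
    have alg: "lam * A * (2 * s * c' * E / Q) = 2 * lam * E * ((A * (s / Q)) * c')" for A s c' Q :: real
      by simp
    have "((sin \<theta>)^2 / ?d \<theta>) powr (lam - 1) * (sin \<theta> / (?d \<theta>)^2) = h \<theta>"
    proof -
      have "((sin \<theta>)^2 / ?d \<theta>) powr (lam - 1)
          = sin \<theta> powr (2 * lam - 2) * ?d \<theta> powr (1 - lam)"
        using s d[of \<theta>]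
        by (simp add: powr_divide powr_power powr_minus_divide[symmetric] powr_numeral[symmetric] powr_powr algebra_simps
             divide_powr_uminus del: powr_numeral)
      hence "((sin \<theta>)^2 / ?d \<theta>) powr (lam - 1) * (sin \<theta> / (?d \<theta>)^2)
          = (sin \<theta> powr (2 * lam - 2) * sin \<theta>) * (?d \<theta> powr (1 - lam) / (?d \<theta>)^2)"
        by simp
      also have "sin \<theta> powr (2 * lam - 2) * sin \<theta> = sin \<theta> powr (2 * lam - 1)"
        using s powr_add[of "sin \<theta>" "2 * lam - 2" 1] by simp
      also have "?d \<theta> powr (1 - lam) / (?d \<theta>)^2 = 1 / ?d \<theta> powr (lam + 1)"
        using d[of \<theta>] powr_diff[of "?d \<theta>" "1 - lam" 2]
        by (simp add: powr_minus_divide[symmetric] algebra_simps)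
      finally show ?thesis by (simp add: h_def)
    qed
    hence "lam * ((sin \<theta>)^2 / ?d \<theta>) powr (lam - 1) * (2 * sin \<theta> * cos \<theta> * E / (?d \<theta>)^2)
        = 2 * lam * E * (h \<theta> * cos \<theta>)"
      unfolding alg by (rule arg_cong)
    with D show ?thesis by (rule DERIV_cong)
  qed
  have h0: "h \<theta> \<ge> 0" for \<theta> unfolding h_def by simp
  have Gends: "G 0 = 0" "G pi = 0" "G (pi/2) = 1 / (E + c) powr lam"
    using E c by (simp_all add: G_def powr_divide)
  \<comment> \<open>The interval is split at \<open>pi/2\<close>, where the cosine changes sign.
    \<open>G\<close> vanishes at both ends, so each half contributes the value of \<open>G\<close>
    in the middle. Differentiability is available in the interior only.\<close>
  have I1: "((\<lambda>\<theta>. 2 * lam * E * (h \<theta> * cos \<theta>)) has_integral (G (pi/2) - G 0)) {0..pi/2}"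
    by (rule fundamental_theorem_of_calculus_interior[OF _ contG])
       (use derG in \<open>auto simp: has_real_derivative_iff_has_vector_derivative[symmetric]\<close>)
  have I2: "((\<lambda>\<theta>. 2 * lam * E * (h \<theta> * cos \<theta>)) has_integral (G pi - G (pi/2))) {pi/2..pi}"
    by (rule fundamental_theorem_of_calculus_interior[OF _ contG])
       (use derG in \<open>auto simp: has_real_derivative_iff_has_vector_derivative[symmetric]\<close>)
  have I1': "((\<lambda>\<theta>. h \<theta> * \<bar>cos \<theta>\<bar>) has_integral (1 / (2 * lam * E * (E + c) powr lam))) {0..pi/2}"
  proof -
    have "((\<lambda>\<theta>. (1 / (2 * lam * E)) * (2 * lam * E * (h \<theta> * cos \<theta>))) has_integral
        ((1 / (2 * lam * E)) * (G (pi/2) - G 0))) {0..pi/2}"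
      by (rule has_integral_mult_right[OF I1])
    thus ?thesis
      by (rule has_integral_eq[rotated, where f = "\<lambda>\<theta>. (1 / (2 * lam * E)) * (2 * lam * E * (h \<theta> * cos \<theta>))", THEN has_integral_eq_rhs])
         (use lam E Gends in \<open>auto simp: cos_ge_zero\<close>)
  qed
  have I2': "((\<lambda>\<theta>. h \<theta> * \<bar>cos \<theta>\<bar>) has_integral (1 / (2 * lam * E * (E + c) powr lam))) {pi/2..pi}"
  proof -
    have "((\<lambda>\<theta>. (- 1 / (2 * lam * E)) * (2 * lam * E * (h \<theta> * cos \<theta>))) has_integral
        ((- 1 / (2 * lam * E)) * (G pi - G (pi/2)))) {pi/2..pi}"
      by (rule has_integral_mult_right[OF I2])
    moreover have c: "\<bar>cos \<theta>\<bar> = - cos \<theta>" if "pi \<le> \<theta> * 2" "\<theta> \<le> pi" for \<theta>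
      using cos_monotone_0_pi_le[of "pi/2" \<theta>] that by simp
    ultimately show ?thesis
      by (elim has_integral_eq[rotated, where f = "\<lambda>\<theta>. (- 1 / (2 * lam * E)) * (2 * lam * E * (h \<theta> * cos \<theta>))", THEN has_integral_eq_rhs])
         (use lam E Gends in \<open>auto simp: c\<close>)
  qed
  have "((\<lambda>\<theta>. h \<theta> * \<bar>cos \<theta>\<bar>) has_integral
      (1 / (2 * lam * E * (E + c) powr lam) + 1 / (2 * lam * E * (E + c) powr lam))) {0..pi}"
    by (rule has_integral_combine[OF _ _ I1' I2']) auto
  hence I: "((\<lambda>\<theta>. h \<theta> * \<bar>cos \<theta>\<bar>) has_integral (1 / (lam * E * (E + c) powr lam))) {0..pi}"
    by (simp add: mult_ac)
  have bound: "h \<theta> \<le> 2 * (h \<theta> * \<bar>cos \<theta>\<bar>) + 2 * 4 powr (lam + 1) / (E * (E + c) powr lam)"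
    if "0 < \<theta>" "\<theta> < pi" for \<theta>
  proof (cases "\<bar>cos \<theta>\<bar> \<ge> 1/2")
    case True
    hence "h \<theta> * 1 \<le> h \<theta> * (2 * \<bar>cos \<theta>\<bar>)" by (intro mult_left_mono h0) auto
    moreover have "0 \<le> 2 * 4 powr (lam + 1) / (E * (E + c) powr lam)" using E by simp
    ultimately show ?thesis by linarith
  next
    \<comment> \<open>Near the middle the sine is at least \<open>1/2\<close>, so the denominator is
      comparable to \<open>E + c\<close> and the integrand is bounded by a constant.\<close>
    case False
    hence "(cos \<theta>)^2 \<le> (1/2)^2" by (intro power2_le_iff_abs_le[THEN iffD2]) auto
    hence s2: "(sin \<theta>)^2 \<ge> 1/4" unfolding sin_squared_eq by (simp add: power_divide)
    have s: "sin \<theta> > 0" using that by (rule sin_gt_zero)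
    have s3: "sin \<theta> \<ge> 1/2"
      by (rule power2_le_imp_le) (use s2 s in \<open>auto simp: power2_eq_square\<close>)
    \<comment> \<open>For \<open>lam < 1/2\<close> the exponent is negative; since the sine is at
      most 1, lowering the exponent to -1 covers every \<open>lam > 0\<close>.\<close>
    have "sin \<theta> powr (2 * lam - 1) \<le> sin \<theta> powr (-1)"
      using s lam by (intro powr_mono') auto
    also have "\<dots> = 1 / sin \<theta>" using s by (simp add: powr_minus_divide)
    also have "\<dots> \<le> 2" using s3 s by (simp add: field_simps)
    finally have p: "sin \<theta> powr (2 * lam - 1) \<le> 2" .
    have "c * (1/4) \<le> c * (sin \<theta>)^2" by (intro mult_left_mono s2 c)
    hence "(E + c) / 4 \<le> ?d \<theta>" using E by simp
    hence "((E + c) / 4) powr (lam + 1) \<le> ?d \<theta> powr (lam + 1)"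
      using E c lam by (intro powr_mono2) auto
    hence "h \<theta> \<le> 2 / (((E + c) / 4) powr (lam + 1))"
      unfolding h_def using p d[of \<theta>] E c by (intro frac_le) auto
    also have "\<dots> = 2 * 4 powr (lam + 1) / ((E + c) * (E + c) powr lam)"
      using E c by (simp add: powr_divide powr_add)
    also have "\<dots> \<le> 2 * 4 powr (lam + 1) / (E * (E + c) powr lam)"
      using E c by (intro divide_left_mono mult_right_mono mult_pos_pos) auto
    finally show ?thesis using h0[of \<theta>] by (smt (verit) abs_ge_zero mult_nonneg_nonneg)
  qed
  let ?B = "2 * 4 powr (lam + 1) / (E * (E + c) powr lam)"
  have [measurable]: "h \<in> borel_measurable borel" unfolding h_def by measurable
  have "(\<integral>\<^sup>+\<theta>. ennreal (h \<theta>) * indicator {0<..<pi} \<theta> \<partial>lborel)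
      \<le> (\<integral>\<^sup>+\<theta>. ennreal 2 * (ennreal (h \<theta> * \<bar>cos \<theta>\<bar>) * indicator {0..pi} \<theta>)
           + ennreal ?B * indicator {0..pi} \<theta> \<partial>lborel)"
  proof (intro nn_integral_mono)
    fix \<theta> :: real
    show "ennreal (h \<theta>) * indicator {0<..<pi} \<theta> \<le> ennreal 2 * (ennreal (h \<theta> * \<bar>cos \<theta>\<bar>) * indicator {0..pi} \<theta>)
           + ennreal ?B * indicator {0..pi} \<theta>"
    proof (cases "\<theta> \<in> {0<..<pi}")
      case True
      have "ennreal (h \<theta>) \<le> ennreal (2 * (h \<theta> * \<bar>cos \<theta>\<bar>) + ?B)"
        using True by (intro ennreal_leI bound) auto
      also have "\<dots> = ennreal 2 * ennreal (h \<theta> * \<bar>cos \<theta>\<bar>) + ennreal ?B"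
        using h0[of \<theta>] E by (subst ennreal_plus) (auto simp: ennreal_mult)
      finally show ?thesis using True by simp
    qed auto
  qed
  also have "\<dots> = ennreal 2 * (\<integral>\<^sup>+\<theta>. ennreal (h \<theta> * \<bar>cos \<theta>\<bar>) * indicator {0..pi} \<theta> \<partial>lborel)
      + ennreal ?B * emeasure lborel {0..pi}"
    by (subst nn_integral_add) (auto simp: nn_integral_cmult)
  also have "(\<integral>\<^sup>+\<theta>. ennreal (h \<theta> * \<bar>cos \<theta>\<bar>) * indicator {0..pi} \<theta> \<partial>lborel)
      = ennreal (1 / (lam * E * (E + c) powr lam))"
    by (rule nn_integral_has_integral_lebesgue'[OF _ I]) (use h0 in auto)
  also have "ennreal 2 * \<dots> + ennreal ?B * emeasure lborel {0..pi}
      = ennreal (2 * (1 / (lam * E * (E + c) powr lam)) + ?B * pi)"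
    using E lam by (simp add: ennreal_mult del: times_divide_eq_right times_divide_eq_left)
  also have "2 * (1 / (lam * E * (E + c) powr lam)) + ?B * pi
      = (2 / lam + 2 * pi * 4 powr (lam + 1)) / (E * (E + c) powr lam)"
    by (simp add: add_divide_distrib mult_ac)
  finally show ?thesis by (simp add: h_def)
qed

text \<open>For \<open>lam < 1/2\<close> the integrand is unbounded at both ends; its integrability
  is the case \<open>E = 1\<close>, \<open>c = 0\<close> of the preceding bound.\<close>

lemma set_integrable_sin_powr: "set_integrable lborel {0<..<pi} (\<lambda>\<theta>. sin \<theta> powr (2 * lam - 1))"
  unfolding set_integrable_def
proof (rule integrableI_bounded)
  show "(\<lambda>\<theta>. indicat_real {0<..<pi} \<theta> *\<^sub>R sin \<theta> powr (2 * lam - 1)) \<in> borel_measurable lborel"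
    by measurable
  have "(\<integral>\<^sup>+\<theta>. ennreal (norm (indicat_real {0<..<pi} \<theta> *\<^sub>R sin \<theta> powr (2 * lam - 1))) \<partial>lborel)
    = (\<integral>\<^sup>+\<theta>. ennreal (sin \<theta> powr (2 * lam - 1) / (1 + 0 * (sin \<theta>)^2) powr (lam + 1))
            * indicator {0<..<pi} \<theta> \<partial>lborel)"
    by (intro nn_integral_cong) (auto simp: indicator_def)
  also have "\<dots> < \<infinity>"
    using nn_integral_sin_quotient_le[of 1 0] by (simp add: le_less_trans)
  finally show "(\<integral>\<^sup>+\<theta>. ennreal (norm (indicat_real {0<..<pi} \<theta> *\<^sub>R sin \<theta> powr (2 * lam - 1))) \<partial>lborel) < \<infinity>" .
qed

text \<open>A majorant free of \<open>x\<close> and \<open>y\<close>, as dominated convergence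
  demands for the continuity of the kernel.\<close>

lemma poisson_integrand_le:
  assumes "t > 0"
  shows "sin \<theta> powr (2 * lam - 1) / poisson_denom t x y \<theta> powr (lam + 1)
      \<le> sin \<theta> powr (2 * lam - 1) / (t^2) powr (lam + 1)"
  using assms lam poisson_denom_ge[of t x y \<theta>]
  by (intro divide_left_mono powr_mono2 mult_pos_pos) (auto simp: poisson_denom_pos less_imp_neq[OF poisson_denom_pos, symmetric])

lemma set_integrable_poisson_integrand:
  assumes "t > 0"
  shows "set_integrable lborel {0<..<pi}
    (\<lambda>\<theta>. sin \<theta> powr (2 * lam - 1) / poisson_denom t x y \<theta> powr (lam + 1))"
proof (rule set_integrable_bound)
  show "set_integrable lborel {0<..<pi} (\<lambda>\<theta>. sin \<theta> powr (2 * lam - 1) / (t^2) powr (lam + 1))"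
    using set_integrable_sin_powr by (simp add: set_integrable_def)
  show "set_borel_measurable lborel {0<..<pi}
    (\<lambda>\<theta>. sin \<theta> powr (2 * lam - 1) / poisson_denom t x y \<theta> powr (lam + 1))"
    unfolding set_borel_measurable_def poisson_denom_def by measurable
  show "AE \<theta> in lborel. \<theta> \<in> {0<..<pi} \<longrightarrow>
     norm (sin \<theta> powr (2 * lam - 1) / poisson_denom t x y \<theta> powr (lam + 1))
     \<le> norm (sin \<theta> powr (2 * lam - 1) / (t^2) powr (lam + 1))"
    using poisson_integrand_le[OF assms] by (intro AE_I2) simp
qed

section \<open>Positivity, continuity and decay of the kernel\<close>

lemma poisson_kernel_eq:
  "poisson_kernel lam t x y = 2 * lam * t / pi *
     (LBINT \<theta>:{0<..<pi}. sin \<theta> powr (2 * lam - 1) / poisson_denom t x y \<theta> powr (lam + 1))"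
  by (simp add: poisson_kernel_def poisson_denom_def)

lemma poisson_kernel_nonneg: "t > 0 \<Longrightarrow> 0 \<le> poisson_kernel lam t x y"
  unfolding poisson_kernel_eq set_lebesgue_integral_def
  using lam by (intro mult_nonneg_nonneg integral_nonneg_AE AE_I2) auto

lemma poisson_kernel_nn_integral:
  assumes t: "t > 0"
  shows "ennreal (poisson_kernel lam t x y) = ennreal (2 * lam * t / pi) *
     (\<integral>\<^sup>+\<theta>. ennreal (sin \<theta> powr (2 * lam - 1) / poisson_denom t x y \<theta> powr (lam + 1))
         * indicator {0<..<pi} \<theta> \<partial>lborel)"
proof -
  have "(\<integral>\<^sup>+\<theta>. ennreal (sin \<theta> powr (2 * lam - 1) / poisson_denom t x y \<theta> powr (lam + 1))
         * indicator {0<..<pi} \<theta> \<partial>lborel)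
      = (\<integral>\<^sup>+\<theta>. ennreal (indicat_real {0<..<pi} \<theta> *\<^sub>R (sin \<theta> powr (2 * lam - 1) / poisson_denom t x y \<theta> powr (lam + 1))) \<partial>lborel)"
    by (intro nn_integral_cong) (auto simp: indicator_def)
  also have "\<dots> = ennreal (LBINT \<theta>:{0<..<pi}. sin \<theta> powr (2 * lam - 1) / poisson_denom t x y \<theta> powr (lam + 1))"
    unfolding set_lebesgue_integral_def
    using set_integrable_poisson_integrand[OF t, of x y]
    by (intro nn_integral_eq_integral) (auto simp: set_integrable_def)
  finally show ?thesis
    unfolding poisson_kernel_eq using lam t by (subst ennreal_mult') auto
qed

lemma continuous_poisson_kernel:
  assumes t: "t > 0"
  shows "continuous_on UNIV (\<lambda>(x, y). poisson_kernel lam t x y)"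
proof -
  have "(\<lambda>n. poisson_kernel lam t (fst (s n)) (snd (s n))) \<longlonglongrightarrow> poisson_kernel lam t (fst p) (snd p)"
    if s: "s \<longlonglongrightarrow> p" for s :: "nat \<Rightarrow> real \<times> real" and p
  proof -
    have "(\<lambda>n. LBINT \<theta>:{0<..<pi}. sin \<theta> powr (2 * lam - 1) / poisson_denom t (fst (s n)) (snd (s n)) \<theta> powr (lam + 1))
       \<longlonglongrightarrow> (LBINT \<theta>:{0<..<pi}. sin \<theta> powr (2 * lam - 1) / poisson_denom t (fst p) (snd p) \<theta> powr (lam + 1))"
      unfolding set_lebesgue_integral_def
    proof (rule integral_dominated_convergence)
      show "integrable lborel (\<lambda>\<theta>. indicat_real {0<..<pi} \<theta> *\<^sub>R (sin \<theta> powr (2 * lam - 1) / (t^2) powr (lam + 1)))"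
        using set_integrable_sin_powr by (simp add: set_integrable_def)
      show "AE \<theta> in lborel. (\<lambda>n. indicat_real {0<..<pi} \<theta> *\<^sub>R (sin \<theta> powr (2 * lam - 1) / poisson_denom t (fst (s n)) (snd (s n)) \<theta> powr (lam + 1)))
          \<longlonglongrightarrow> indicat_real {0<..<pi} \<theta> *\<^sub>R (sin \<theta> powr (2 * lam - 1) / poisson_denom t (fst p) (snd p) \<theta> powr (lam + 1))"
      proof (rule AE_I2)
        fix \<theta>
        have "(\<lambda>n. poisson_denom t (fst (s n)) (snd (s n)) \<theta>) \<longlonglongrightarrow> poisson_denom t (fst p) (snd p) \<theta>"
          unfolding poisson_denom_def using s by (intro tendsto_intros)
        thus "(\<lambda>n. indicat_real {0<..<pi} \<theta> *\<^sub>R (sin \<theta> powr (2 * lam - 1) / poisson_denom t (fst (s n)) (snd (s n)) \<theta> powr (lam + 1)))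
          \<longlonglongrightarrow> indicat_real {0<..<pi} \<theta> *\<^sub>R (sin \<theta> powr (2 * lam - 1) / poisson_denom t (fst p) (snd p) \<theta> powr (lam + 1))"
          using poisson_denom_pos[OF t, of "fst p" "snd p" \<theta>]
          by (intro tendsto_intros) auto
      qed
      show "AE \<theta> in lborel. norm (indicat_real {0<..<pi} \<theta> *\<^sub>R (sin \<theta> powr (2 * lam - 1) / poisson_denom t (fst (s n)) (snd (s n)) \<theta> powr (lam + 1)))
         \<le> indicat_real {0<..<pi} \<theta> *\<^sub>R (sin \<theta> powr (2 * lam - 1) / (t^2) powr (lam + 1))" for n
        using poisson_integrand_le[OF t] by (intro AE_I2) (auto simp: indicator_def)
    qed (auto simp: poisson_denom_def)
    thus ?thesis unfolding poisson_kernel_eq by (rule tendsto_mult_left)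
  qed
  thus ?thesis
    by (auto simp: continuous_on_sequentially case_prod_beta comp_def)
qed

lemma measurable_poisson_kernel:
  assumes t: "t > 0" and [measurable]: "g \<in> borel_measurable M" "h \<in> borel_measurable M"
  shows "(\<lambda>x. poisson_kernel lam t (g x) (h x)) \<in> borel_measurable M"
proof -
  have "(\<lambda>(x, y). poisson_kernel lam t x y) \<in> borel_measurable (borel :: (real \<times> real) measure)"
    by (rule borel_measurable_continuous_onI[OF continuous_poisson_kernel[OF t]])
  hence [measurable]: "(\<lambda>(x, y). poisson_kernel lam t x y) \<in> borel_measurable (borel \<Otimes>\<^sub>M borel)"
    by (simp add: borel_prod)
  have "(\<lambda>x. (\<lambda>(x, y). poisson_kernel lam t x y) (g x, h x)) \<in> borel_measurable M"
    by measurable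
  thus ?thesis by simp
qed

text \<open>The right-hand side is comparable to \<open>t / (\<rho> m(B(x, \<rho>)))\<close> with \<open>\<rho> = t + \<bar>x - y\<bar>\<close>.\<close>

lemma poisson_kernel_le:
  obtains C where "C > 0" "\<And>t x y. t > 0 \<Longrightarrow> x > 0 \<Longrightarrow> y > 0 \<Longrightarrow>
    poisson_kernel lam t x y \<le> C * (t / ((t + \<bar>x - y\<bar>)^2 * (x + (t + \<bar>x - y\<bar>)) powr (2 * lam)))"
proof
  define A where "A = 2 / lam + 2 * pi * 4 powr (lam + 1)"
  have A: "A > 0" using lam by (simp add: A_def add_pos_pos)
  let ?C = "2 * lam / pi * (A * (2 * 6 powr lam))"
  show "?C > 0" using A lam by simp
  fix t x y :: real assume t: "t > 0" and x: "x > 0" and y: "y > 0"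
  define E where "E = (x - y)^2 + t^2"
  define \<rho> where "\<rho> = t + \<bar>x - y\<bar>"
  have \<rho>: "\<rho> > 0" using t by (simp add: \<rho>_def add_pos_nonneg)
  have xy: "x * y > 0" using x y by simp
  have E: "E > 0" using t by (simp add: E_def add_nonneg_pos)
  have E\<rho>: "\<rho>^2 \<le> 2 * E"
  proof -
    have "2 * E - \<rho>^2 = (t - \<bar>x - y\<bar>)^2" by (simp add: E_def \<rho>_def power2_eq_square algebra_simps)
    thus ?thesis by (smt (verit) zero_le_power2)
  qed
  have x\<rho>: "(x + \<rho>)^2 \<le> 6 * (E + x * y)"
  proof -
    define d where "d = \<bar>x - y\<bar>"
    have d2: "d^2 = (x - y)^2" by (simp add: d_def)
    \<comment> \<open>Because \<open>2 * x * y = x^2 + y^2 - d^2\<close>, this sum of squares is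
      exactly the difference of the two sides below; that is the origin of the constant 6.\<close>
    have "0 \<le> (x - t)^2 + (x - d)^2 + (t - d)^2 + 3 * (y^2 + t^2)" by simp
    hence "(x + (t + d))^2 \<le> 6 * (d^2 + t^2 + x * y)"
      unfolding d2 by (simp add: power2_eq_square algebra_simps d2[unfolded power2_eq_square])
    thus ?thesis by (simp add: \<rho>_def E_def d_def)
  qed
  have pos: "0 < E + x * y * (sin \<theta>)^2" for \<theta> using E xy by (intro add_pos_nonneg) auto
  have "ennreal (poisson_kernel lam t x y) \<le> ennreal (2 * lam * t / pi) *
     (\<integral>\<^sup>+\<theta>. ennreal (sin \<theta> powr (2 * lam - 1) / (E + x * y * (sin \<theta>)^2) powr (lam + 1))
         * indicator {0<..<pi} \<theta> \<partial>lborel)"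
    unfolding poisson_kernel_nn_integral[OF t] using E xy lam poisson_denom_ge_sin[of x y t]
    by (intro mult_left_mono nn_integral_mono mult_right_mono ennreal_leI divide_left_mono
        powr_mono2 mult_pos_pos)
       (auto simp: pos[unfolded E_def] E_def poisson_denom_pos[OF t] less_imp_neq[OF pos[unfolded E_def], symmetric]
         less_imp_le[OF pos[unfolded E_def]] less_imp_neq[OF poisson_denom_pos[OF t], symmetric])
  also have "\<dots> \<le> ennreal (2 * lam * t / pi) * ennreal (A / (E * (E + x * y) powr lam))"
    unfolding A_def using nn_integral_sin_quotient_le[OF E, of "x * y"] xy
    by (intro mult_left_mono) auto
  also have "\<dots> = ennreal (2 * lam * t / pi * (A / (E * (E + x * y) powr lam)))"
    using lam t A E by (subst ennreal_mult') auto
  finally have "poisson_kernel lam t x y \<le> 2 * lam * t / pi * (A / (E * (E + x * y) powr lam))"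
    using lam t A E by (subst (asm) ennreal_le_iff) auto
  also have "\<dots> \<le> 2 * lam * t / pi * (A / ((\<rho>^2 / 2) * ((x + \<rho>) powr (2 * lam) / 6 powr lam)))"
  proof -
    have "((x + \<rho>)^2 / 6) powr lam \<le> (E + x * y) powr lam"
      using x\<rho> lam by (intro powr_mono2) auto
    moreover have "((x + \<rho>)^2 / 6) powr lam = (x + \<rho>) powr (2 * lam) / 6 powr lam"
      using x \<rho> by (simp add: powr_divide powr_powr flip: powr_numeral)
    ultimately have "(x + \<rho>) powr (2 * lam) / 6 powr lam \<le> (E + x * y) powr lam" by simp
    thus ?thesis using E\<rho> E xy A lam t \<rho> x
      by (intro mult_left_mono divide_left_mono mult_mono mult_pos_pos) auto
  qed
  also have "\<dots> = ?C * (t / (\<rho>^2 * (x + \<rho>) powr (2 * lam)))"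
    by (simp add: field_simps)
  finally show "poisson_kernel lam t x y \<le> ?C * (t / ((t + \<bar>x - y\<bar>)^2 * (x + (t + \<bar>x - y\<bar>)) powr (2 * lam)))"
    by (simp add: \<rho>_def)
qed

end

section \<open>The maximal theorem\<close>

context
  fixes lam :: real
  assumes lam: "lam > 0"
begin

text \<open>Comparable to the measure of the ball.\<close>

definition ball_vol :: "real \<Rightarrow> real \<Rightarrow> real" where
  "ball_vol x r = r * (x + r) powr (2 * lam)"

lemma nn_integral_ball_le:
  assumes x: "x > 0" and r: "r > 0"
  shows "(\<integral>\<^sup>+z. indicator (ball x r) z \<partial>bessel_measure lam) \<le> ennreal (2 * ball_vol x r)"
proof -
  have "(\<integral>\<^sup>+z. indicator (ball x r) z \<partial>bessel_measure lam)
      = (\<integral>\<^sup>+z. ennreal (z powr (2 * lam)) * indicator (ball x r) z * indicator {0<..} z \<partial>lborel)"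
    by (rule nn_integral_bessel, rule borel_measurable_indicator) simp
  also have "\<dots> \<le> (\<integral>\<^sup>+z. ennreal ((x + r) powr (2 * lam)) * indicator {x - r<..<x + r} z \<partial>lborel)"
    using lam by (intro nn_integral_mono)
      (auto simp: indicator_def dist_real_def intro!: ennreal_leI powr_mono2)
  also have "\<dots> = ennreal (2 * ball_vol x r)"
    using r by (subst nn_integral_cmult_indicator) (auto simp: ennreal_mult[symmetric] ball_vol_def mult_ac)
  finally show ?thesis .
qed

lemma ball_vol_pos: "x > 0 \<Longrightarrow> r > 0 \<Longrightarrow> 0 < ball_vol x r"
  by (simp add: ball_vol_def)

text \<open>The doubling property, needed with \<open>k = 5\<close> for the Vitali enlargement and
  with \<open>k = 2\<close> in the dyadic sum.\<close>

lemma ball_vol_mult_le: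
  assumes "x > 0" "r > 0" "k \<ge> 1"
  shows "ball_vol x (k * r) \<le> k * k powr (2 * lam) * ball_vol x r"
proof -
  have "(x + k * r) powr (2 * lam) \<le> (k * (x + r)) powr (2 * lam)"
    using assms lam by (intro powr_mono2) (auto simp: algebra_simps)
  also have "\<dots> = k powr (2 * lam) * (x + r) powr (2 * lam)"
    using assms by (simp add: powr_mult)
  finally have "k * r * (x + k * r) powr (2 * lam) \<le> k * r * (k powr (2 * lam) * (x + r) powr (2 * lam))"
    using assms by (intro mult_left_mono) auto
  thus ?thesis by (simp add: ball_vol_def mult_ac)
qed

text \<open>Vitali's covering argument: disjoint balls enlarged five times cover \<open>E\<close>,
  doubling pays for the enlargement, and disjointness bounds the sum of the integrals of
  \<open>g\<close>. Since \<open>E\<close> is any measurable set of points with a large average, no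
  maximal function has to be named.\<close>

lemma maximal_weak_type:
  fixes g :: "real \<Rightarrow> ennreal"
  assumes g: "g \<in> borel_measurable (bessel_measure lam)"
    and E: "E \<in> sets (bessel_measure lam)" and a: "a > 0"
    and big: "\<And>x. x \<in> E \<Longrightarrow> \<exists>r>0. ennreal (a * ball_vol x r)
                < (\<integral>\<^sup>+z. g z * indicator (ball x r) z \<partial>bessel_measure lam)"
  shows "ennreal a * emeasure (bessel_measure lam) E
       \<le> ennreal (10 * 5 powr (2 * lam)) * (\<integral>\<^sup>+z. g z \<partial>bessel_measure lam)"
proof (cases "(\<integral>\<^sup>+z. g z \<partial>bessel_measure lam) = \<infinity>")
  case True
  thus ?thesis by (simp add: ennreal_mult_top)
next
  case False
  let ?m = "bessel_measure lam"
  have posE: "x > 0" if "x \<in> E" for x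
    using sets.sets_into_space[OF E] that by auto
  obtain I where I: "(\<integral>\<^sup>+z. g z \<partial>?m) = ennreal I" "I \<ge> 0"
    using False by (cases "(\<integral>\<^sup>+z. g z \<partial>?m)") auto
  obtain r where r: "\<And>x. x \<in> E \<Longrightarrow> r x > 0" "\<And>x. x \<in> E \<Longrightarrow>
      ennreal (a * ball_vol x (r x)) < (\<integral>\<^sup>+z. g z * indicator (ball x (r x)) z \<partial>?m)"
    using big by metis
  \<comment> \<open>The covering lemma demands bounded radii. They are bounded because
    \<open>ball_vol x r\<close> is at least \<open>r powr (2 * lam + 1)\<close>, while
    \<open>a * ball_vol x (r x)\<close> stays below the finite integral of \<open>g\<close>.\<close>
  have rB: "r x \<le> (I / a) powr (1 / (2 * lam + 1))" if x: "x \<in> E" for x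
  proof -
    have "ennreal (a * ball_vol x (r x)) \<le> (\<integral>\<^sup>+z. g z \<partial>?m)"
      by (rule order.trans[OF less_imp_le[OF r(2)[OF x]]], intro nn_integral_mono)
         (auto simp: indicator_def)
    hence 1: "a * ball_vol x (r x) \<le> I" using I by simp
    have "r x powr (2 * lam + 1) = r x * r x powr (2 * lam)"
      using r(1)[OF x] by (simp add: powr_add)
    also have "\<dots> \<le> ball_vol x (r x)"
      unfolding ball_vol_def using r(1)[OF x] posE[OF x] lam
      by (intro mult_left_mono powr_mono2) auto
    also have "\<dots> \<le> I / a" using 1 a by (simp add: field_simps)
    finally have "(r x powr (2 * lam + 1)) powr (1 / (2 * lam + 1)) \<le> (I / a) powr (1 / (2 * lam + 1))"
      using lam by (intro powr_mono2) auto
    thus ?thesis using r(1)[OF x] lam by (simp add: powr_powr)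
  qed
  have "E \<subseteq> (\<Union>i\<in>E. ball i (r i))" using r(1) by force
  then obtain C where C: "countable C" "C \<subseteq> E"
     "pairwise (\<lambda>i j. disjnt (ball i (r i)) (ball j (r j))) C"
     "E \<subseteq> (\<Union>i\<in>C. ball i (5 * r i))"
    by (rule Vitali_covering_lemma_balls[where a = "\<lambda>x. x" and r = r and K = E and S = E
          and B = "(I / a) powr (1 / (2 * lam + 1))"]) (use r rB in auto)
  have mb: "(\<lambda>z. indicator (ball x s) z :: ennreal) \<in> borel_measurable ?m" for x s :: real
    by (intro borel_measurable_bessel_of_borel borel_measurable_indicator) simp
  have "emeasure ?m E = (\<integral>\<^sup>+z. indicator E z \<partial>?m)" using E by simp
  \<comment> \<open>The sum over the countable family is written as an integral over
    \<open>count_space C\<close>, which lets it be interchanged with the integral over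
    \<open>z\<close>.\<close>
  also have "\<dots> \<le> (\<integral>\<^sup>+z. (\<integral>\<^sup>+i. indicator (ball i (5 * r i)) z \<partial>count_space C) \<partial>?m)"
  proof (intro nn_integral_mono)
    fix z
    show "(indicator E z :: ennreal) \<le> (\<integral>\<^sup>+i. indicator (ball i (5 * r i)) z \<partial>count_space C)"
    proof (cases "z \<in> E")
      case True
      then obtain i where i: "i \<in> C" "z \<in> ball i (5 * r i)" using C(4) by blast
      have "(indicator (ball i (5 * r i)) z :: ennreal) \<le> (\<integral>\<^sup>+i. indicator (ball i (5 * r i)) z \<partial>count_space C)"
        by (rule nn_integral_ge_point[OF i(1)])
      thus ?thesis using i True by simp
    qed auto
  qed
  also have "\<dots> = (\<integral>\<^sup>+i. (\<integral>\<^sup>+z. indicator (ball i (5 * r i)) z \<partial>?m) \<partial>count_space C)"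
    using C(1) mb by (intro nn_integral_count_space_nn_integral) auto
  also have "\<dots> \<le> (\<integral>\<^sup>+i. ennreal (10 * 5 powr (2 * lam) * ball_vol i (r i)) \<partial>count_space C)"
  proof (intro nn_integral_mono)
    fix i assume "i \<in> space (count_space C)"
    hence i: "i > 0" "r i > 0" using C(2) posE r(1) by auto
    have "(\<integral>\<^sup>+z. indicator (ball i (5 * r i)) z \<partial>?m) \<le> ennreal (2 * ball_vol i (5 * r i))"
      using i by (intro nn_integral_ball_le) auto
    also have "\<dots> \<le> ennreal (10 * 5 powr (2 * lam) * ball_vol i (r i))"
      using ball_vol_mult_le[of i "r i" 5] i by (intro ennreal_leI) linarith
    finally show "(\<integral>\<^sup>+z. indicator (ball i (5 * r i)) z \<partial>?m) \<le> ennreal (10 * 5 powr (2 * lam) * ball_vol i (r i))" .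
  qed
  finally have "ennreal a * emeasure ?m E
      \<le> ennreal a * (\<integral>\<^sup>+i. ennreal (10 * 5 powr (2 * lam) * ball_vol i (r i)) \<partial>count_space C)"
    by (rule mult_left_mono) simp
  also have "\<dots> = (\<integral>\<^sup>+i. ennreal (10 * 5 powr (2 * lam)) * ennreal (a * ball_vol i (r i)) \<partial>count_space C)"
    by (subst nn_integral_cmult[symmetric]) (use a in \<open>auto simp: ennreal_mult'[symmetric] ennreal_mult''[symmetric] mult_ac\<close>)
  also have "\<dots> \<le> (\<integral>\<^sup>+i. ennreal (10 * 5 powr (2 * lam))
      * (\<integral>\<^sup>+z. g z * indicator (ball i (r i)) z \<partial>?m) \<partial>count_space C)"
    using C(2) r(2) by (intro nn_integral_mono mult_left_mono less_imp_le) auto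
  also have "\<dots> = ennreal (10 * 5 powr (2 * lam)) *
      (\<integral>\<^sup>+i. (\<integral>\<^sup>+z. g z * indicator (ball i (r i)) z \<partial>?m) \<partial>count_space C)"
    by (rule nn_integral_cmult) simp
  also have "(\<integral>\<^sup>+i. (\<integral>\<^sup>+z. g z * indicator (ball i (r i)) z \<partial>?m) \<partial>count_space C)
      = (\<integral>\<^sup>+z. (\<integral>\<^sup>+i. g z * indicator (ball i (r i)) z \<partial>count_space C) \<partial>?m)"
    using C(1) mb g by (intro nn_integral_count_space_nn_integral[symmetric]) auto
  also have "\<dots> \<le> (\<integral>\<^sup>+z. g z \<partial>?m)"
  proof (intro nn_integral_mono)
    fix z
    define D where "D = {i\<in>C. z \<in> ball i (r i)}"
    \<comment> \<open>By disjointness, at most one of the selected balls contains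
      \<open>z\<close>.\<close>
    have "finite D \<and> card D \<le> 1"
    proof -
      have "i = j" if "i \<in> D" "j \<in> D" for i j
        using that C(3) unfolding D_def pairwise_def disjnt_def by blast
      thus ?thesis by (metis card.empty card_le_Suc0_iff_eq finite.emptyI finite.insertI finite_subset One_nat_def singletonI subsetI zero_le)
    qed
    hence D: "emeasure (count_space C) D \<le> 1"
      by (subst emeasure_count_space) (auto simp: D_def)
    have "(\<integral>\<^sup>+i. g z * indicator (ball i (r i)) z \<partial>count_space C)
        = g z * (\<integral>\<^sup>+i. indicator (ball i (r i)) z \<partial>count_space C)"
      by (rule nn_integral_cmult) simp
    also have "(\<integral>\<^sup>+i. indicator (ball i (r i)) z \<partial>count_space C) = (\<integral>\<^sup>+i. indicator D i \<partial>count_space C)"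
      by (intro nn_integral_cong) (auto simp: D_def indicator_def)
    also have "\<dots> = emeasure (count_space C) D"
      by (rule nn_integral_indicator) (auto simp: D_def)
    also have "g z * \<dots> \<le> g z * 1" by (intro mult_left_mono D) simp
    finally show "(\<integral>\<^sup>+i. g z * indicator (ball i (r i)) z \<partial>count_space C) \<le> g z" by simp
  qed
  finally show ?thesis by (simp add: mult_left_mono)
qed

text \<open>The layer-cake weight, used with \<open>q = p\<close> and \<open>q = p - 1\<close>. The
  latter may be less than 1, and then the integrand is unbounded at 0; hence the fundamental theorem
  with derivatives in the interior only.\<close>

lemma nn_integral_powr_layer:
  assumes q: "q > 0" and y: "y \<ge> 0"
  shows "(\<integral>\<^sup>+a. ennreal (a powr (q - 1)) * indicator {0<..<y} a \<partial>lborel) = ennreal (y powr q / q)"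
proof -
  have "((\<lambda>a. q * a powr (q - 1)) has_integral (y powr q - 0 powr q)) {0..y}"
    by (rule fundamental_theorem_of_calculus_interior[OF y continuous_on_powr'])
       (use q y in \<open>auto intro!: continuous_on_id continuous_on_const derivative_eq_intros
          simp: has_real_derivative_iff_has_vector_derivative[symmetric]\<close>)
  from has_integral_mult_right[OF this, of "1 / q"]
  have "((\<lambda>a. a powr (q - 1)) has_integral (y powr q / q)) {0..y}" using q by simp
  hence "(\<integral>\<^sup>+a. ennreal (a powr (q - 1)) * indicator {0..y} a \<partial>lborel) = ennreal (y powr q / q)"
    by (rule nn_integral_has_integral_lebesgue'[rotated]) simp
  moreover have "(\<integral>\<^sup>+a. ennreal (a powr (q - 1)) * indicator {0..y} a \<partial>lborel)
     = (\<integral>\<^sup>+a. ennreal (a powr (q - 1)) * indicator {0<..<y} a \<partial>lborel)"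
  proof (rule nn_integral_cong_AE)
    show "AE a in lborel. ennreal (a powr (q - 1)) * indicator {0..y} a
        = ennreal (a powr (q - 1)) * indicator {0<..<y} a"
      using AE_lborel_singleton[of 0] AE_lborel_singleton[of y]
      by eventually_elim (auto simp: indicator_def)
  qed
  ultimately show ?thesis by simp
qed

text \<open>Marcinkiewicz interpolation between the weak \<open>L\<^sup>1\<close> bound and \<open>L\<^sup>\<infinity>\<close>. The function \<open>h\<close> is a minorant
  of the maximal function of \<open>g\<close>; this spares the measurability of the latter.\<close>

lemma maximal_strong_type:
  assumes p: "p > 1"
    and g: "g \<in> borel_measurable (bessel_measure lam)" "\<And>x. 0 \<le> g x"
    and h: "h \<in> borel_measurable (bessel_measure lam)" "\<And>x. 0 \<le> h x"
    and dom: "\<And>x a. x > 0 \<Longrightarrow> a > 0 \<Longrightarrow> a < h x \<Longrightarrow> \<exists>r>0. ennreal (a * ball_vol x r)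
                < (\<integral>\<^sup>+z. ennreal (g z) * indicator (ball x r) z \<partial>bessel_measure lam)"
  shows "(\<integral>\<^sup>+x. ennreal (h x powr p) \<partial>bessel_measure lam)
    \<le> ennreal (20 * 5 powr (2 * lam) * p * 4 powr (p - 1) / (p - 1)) * (\<integral>\<^sup>+x. ennreal (g x powr p) \<partial>bessel_measure lam)"
proof -
  let ?m = "bessel_measure lam"
  let ?K = "10 * 5 powr (2 * lam)"
  note [measurable] = g(1) h(1)
  interpret m: sigma_finite_measure ?m by (rule sigma_finite_bessel)
  interpret P: pair_sigma_finite ?m "lborel :: real measure" ..
  have [measurable]: "Measurable.pred (?m \<Otimes>\<^sub>M borel) (\<lambda>x. snd x \<in> {0<..<h (fst x)})"
      "Measurable.pred (?m \<Otimes>\<^sub>M borel) (\<lambda>x. snd x \<in> {0<..<4 * g (fst x)})"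
    unfolding greaterThanLessThan_iff by measurable
  have [measurable]: "Measurable.pred ?m (\<lambda>z. a \<in> {0<..<4 * g z})" for a
    unfolding greaterThanLessThan_iff by measurable
  have weak: "ennreal a * emeasure ?m {x\<in>space ?m. a < h x}
      \<le> ennreal (2 * ?K) * (\<integral>\<^sup>+z. ennreal (g z) * indicator {0<..<4 * g z} a \<partial>?m)"
    if a: "a > 0" for a
  proof -
    \<comment> \<open>\<open>?g\<close> keeps \<open>g\<close> where it exceeds
      \<open>a / 4\<close>. On a ball the discarded part contributes at most \<open>a / 4\<close>
      times \<open>2 * ball_vol\<close>, which is half of the assumed lower bound, so
      \<open>?g\<close> still satisfies the hypothesis of the weak bound with
      \<open>a / 2\<close>.\<close>
    let ?g = "\<lambda>z. ennreal (g z) * indicator {0<..<4 * g z} a"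
    have mg: "?g \<in> borel_measurable ?m" by measurable
    have mE: "{x\<in>space ?m. a < h x} \<in> sets ?m" by measurable
    have "ennreal (a / 2) * emeasure ?m {x\<in>space ?m. a < h x} \<le> ennreal ?K * (\<integral>\<^sup>+z. ?g z \<partial>?m)"
    proof (rule maximal_weak_type)
      fix x assume "x \<in> {x\<in>space ?m. a < h x}"
      hence x: "x > 0" "a < h x" by auto
      then obtain r where r: "r > 0" "ennreal (a * ball_vol x r)
                < (\<integral>\<^sup>+z. ennreal (g z) * indicator (ball x r) z \<partial>?m)" using dom[of x a] a by auto
      have mb: "(\<lambda>z. indicator (ball x r) z :: ennreal) \<in> borel_measurable ?m"
        by (intro borel_measurable_bessel_of_borel borel_measurable_indicator) simp
      have "ennreal (a / 2 * ball_vol x r) < (\<integral>\<^sup>+z. ?g z * indicator (ball x r) z \<partial>?m)"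
      proof (rule ccontr)
        assume "\<not> ?thesis"
        hence n: "(\<integral>\<^sup>+z. ?g z * indicator (ball x r) z \<partial>?m) \<le> ennreal (a / 2 * ball_vol x r)" by simp
        have "(\<integral>\<^sup>+z. ennreal (g z) * indicator (ball x r) z \<partial>?m)
           \<le> (\<integral>\<^sup>+z. ?g z * indicator (ball x r) z + ennreal (a / 4) * indicator (ball x r) z \<partial>?m)"
          using a by (intro nn_integral_mono) (auto simp: indicator_def not_less intro!: ennreal_leI)
        also have "\<dots> = (\<integral>\<^sup>+z. ?g z * indicator (ball x r) z \<partial>?m) + ennreal (a / 4) * (\<integral>\<^sup>+z. indicator (ball x r) z \<partial>?m)"
          using mb mg by (subst nn_integral_add) (auto simp: nn_integral_cmult)
        also have "\<dots> \<le> ennreal (a / 2 * ball_vol x r) + ennreal (a / 4) * ennreal (2 * ball_vol x r)"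
          using n nn_integral_ball_le[OF x(1) r(1)] by (intro add_mono mult_left_mono) auto
        also have "\<dots> = ennreal (a * ball_vol x r)"
          using a ball_vol_pos[OF x(1) r(1)]
          by (simp add: ennreal_mult[symmetric] ennreal_plus[symmetric] del: ennreal_plus)
        finally show False using r(2) by simp
      qed
      with r(1) show "\<exists>r>0. ennreal (a / 2 * ball_vol x r) < (\<integral>\<^sup>+z. ?g z * indicator (ball x r) z \<partial>?m)" by blast
    qed (use a mg mE in auto)
    hence "ennreal 2 * (ennreal (a / 2) * emeasure ?m {x\<in>space ?m. a < h x})
        \<le> ennreal 2 * (ennreal ?K * (\<integral>\<^sup>+z. ?g z \<partial>?m))"
      by (rule mult_left_mono) simp
    thus ?thesis using a
      by (simp add: mult.assoc[symmetric] ennreal_mult'[symmetric] del: ennreal_numeral)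
  qed
  have "(\<integral>\<^sup>+x. ennreal (h x powr p) \<partial>?m)
      = (\<integral>\<^sup>+x. (\<integral>\<^sup>+a. ennreal p * (ennreal (a powr (p - 1)) * indicator {0<..<h x} a) \<partial>lborel) \<partial>?m)"
  proof (intro nn_integral_cong)
    fix x
    have "ennreal (h x powr p) = ennreal p * ennreal (h x powr p / p)"
      using p by (subst ennreal_mult[symmetric]) auto
    also have "\<dots> = ennreal p * (\<integral>\<^sup>+a. ennreal (a powr (p - 1)) * indicator {0<..<h x} a \<partial>lborel)"
      using p h by (subst nn_integral_powr_layer) auto
    also have "\<dots> = (\<integral>\<^sup>+a. ennreal p * (ennreal (a powr (p - 1)) * indicator {0<..<h x} a) \<partial>lborel)"
      by (rule nn_integral_cmult[symmetric]) measurable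
    finally show "ennreal (h x powr p) = \<dots>" .
  qed
  also have "\<dots> = (\<integral>\<^sup>+a. (\<integral>\<^sup>+x. ennreal p * (ennreal (a powr (p - 1)) * indicator {0<..<h x} a) \<partial>?m) \<partial>lborel)"
    by (rule P.Fubini'[symmetric]) measurable
  also have "\<dots> \<le> (\<integral>\<^sup>+a. (\<integral>\<^sup>+z. ennreal (2 * ?K * p) * (ennreal (g z) * (ennreal (a powr (p - 1 - 1)) * indicator {0<..<4 * g z} a)) \<partial>?m) \<partial>lborel)"
  proof (rule nn_integral_mono)
    fix a :: real
    show "(\<integral>\<^sup>+x. ennreal p * (ennreal (a powr (p - 1)) * indicator {0<..<h x} a) \<partial>?m)
      \<le> (\<integral>\<^sup>+z. ennreal (2 * ?K * p) * (ennreal (g z) * (ennreal (a powr (p - 1 - 1)) * indicator {0<..<4 * g z} a)) \<partial>?m)"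
    proof (cases "a > 0")
      case True
      have "(\<integral>\<^sup>+x. ennreal p * (ennreal (a powr (p - 1)) * indicator {0<..<h x} a) \<partial>?m)
         = (\<integral>\<^sup>+x. ennreal (p * a powr (p - 1)) * indicator {x\<in>space ?m. a < h x} x \<partial>?m)"
        using True p by (intro nn_integral_cong) (auto simp: indicator_def ennreal_mult)
      also have "\<dots> = ennreal (p * a powr (p - 1)) * emeasure ?m {x\<in>space ?m. a < h x}"
        by (rule nn_integral_cmult_indicator) measurable
      \<comment> \<open>One factor \<open>a\<close> is split off to match the weak bound. The
        remaining power \<open>a powr (p - 2)\<close> is integrable at 0 because
        \<open>p > 1\<close>.\<close>
      also have "p * a powr (p - 1) = p * a powr (p - 1 - 1) * a"
        using True powr_add[of a "p - 1 - 1" 1] by simp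
      also have "ennreal \<dots> * emeasure ?m {x\<in>space ?m. a < h x}
         = ennreal (p * a powr (p - 1 - 1)) * (ennreal a * emeasure ?m {x\<in>space ?m. a < h x})"
        using True p by (subst ennreal_mult) (auto simp: mult.assoc)
      also have "\<dots> \<le> ennreal (p * a powr (p - 1 - 1)) *
          (ennreal (2 * ?K) * (\<integral>\<^sup>+z. ennreal (g z) * indicator {0<..<4 * g z} a \<partial>?m))"
        by (intro mult_left_mono weak True) simp
      also have "\<dots> = ennreal (p * a powr (p - 1 - 1) * (2 * ?K)) * (\<integral>\<^sup>+z. ennreal (g z) * indicator {0<..<4 * g z} a \<partial>?m)"
        using p by (subst ennreal_mult) (auto simp: mult.assoc)
      also have "\<dots> = (\<integral>\<^sup>+z. ennreal (p * a powr (p - 1 - 1) * (2 * ?K)) * (ennreal (g z) * indicator {0<..<4 * g z} a) \<partial>?m)"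
        by (rule nn_integral_cmult[symmetric]) measurable
      also have "\<dots> = (\<integral>\<^sup>+z. ennreal (2 * ?K * p) * (ennreal (g z) * (ennreal (a powr (p - 1 - 1)) * indicator {0<..<4 * g z} a)) \<partial>?m)"
        using p by (intro nn_integral_cong) (auto simp: indicator_def ennreal_mult'[symmetric] g(2) mult_ac)
      finally show ?thesis .
    next
      case False
      thus ?thesis by (simp add: indicator_def)
    qed
  qed
  also have "\<dots> = (\<integral>\<^sup>+z. (\<integral>\<^sup>+a. ennreal (2 * ?K * p) * (ennreal (g z) * (ennreal (a powr (p - 1 - 1)) * indicator {0<..<4 * g z} a)) \<partial>lborel) \<partial>?m)"
    by (rule P.Fubini') measurable
  also have "\<dots> = (\<integral>\<^sup>+z. ennreal (20 * 5 powr (2 * lam) * p * 4 powr (p - 1) / (p - 1)) * ennreal (g z powr p) \<partial>?m)"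
  proof (intro nn_integral_cong)
    fix z
    have "(\<integral>\<^sup>+a. ennreal (2 * ?K * p) * (ennreal (g z) * (ennreal (a powr (p - 1 - 1)) * indicator {0<..<4 * g z} a)) \<partial>lborel)
        = ennreal (2 * ?K * p) * (ennreal (g z) * ennreal ((4 * g z) powr (p - 1) / (p - 1)))"
      using p g(2) nn_integral_powr_layer[of "p - 1" "4 * g z"] by (simp add: nn_integral_cmult)
    also have "\<dots> = ennreal (2 * ?K * p * (g z * ((4 * g z) powr (p - 1) / (p - 1))))"
      using p g(2)[of z] by (simp add: ennreal_mult'[symmetric])
    also have "2 * ?K * p * (g z * ((4 * g z) powr (p - 1) / (p - 1)))
        = 20 * 5 powr (2 * lam) * p * 4 powr (p - 1) / (p - 1) * g z powr p"
    proof -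
      have "g z * g z powr (p - 1) = g z powr p"
        using g(2)[of z] powr_add[of "g z" 1 "p - 1"] p by (cases "g z = 0") auto
      thus ?thesis using g(2)[of z] by (simp add: powr_mult field_simps)
    qed
    also have "ennreal \<dots> = ennreal (20 * 5 powr (2 * lam) * p * 4 powr (p - 1) / (p - 1)) * ennreal (g z powr p)"
      using p by (subst ennreal_mult) auto
    finally show "(\<integral>\<^sup>+a. ennreal (2 * ?K * p) * (ennreal (g z) * (ennreal (a powr (p - 1 - 1)) * indicator {0<..<4 * g z} a)) \<partial>lborel)
        = \<dots>" .
  qed
  also have "\<dots> = ennreal (20 * 5 powr (2 * lam) * p * 4 powr (p - 1) / (p - 1)) * (\<integral>\<^sup>+z. ennreal (g z powr p) \<partial>?m)"
    by (rule nn_integral_cmult) measurable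
  finally show ?thesis .
qed

end

section \<open>Series and Gaussian integrals\<close>

lemma ennreal_suminf_swap:
  fixes f :: "nat \<Rightarrow> nat \<Rightarrow> ennreal"
  shows "(\<Sum>i. \<Sum>j. f i j) = (\<Sum>j. \<Sum>i. f i j)"
proof -
  have "(\<Sum>i. \<Sum>j. f i j) = (\<integral>\<^sup>+i. (\<Sum>j. f i j) \<partial>count_space UNIV)"
    by (simp add: nn_integral_count_space_nat)
  also have "\<dots> = (\<Sum>j. \<integral>\<^sup>+i. f i j \<partial>count_space UNIV)"
    by (rule nn_integral_suminf) simp
  finally show ?thesis by (simp add: nn_integral_count_space_nat)
qed

lemma ennreal_suminf_shift:
  fixes f :: "nat \<Rightarrow> ennreal"
  shows "(\<Sum>j. if i \<le> j then f (j - i) else 0) = (\<Sum>j. f j)"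
  by (subst suminf_offset[where i = i]) auto

text \<open>Vandermonde's convolution for the upper argument \<open>j + (m + k - 1)\<close>. The
  left side is the coefficient that arises when a product of two Bessel series is integrated against
  a Gaussian; on the right, for fixed \<open>i\<close>, the dependence on \<open>j\<close> and
  \<open>k\<close> separates.\<close>

lemma pochhammer_Vandermonde:
  fixes m :: real
  assumes m: "m > 0"
  shows "pochhammer m (j + k) / (fact j * fact k * pochhammer m j * pochhammer m k)
    = (\<Sum>i\<le>k. if i \<le> j then 1 / (fact (j - i) * fact (k - i) * fact i * pochhammer m i) else 0)"
proof -
  have pos: "pochhammer m n > 0" for n using m by (rule pochhammer_pos)
  have 1: "(m + real k - 1) gchoose (k - i) = pochhammer m k / (pochhammer m i * fact (k - i))"
    if "i \<le> k" for i
  proof -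
    have "(m + real k - 1) gchoose (k - i) = pochhammer (m + real i) (k - i) / fact (k - i)"
      using that by (simp add: gbinomial_pochhammer' of_nat_diff algebra_simps)
    moreover have "pochhammer m k = pochhammer m i * pochhammer (m + real i) (k - i)"
      by (rule pochhammer_product[OF that])
    ultimately show ?thesis using pos[of i] by (simp add: field_simps)
  qed
  have 2: "real j gchoose i = (if i \<le> j then fact j / (fact i * fact (j - i)) else 0)" for i
    by (simp add: binomial_gbinomial[symmetric] binomial_fact binomial_eq_0)
  have "(real j + (m + real k - 1)) gchoose k = pochhammer (m + real j) k / fact k"
    by (simp add: gbinomial_pochhammer' algebra_simps)
  also have "pochhammer (m + real j) k = pochhammer m (j + k) / pochhammer m j"
    using pos[of j] by (simp add: pochhammer_product')
  finally have "pochhammer m (j + k) / (fact k * pochhammer m j)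
     = (\<Sum>i=0..k. (real j gchoose i) * ((m + real k - 1) gchoose (k - i)))"
    by (simp add: gbinomial_Vandermonde field_simps)
  also have "\<dots> = (\<Sum>i\<le>k. fact j * pochhammer m k * (if i \<le> j then 1 / (fact (j - i) * fact (k - i) * fact i * pochhammer m i) else 0))"
    unfolding atMost_atLeast0 by (intro sum.cong refl) (auto simp: 1 2)
  also have "\<dots> = fact j * pochhammer m k * (\<Sum>i\<le>k. if i \<le> j then 1 / (fact (j - i) * fact (k - i) * fact i * pochhammer m i) else 0)"
    by (simp add: sum_distrib_left)
  finally show ?thesis using pos[of j] pos[of k] by (simp add: field_simps)
qed

text \<open>Up to a power of \<open>u\<close>, this is the modified Bessel function of the first kind of order
  \<open>m - 1\<close> at \<open>2 sqrt u\<close>.\<close>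

definition bessel_series :: "real \<Rightarrow> real \<Rightarrow> ennreal" where
  "bessel_series m u = (\<Sum>k. ennreal (u ^ k / (fact k * pochhammer m k)))"

lemma measurable_bessel_series [measurable]: "bessel_series m \<in> borel_measurable borel"
  unfolding bessel_series_def by measurable

lemma ennreal_suminf_exp: "x \<ge> 0 \<Longrightarrow> (\<Sum>n. ennreal (x ^ n / fact n)) = ennreal (exp x)"
  using exp_converges[of x] by (intro suminf_ennreal_eq) (auto simp: field_simps)

text \<open>The discrete form of Weber's integral for a product of two Bessel functions. After
  Vandermonde's convolution the sums over \<open>j - i\<close> and \<open>k - i\<close> are
  exponential series, and the sum over \<open>i\<close> is the Bessel series of the product.\<close>

lemma bessel_series_convolution:
  assumes m: "m > 0" and X: "X \<ge> 0" and Y: "Y \<ge> 0"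
  shows "(\<Sum>j. \<Sum>k. ennreal (pochhammer m (j + k) / (fact j * fact k * pochhammer m j * pochhammer m k) * X ^ j * Y ^ k))
     = ennreal (exp (X + Y)) * bessel_series m (X * Y)"
proof -
  have pos: "pochhammer m n > 0" for n using m by (rule pochhammer_pos)
  \<comment> \<open>\<open>c i\<close> carries the common index; \<open>A\<close> and
    \<open>B\<close> are the exponential series of \<open>X\<close> and \<open>Y\<close> shifted by
    \<open>i\<close>, with zeros below the shift so that all sums run over every index.\<close>
  define c where "c = (\<lambda>i. ennreal ((X * Y) ^ i / (fact i * pochhammer m i)))"
  define A where "A = (\<lambda>i j. if i \<le> j then ennreal (X ^ (j - i) / fact (j - i)) else 0)"
  define B where "B = (\<lambda>i k. if i \<le> k then ennreal (Y ^ (k - i) / fact (k - i)) else 0)"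
  have "ennreal (pochhammer m (j + k) / (fact j * fact k * pochhammer m j * pochhammer m k) * X ^ j * Y ^ k)
      = (\<Sum>i. c i * A i j * B i k)" for j k
  proof -
    have "ennreal (pochhammer m (j + k) / (fact j * fact k * pochhammer m j * pochhammer m k) * X ^ j * Y ^ k)
       = ennreal (\<Sum>i\<le>k. (if i \<le> j then 1 / (fact (j - i) * fact (k - i) * fact i * pochhammer m i) else 0) * X ^ j * Y ^ k)"
      unfolding pochhammer_Vandermonde[OF m] by (simp add: sum_distrib_right)
    also have "\<dots> = (\<Sum>i\<le>k. ennreal ((if i \<le> j then 1 / (fact (j - i) * fact (k - i) * fact i * pochhammer m i) else 0) * X ^ j * Y ^ k))"
      using X Y less_imp_le[OF pos] by (intro sum_ennreal[symmetric]) auto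
    also have "\<dots> = (\<Sum>i\<le>k. c i * A i j * B i k)"
    proof (intro sum.cong refl)
      fix i assume i: "i \<in> {..k}"
      show "ennreal ((if i \<le> j then 1 / (fact (j - i) * fact (k - i) * fact i * pochhammer m i) else 0) * X ^ j * Y ^ k)
         = c i * A i j * B i k"
      proof (cases "i \<le> j")
        case True
        have "X ^ j = X ^ i * X ^ (j - i)" "Y ^ k = Y ^ i * Y ^ (k - i)"
          using True i by (simp_all add: power_add[symmetric])
        thus ?thesis using True i X Y less_imp_le[OF pos]
          by (simp add: c_def A_def B_def ennreal_mult[symmetric] power_mult_distrib mult_ac)
      qed (simp add: A_def)
    qed
    also have "\<dots> = (\<Sum>i. c i * A i j * B i k)"
      by (rule suminf_finite[symmetric]) (auto simp: B_def)
    finally show ?thesis .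
  qed
  hence "(\<Sum>j. \<Sum>k. ennreal (pochhammer m (j + k) / (fact j * fact k * pochhammer m j * pochhammer m k) * X ^ j * Y ^ k))
      = (\<Sum>j. \<Sum>k. \<Sum>i. c i * A i j * B i k)" by simp
  also have "\<dots> = (\<Sum>j. \<Sum>i. \<Sum>k. c i * A i j * B i k)"
    by (subst ennreal_suminf_swap) simp
  also have "\<dots> = (\<Sum>i. \<Sum>j. \<Sum>k. c i * A i j * B i k)"
    by (rule ennreal_suminf_swap)
  also have "\<dots> = (\<Sum>i. c i * (ennreal (exp X) * ennreal (exp Y)))"
  proof (intro suminf_cong)
    fix i
    have a: "(\<Sum>j. A i j) = ennreal (exp X)" "(\<Sum>k. B i k) = ennreal (exp Y)"
      unfolding A_def B_def ennreal_suminf_shift[of i "\<lambda>n. ennreal (X ^ n / fact n)"]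
        ennreal_suminf_shift[of i "\<lambda>n. ennreal (Y ^ n / fact n)"]
      using X Y by (simp_all only: ennreal_suminf_exp)
    show "(\<Sum>j. \<Sum>k. c i * A i j * B i k) = c i * (ennreal (exp X) * ennreal (exp Y))"
      by (simp add: a mult.assoc)
  qed
  also have "\<dots> = ennreal (exp (X + Y)) * bessel_series m (X * Y)"
    by (simp add: c_def bessel_series_def exp_add ennreal_mult mult_ac)
  finally show ?thesis .
qed

section \<open>Gamma and Gaussian integrals\<close>

lemma nn_integral_Gamma:
  assumes s: "s > 0"
  shows "(\<integral>\<^sup>+t. ennreal (t powr (s - 1) * exp (- t)) * indicator {0<..} t \<partial>lborel) = ennreal (Gamma s)"
proof -
  have "(\<integral>\<^sup>+t. ennreal (t powr (s - 1) * exp (- t)) * indicator {0<..} t \<partial>lborel)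
     = (\<integral>\<^sup>+t. ennreal (indicator {0..} t * t powr (s - 1) / exp t) \<partial>lborel)"
  proof (rule nn_integral_cong_AE)
    show "AE t in lborel. ennreal (t powr (s - 1) * exp (- t)) * indicator {0<..} t
        = ennreal (indicator {0..} t * t powr (s - 1) / exp t)"
      using AE_lborel_singleton[of 0]
      by eventually_elim (auto simp: indicator_def exp_minus field_simps)
  qed
  thus ?thesis using Gamma_conv_nn_integral_real[OF s] by simp
qed

lemma image_Ioi_self:
  fixes g h :: "real \<Rightarrow> real"
  assumes "\<And>x. x > 0 \<Longrightarrow> g x > 0" "\<And>y. y > 0 \<Longrightarrow> h y > 0 \<and> g (h y) = y"
  shows "g ` {0<..} = {0<..}"
  using assms by (auto simp: image_iff) (metis greaterThan_iff)

text \<open>Solves for an integral \<open>I\<close> that is not known to be finite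
  beforehand.\<close>

lemma ennreal_eq_cmultD:
  assumes "ennreal G = ennreal c * I" "c > 0" "G \<ge> 0"
  shows "I = ennreal (G / c)"
proof (cases I)
  case (real r)
  thus ?thesis using assms by (auto simp: ennreal_mult[symmetric])
next
  case top
  thus ?thesis using assms by (auto simp: ennreal_mult_top)
qed

lemma nn_integral_exp_powr:
  assumes s: "s > 0" and A: "A > 0"
  shows "(\<integral>\<^sup>+v. ennreal (v powr (s - 1) * exp (- (A * v))) * indicator {0<..} v \<partial>lborel)
     = ennreal (Gamma s * A powr (- s))"
proof -
  have im: "(\<lambda>v. A * v) ` {0<..} = {0<..}"
    by (rule image_Ioi_self[where h = "\<lambda>y. y / A"]) (use A in auto)
  have "ennreal (Gamma s) = (\<integral>\<^sup>+t. ennreal (t powr (s - 1) * exp (- t)) * indicator ((\<lambda>v. A * v) ` {0<..}) t \<partial>lborel)"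
    unfolding im using nn_integral_Gamma[OF s] by simp
  also have "\<dots> = (\<integral>\<^sup>+v. ennreal (\<bar>A\<bar> * ((A * v) powr (s - 1) * exp (- (A * v)))) * indicator {0<..} v \<partial>lborel)"
    by (rule nn_integral_change_of_variables)
       (use A im in \<open>auto intro!: derivative_eq_intros inj_onI\<close>)
  also have "\<dots> = (\<integral>\<^sup>+v. ennreal (A powr s) * (ennreal (v powr (s - 1) * exp (- (A * v))) * indicator {0<..} v) \<partial>lborel)"
  proof (intro nn_integral_cong)
    fix v :: real
    have "A * A powr (s - 1) = A powr s" using A by (simp add: powr_mult_base)
    thus "ennreal (\<bar>A\<bar> * ((A * v) powr (s - 1) * exp (- (A * v)))) * indicator {0<..} v
       = ennreal (A powr s) * (ennreal (v powr (s - 1) * exp (- (A * v))) * indicator {0<..} v)"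
      using A by (auto simp: indicator_def powr_mult ennreal_mult'[symmetric] mult_ac)
  qed
  also have "\<dots> = ennreal (A powr s) * (\<integral>\<^sup>+v. ennreal (v powr (s - 1) * exp (- (A * v))) * indicator {0<..} v \<partial>lborel)"
    by (rule nn_integral_cmult) measurable
  finally have "(\<integral>\<^sup>+v. ennreal (v powr (s - 1) * exp (- (A * v))) * indicator {0<..} v \<partial>lborel)
      = ennreal (Gamma s / A powr s)"
    by (rule ennreal_eq_cmultD) (use A s Gamma_real_pos[of s] in auto)
  thus ?thesis by (simp add: powr_minus divide_inverse)
qed

lemma nn_integral_gaussian_powr:
  assumes s: "s > 0" and p: "p > 0"
  shows "(\<integral>\<^sup>+z. ennreal (z powr (2 * s - 1) * exp (- (p * z^2))) * indicator {0<..} z \<partial>lborel)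
     = ennreal (Gamma s / 2 * p powr (- s))"
proof -
  have im: "(\<lambda>z. z^2) ` {0<..} = {0::real<..}"
    by (rule image_Ioi_self[where h = sqrt]) auto
  have "ennreal (Gamma s * p powr (- s))
      = (\<integral>\<^sup>+t. ennreal (t powr (s - 1) * exp (- (p * t))) * indicator ((\<lambda>z. z^2) ` {0<..}) t \<partial>lborel)"
    unfolding im using nn_integral_exp_powr[OF s p] by simp
  also have "\<dots> = (\<integral>\<^sup>+z. ennreal (\<bar>2 * z\<bar> * ((z^2) powr (s - 1) * exp (- (p * z^2)))) * indicator {0<..} z \<partial>lborel)"
    by (rule nn_integral_change_of_variables)
       (use p im in \<open>auto intro!: derivative_eq_intros inj_onI simp: power2_eq_iff\<close>)
  also have "\<dots> = (\<integral>\<^sup>+z. ennreal 2 * (ennreal (z powr (2 * s - 1) * exp (- (p * z^2))) * indicator {0<..} z) \<partial>lborel)"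
  proof (intro nn_integral_cong)
    fix z :: real
    have "z * (z^2) powr (s - 1) = z powr (2 * s - 1)" if "z > 0"
    proof -
      have "(z^2) powr (s - 1) = z powr (2 * s - 2)"
        using that by (simp add: powr_powr algebra_simps flip: powr_numeral)
      thus ?thesis using powr_add[of z 1 "2 * s - 2"] that by simp
    qed
    thus "ennreal (\<bar>2 * z\<bar> * ((z^2) powr (s - 1) * exp (- (p * z^2)))) * indicator {0<..} z
       = ennreal 2 * (ennreal (z powr (2 * s - 1) * exp (- (p * z^2))) * indicator {0<..} z)"
      by (auto simp: indicator_def ennreal_mult'[symmetric] mult.assoc[symmetric] simp del: ennreal_numeral)
  qed
  also have "\<dots> = ennreal 2 * (\<integral>\<^sup>+z. ennreal (z powr (2 * s - 1) * exp (- (p * z^2))) * indicator {0<..} z \<partial>lborel)"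
    by (rule nn_integral_cmult) measurable
  finally have "(\<integral>\<^sup>+z. ennreal (z powr (2 * s - 1) * exp (- (p * z^2))) * indicator {0<..} z \<partial>lborel)
      = ennreal (Gamma s * p powr (- s) / 2)"
    by (rule ennreal_eq_cmultD) (use p s Gamma_real_pos[of s] in auto)
  thus ?thesis by simp
qed

section \<open>The heat kernel\<close>

context
  fixes lam :: real
  assumes lam: "lam > 0"
begin

text \<open>For even \<open>k\<close> this is the Beta function at \<open>lam\<close> and
  \<open>(k + 1) / 2\<close>. Only its ratio to the moment of order 0 is computed; the latter
  remains as a constant.\<close>

definition sin_cos_moment :: "nat \<Rightarrow> real" where
  "sin_cos_moment k = (LBINT \<theta>:{0<..<pi}. sin \<theta> powr (2 * lam - 1) * cos \<theta> ^ k)"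

lemma set_integrable_sin_cos: "set_integrable lborel {0<..<pi} (\<lambda>\<theta>. sin \<theta> powr (2 * lam - 1) * cos \<theta> ^ k)"
proof (rule set_integrable_bound[OF set_integrable_sin_powr[OF lam]])
  show "set_borel_measurable lborel {0<..<pi} (\<lambda>\<theta>. sin \<theta> powr (2 * lam - 1) * cos \<theta> ^ k)"
    unfolding set_borel_measurable_def by measurable
  show "AE \<theta> in lborel. \<theta> \<in> {0<..<pi} \<longrightarrow> norm (sin \<theta> powr (2 * lam - 1) * cos \<theta> ^ k) \<le> norm (sin \<theta> powr (2 * lam - 1))"
    by (intro AE_I2) (auto simp: abs_mult power_abs intro!: mult_left_le power_le_one)
qed

lemma has_integral_sin_cos: "((\<lambda>\<theta>. sin \<theta> powr (2 * lam - 1) * cos \<theta> ^ k) has_integral sin_cos_moment k) {0<..<pi}"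
  unfolding sin_cos_moment_def
  using set_borel_integral_eq_integral[OF set_integrable_sin_cos[of k]]
  by (simp add: has_integral_iff)

text \<open>Integration of the derivative of
  \<open>cos \<theta> ^ Suc k * sin \<theta> powr (2 * lam)\<close>, whose boundary values vanish
  because \<open>lam > 0\<close>.\<close>

lemma sin_cos_moment_rec:
  "(2 * lam + real (Suc k)) * sin_cos_moment (k + 2) = real (Suc k) * sin_cos_moment k"
proof -
  let ?s = "\<lambda>\<theta>. sin \<theta> powr (2 * lam - 1)"
  have "((\<lambda>\<theta>. (2 * lam + real (Suc k)) * (?s \<theta> * cos \<theta> ^ (k + 2)) - real (Suc k) * (?s \<theta> * cos \<theta> ^ k)) has_integral
     (cos pi ^ Suc k * sin pi powr (2 * lam) - cos 0 ^ Suc k * sin 0 powr (2 * lam))) {0..pi}"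
  proof (rule fundamental_theorem_of_calculus_interior)
    show "continuous_on {0..pi} (\<lambda>\<theta>. cos \<theta> ^ Suc k * sin \<theta> powr (2 * lam))"
      using lam by (intro continuous_on_mult continuous_on_powr' continuous_on_power continuous_intros)
        (auto simp: sin_ge_zero)
    fix \<theta> :: real assume "\<theta> \<in> {0<..<pi}"
    hence s: "sin \<theta> > 0" by (simp add: sin_gt_zero)
    have 1: "sin \<theta> powr (2 * lam) = ?s \<theta> * sin \<theta>"
      using s powr_add[of "sin \<theta>" "2 * lam - 1" 1] by simp
    have "((\<lambda>\<theta>. cos \<theta> ^ Suc k * sin \<theta> powr (2 * lam)) has_field_derivative
       cos \<theta> ^ Suc k * (2 * lam * sin \<theta> powr (2 * lam - 1) * cos \<theta>)
         + (real (Suc k) * (cos \<theta> ^ k * - sin \<theta>)) * sin \<theta> powr (2 * lam)) (at \<theta>)"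
      using s by (auto intro!: derivative_eq_intros DERIV_fun_powr[THEN DERIV_cong] simp del: power_Suc)
    also have "cos \<theta> ^ Suc k * (2 * lam * sin \<theta> powr (2 * lam - 1) * cos \<theta>)
         + (real (Suc k) * (cos \<theta> ^ k * - sin \<theta>)) * sin \<theta> powr (2 * lam)
       = ?s \<theta> * cos \<theta> ^ k * (2 * lam * (cos \<theta>)^2 - real (Suc k) * (sin \<theta>)^2)"
      unfolding 1 by (simp add: power2_eq_square algebra_simps)
    also have "\<dots> = (2 * lam + real (Suc k)) * (?s \<theta> * cos \<theta> ^ (k + 2)) - real (Suc k) * (?s \<theta> * cos \<theta> ^ k)"
      unfolding sin_squared_eq by (simp add: power2_eq_square power_add algebra_simps)
    finally show "((\<lambda>\<theta>. cos \<theta> ^ Suc k * sin \<theta> powr (2 * lam)) has_vector_derivative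
       (2 * lam + real (Suc k)) * (?s \<theta> * cos \<theta> ^ (k + 2)) - real (Suc k) * (?s \<theta> * cos \<theta> ^ k)) (at \<theta>)"
      by (simp add: has_real_derivative_iff_has_vector_derivative)
  qed simp
  hence "((\<lambda>\<theta>. (2 * lam + real (Suc k)) * (?s \<theta> * cos \<theta> ^ (k + 2)) - real (Suc k) * (?s \<theta> * cos \<theta> ^ k)) has_integral 0) {0<..<pi}"
    by (simp add: has_integral_Icc_iff_Ioo)
  moreover have "((\<lambda>\<theta>. (2 * lam + real (Suc k)) * (?s \<theta> * cos \<theta> ^ (k + 2)) - real (Suc k) * (?s \<theta> * cos \<theta> ^ k)) has_integral
      ((2 * lam + real (Suc k)) * sin_cos_moment (k + 2) - real (Suc k) * sin_cos_moment k)) {0<..<pi}"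
    by (intro has_integral_diff has_integral_mult_right has_integral_sin_cos)
  ultimately have "(2 * lam + real (Suc k)) * sin_cos_moment (k + 2) - real (Suc k) * sin_cos_moment k = 0"
    by (rule has_integral_unique[symmetric])
  thus ?thesis by simp
qed

lemma sin_cos_moment_even:
  "sin_cos_moment (2 * k) / fact (2 * k) = sin_cos_moment 0 / (4 ^ k * fact k * pochhammer (lam + 1/2) k)"
proof (induction k)
  case (Suc k)
  have p: "pochhammer (lam + 1/2) k > 0" using lam by (intro pochhammer_pos) simp
  have "(2 * lam + real (Suc (2 * k))) * sin_cos_moment (2 * Suc k) = real (Suc (2 * k)) * sin_cos_moment (2 * k)"
    using sin_cos_moment_rec[of "2 * k"] by simp
  hence "sin_cos_moment (2 * Suc k) = real (Suc (2 * k)) * sin_cos_moment (2 * k) / (2 * lam + real (Suc (2 * k)))"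
    using lam by (simp add: field_simps)
  hence "sin_cos_moment (2 * Suc k) / fact (2 * Suc k)
     = (sin_cos_moment (2 * k) / fact (2 * k)) / ((2 * lam + real (Suc (2 * k))) * real (2 * k + 2))"
    using lam by (simp add: divide_simps)
  also have "\<dots> = sin_cos_moment 0 / (4 ^ k * fact k * pochhammer (lam + 1/2) k) / ((2 * lam + real (Suc (2 * k))) * real (2 * k + 2))"
    by (simp only: Suc)
  \<comment> \<open>The new factors agree since \<open>(2 * lam + 2 * k + 1) * (2 * k + 2) = 4 *
    (lam + 1/2 + k) * (k + 1)\<close>.\<close>
  also have "\<dots> = sin_cos_moment 0 / (4 ^ Suc k * fact (Suc k) * pochhammer (lam + 1/2) (Suc k))"
    using p lam by (simp add: divide_simps pochhammer_Suc) (simp add: algebra_simps)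
  finally show ?case .
qed simp

lemma sin_cos_moment_nonneg: "sin_cos_moment (2 * k) \<ge> 0"
  unfolding sin_cos_moment_def set_lebesgue_integral_def
  by (intro integral_nonneg_AE AE_I2) (auto simp: indicator_def)

text \<open>Poisson's integral for the modified Bessel function of order \<open>lam - 1/2\<close>.
  The odd terms of the exponential series change sign with the cosine and cannot be integrated one
  by one in \<open>ennreal\<close>; averaging with the reflection of \<theta> at \<open>pi/2\<close>
  replaces \<open>exp\<close> by \<open>cosh\<close>, whose terms are nonnegative.\<close>

lemma nn_integral_sin_exp_cos:
  "(\<integral>\<^sup>+\<theta>. ennreal (sin \<theta> powr (2 * lam - 1) * exp (z * cos \<theta>)) * indicator {0<..<pi} \<theta> \<partial>lborel)
    = ennreal (sin_cos_moment 0) * bessel_series (lam + 1/2) (z^2 / 4)"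
proof -
  let ?L = "\<lambda>z. \<integral>\<^sup>+\<theta>. ennreal (sin \<theta> powr (2 * lam - 1) * exp (z * cos \<theta>)) * indicator {0<..<pi} \<theta> \<partial>lborel"
  have refl: "?L z = ?L (- z)"
  proof -
    have "?L z = ennreal \<bar>-1\<bar> * (\<integral>\<^sup>+\<theta>. ennreal (sin (pi + (-1) * \<theta>) powr (2 * lam - 1) * exp (z * cos (pi + (-1) * \<theta>)))
       * indicator {0<..<pi} (pi + (-1) * \<theta>) \<partial>lborel)"
      by (rule nn_integral_real_affine) measurable
    also have "\<dots> = ?L (- z)"
      by (simp, intro nn_integral_cong) (auto simp: indicator_def sin_diff cos_diff)
    finally show ?thesis .
  qed
  have cosh_series: "ennreal (cosh x) = (\<Sum>k. ennreal (x ^ (2 * k) / fact (2 * k)))" for x :: real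
  proof -
    have "(\<lambda>n. if even n then x ^ n /\<^sub>R fact n else 0) sums cosh x" by (rule cosh_converges)
    hence "(\<lambda>k. (\<lambda>n. if even n then x ^ n /\<^sub>R fact n else 0) (2 * k)) sums cosh x"
      by (subst sums_mono_reindex) (auto simp: strict_mono_def elim!: evenE)
    hence "(\<lambda>k. x ^ (2 * k) / fact (2 * k)) sums cosh x" by (simp add: field_simps)
    thus ?thesis by (intro suminf_ennreal_eq[symmetric]) auto
  qed
  have mom: "(\<integral>\<^sup>+\<theta>. ennreal (sin \<theta> powr (2 * lam - 1) * cos \<theta> ^ (2 * k)) * indicator {0<..<pi} \<theta> \<partial>lborel)
      = ennreal (sin_cos_moment (2 * k))" for k
    by (rule nn_integral_has_integral_lebesgue'[OF _ has_integral_sin_cos]) (auto simp: power_mult)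
  have "2 * ?L z = ?L z + ?L z" by (rule mult_2)
  also have "\<dots> = ?L z + ?L (- z)" by (rule arg_cong[OF refl])
  also have "\<dots> = (\<integral>\<^sup>+\<theta>. ennreal (sin \<theta> powr (2 * lam - 1) * exp (z * cos \<theta>)) * indicator {0<..<pi} \<theta>
      + ennreal (sin \<theta> powr (2 * lam - 1) * exp (- z * cos \<theta>)) * indicator {0<..<pi} \<theta> \<partial>lborel)"
    by (rule nn_integral_add[symmetric]) measurable
  also have "\<dots> = (\<integral>\<^sup>+\<theta>. 2 * (\<Sum>k. ennreal (z ^ (2 * k) / fact (2 * k)) *
      (ennreal (sin \<theta> powr (2 * lam - 1) * cos \<theta> ^ (2 * k)) * indicator {0<..<pi} \<theta>)) \<partial>lborel)"
  proof (intro nn_integral_cong)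
    fix \<theta> :: real
    let ?s = "sin \<theta> powr (2 * lam - 1)"
    have term_eq: "ennreal (z ^ (2 * k) / fact (2 * k)) * (ennreal (?s * cos \<theta> ^ (2 * k)) * indicator {0<..<pi} \<theta>)
      = ennreal ((z * cos \<theta>) ^ (2 * k) / fact (2 * k)) * (ennreal ?s * indicator {0<..<pi} \<theta>)" for k
    proof -
      have "ennreal (z ^ (2 * k) / fact (2 * k)) * ennreal (?s * cos \<theta> ^ (2 * k))
        = ennreal (z ^ (2 * k) / fact (2 * k) * (?s * cos \<theta> ^ (2 * k)))"
        by (rule ennreal_mult[symmetric]) (auto simp: power_mult)
      also have "z ^ (2 * k) / fact (2 * k) * (?s * cos \<theta> ^ (2 * k)) = (z * cos \<theta>) ^ (2 * k) / fact (2 * k) * ?s"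
        by (simp add: power_mult_distrib)
      also have "ennreal \<dots> = ennreal ((z * cos \<theta>) ^ (2 * k) / fact (2 * k)) * ennreal ?s"
        by (rule ennreal_mult) (auto simp: power_mult)
      finally show ?thesis by (simp add: mult.assoc[symmetric])
    qed
    have sum_eq: "(\<Sum>k. ennreal (z ^ (2 * k) / fact (2 * k)) * (ennreal (?s * cos \<theta> ^ (2 * k)) * indicator {0<..<pi} \<theta>))
      = ennreal (cosh (z * cos \<theta>)) * (ennreal ?s * indicator {0<..<pi} \<theta>)"
      unfolding term_eq cosh_series by (rule ennreal_suminf_multc)
    have "ennreal (?s * exp (z * cos \<theta>)) + ennreal (?s * exp (- z * cos \<theta>))
      = ennreal (?s * exp (z * cos \<theta>) + ?s * exp (- z * cos \<theta>))"
      by (rule ennreal_plus[symmetric]) auto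
    also have "?s * exp (z * cos \<theta>) + ?s * exp (- z * cos \<theta>) = 2 * (cosh (z * cos \<theta>) * ?s)"
      by (simp add: cosh_field_def distrib_left mult.commute)
    also have "ennreal \<dots> = 2 * (ennreal (cosh (z * cos \<theta>)) * ennreal ?s)"
      by (simp add: ennreal_mult)
    finally show "ennreal (?s * exp (z * cos \<theta>)) * indicator {0<..<pi} \<theta>
      + ennreal (?s * exp (- z * cos \<theta>)) * indicator {0<..<pi} \<theta>
      = 2 * (\<Sum>k. ennreal (z ^ (2 * k) / fact (2 * k)) * (ennreal (?s * cos \<theta> ^ (2 * k)) * indicator {0<..<pi} \<theta>))"
      unfolding sum_eq by (auto simp: indicator_def)
  qed
  also have "\<dots> = 2 * (\<Sum>k. ennreal (z ^ (2 * k) / fact (2 * k)) * ennreal (sin_cos_moment (2 * k)))"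
    by (simp add: nn_integral_cmult nn_integral_suminf mom)
  finally have "?L z = (\<Sum>k. ennreal (z ^ (2 * k) / fact (2 * k)) * ennreal (sin_cos_moment (2 * k)))"
    by (simp add: ennreal_mult_cancel_left)
  also have "\<dots> = (\<Sum>k. ennreal (sin_cos_moment 0) * ennreal ((z^2 / 4) ^ k / (fact k * pochhammer (lam + 1/2) k)))"
  proof (intro suminf_cong)
    fix k
    have "ennreal (z ^ (2 * k) / fact (2 * k)) * ennreal (sin_cos_moment (2 * k))
        = ennreal (z ^ (2 * k) * (sin_cos_moment (2 * k) / fact (2 * k)))"
      using sin_cos_moment_nonneg[of k] by (subst ennreal_mult''[symmetric]) (auto simp: mult_ac)
    also have "z ^ (2 * k) * (sin_cos_moment (2 * k) / fact (2 * k))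
        = sin_cos_moment 0 * ((z^2 / 4) ^ k / (fact k * pochhammer (lam + 1/2) k))"
      unfolding sin_cos_moment_even power_mult by (simp add: power_divide mult_ac)
    also have "ennreal \<dots> = ennreal (sin_cos_moment 0) * ennreal ((z^2 / 4) ^ k / (fact k * pochhammer (lam + 1/2) k))"
      using sin_cos_moment_nonneg[of 0] by (subst ennreal_mult') auto
    finally show "ennreal (z ^ (2 * k) / fact (2 * k)) * ennreal (sin_cos_moment (2 * k)) = \<dots>" .
  qed
  also have "\<dots> = ennreal (sin_cos_moment 0) * bessel_series (lam + 1/2) (z^2 / 4)"
    by (simp add: bessel_series_def)
  finally show ?thesis .
qed

text \<open>Up to normalisation, the heat kernel of the Bessel operator at time \<open>1 / (4 v)\<close>, without the
  factor \<open>v powr (lam + 1/2)\<close>.\<close>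

definition heat :: "real \<Rightarrow> real \<Rightarrow> real \<Rightarrow> ennreal" where
  "heat v x y = ennreal (exp (- (v * (x^2 + y^2)))) * bessel_series (lam + 1/2) ((v * x * y)^2)"

lemma measurable_heat [measurable (raw)]:
  assumes [measurable]: "f \<in> borel_measurable M" "g \<in> borel_measurable M" "h \<in> borel_measurable M"
  shows "(\<lambda>z. heat (f z) (g z) (h z)) \<in> borel_measurable M"
  unfolding heat_def by measurable

text \<open>The parameter is the reciprocal of four times the time, so adding times means
  \<open>1 / V = 1 / v + 1 / w\<close>, that is \<open>V = v * w / (v + w)\<close>. The power of
  \<open>v + w\<close> accounts for the factors \<open>v powr (lam + 1/2)\<close> left out of
  \<open>heat\<close>. The product of the two series is integrated term by term against a
  Gaussian.\<close>

lemma heat_semigroup: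
  assumes v: "v > 0" and w: "w > 0"
  shows "(\<integral>\<^sup>+z. heat v x z * heat w z y \<partial>bessel_measure lam)
    = ennreal (Gamma (lam + 1/2) / 2 * (v + w) powr (- (lam + 1/2))) * heat (v * w / (v + w)) x y"
proof -
  let ?m = "lam + 1/2"
  have m: "?m > 0" using lam by simp
  have pos: "pochhammer ?m n > 0" for n using m by (rule pochhammer_pos)
  have vw: "v + w > 0" using v w by simp
  \<comment> \<open>In the term with indices \<open>j\<close> and \<open>k\<close>,
    \<open>c j k\<close> and \<open>K\<close> hold what is free of \<open>z\<close>; the rest is
    \<open>f (j + k)\<close>, a Gaussian times a power of \<open>z\<close>.\<close>
  define c where "c = (\<lambda>j k. (v * x)^(2*j) / (fact j * pochhammer ?m j) * ((w * y)^(2*k) / (fact k * pochhammer ?m k)))"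
  have c0: "c j k \<ge> 0" for j k
    unfolding c_def using less_imp_le[OF pos] by (intro mult_nonneg_nonneg divide_nonneg_nonneg) auto
  define K where "K = exp (- (v * x^2)) * exp (- (w * y^2))"
  have K: "K \<ge> 0" by (simp add: K_def)
  define f where "f = (\<lambda>n z. ennreal (z powr (2 * (real n + ?m) - 1) * exp (- ((v + w) * z^2))) * indicator {0<..} z)"
  have fm [measurable]: "f n \<in> borel_measurable borel" for n unfolding f_def by measurable
  have "(\<integral>\<^sup>+z. heat v x z * heat w z y \<partial>bessel_measure lam)
     = (\<integral>\<^sup>+z. ennreal (z powr (2 * lam)) * (heat v x z * heat w z y) * indicator {0<..} z \<partial>lborel)"
    by (rule nn_integral_bessel) measurable
  also have "\<dots> = (\<integral>\<^sup>+z. (\<Sum>j. \<Sum>k. ennreal (K * c j k) * f (j + k) z) \<partial>lborel)"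
  proof (intro nn_integral_cong)
    fix z :: real
    show "ennreal (z powr (2 * lam)) * (heat v x z * heat w z y) * indicator {0<..} z
       = (\<Sum>j. \<Sum>k. ennreal (K * c j k) * f (j + k) z)"
    proof (cases "z > 0")
      case True
      let ?e = "ennreal (z powr (2 * lam) * (K * exp (- ((v + w) * z^2))))"
      let ?a = "\<lambda>j. ennreal (((v * x * z)^2)^j / (fact j * pochhammer ?m j))"
      let ?b = "\<lambda>k. ennreal (((w * z * y)^2)^k / (fact k * pochhammer ?m k))"
      have "exp (- (v * (x^2 + z^2))) * exp (- (w * (z^2 + y^2))) = K * exp (- ((v + w) * z^2))"
        unfolding K_def by (simp add: exp_add[symmetric] algebra_simps)
      hence "ennreal (z powr (2 * lam)) * (heat v x z * heat w z y)
         = ?e * ((\<Sum>j. ?a j) * (\<Sum>k. ?b k))"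
        unfolding heat_def bessel_series_def
        by (simp add: ennreal_mult' mult.assoc mult.left_commute)
           (simp add: mult.assoc[symmetric] ennreal_mult'[symmetric] mult.commute[of "z powr (2 * lam)" K])
      also have "(\<Sum>j. ?a j) * (\<Sum>k. ?b k) = (\<Sum>j. \<Sum>k. ?a j * ?b k)"
        by simp
      also have "?e * \<dots> = (\<Sum>j. \<Sum>k. ?e * (?a j * ?b k))"
        by simp
      also have "\<dots> = (\<Sum>j. \<Sum>k. ennreal (K * c j k) * f (j + k) z)"
      proof (intro suminf_cong)
        fix j k
        have "z powr (2 * (real (j + k) + ?m) - 1) = z powr (2 * lam + real (2 * j) + real (2 * k))"
          by (simp add: algebra_simps)
        also have "\<dots> = z powr (2 * lam) * z ^ (2 * j) * z ^ (2 * k)"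
          using True by (simp only: powr_add powr_realpow)
        finally have zp: "z powr (2 * (real (j + k) + ?m) - 1) = z powr (2 * lam) * z ^ (2 * j) * z ^ (2 * k)" .
        have "?e * (?a j * ?b k) = ennreal (z powr (2 * lam) * (K * exp (- ((v + w) * z^2))) *
           (((v * x * z)^2)^j / (fact j * pochhammer ?m j) * (((w * z * y)^2)^k / (fact k * pochhammer ?m k))))"
          using K less_imp_le[OF pos] by (simp add: ennreal_mult'[symmetric])
        also have "z powr (2 * lam) * (K * exp (- ((v + w) * z^2))) *
           (((v * x * z)^2)^j / (fact j * pochhammer ?m j) * (((w * z * y)^2)^k / (fact k * pochhammer ?m k)))
           = (K * c j k) * (z powr (2 * (real (j + k) + ?m) - 1) * exp (- ((v + w) * z^2)))"
          unfolding zp c_def by (simp add: power_mult[symmetric] power_mult_distrib)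
        also have "ennreal \<dots> = ennreal (K * c j k) * ennreal (z powr (2 * (real (j + k) + ?m) - 1) * exp (- ((v + w) * z^2)))"
          using K c0 by (intro ennreal_mult) auto
        also have "ennreal (z powr (2 * (real (j + k) + ?m) - 1) * exp (- ((v + w) * z^2))) = f (j + k) z"
          by (simp only: f_def indicator_def greaterThan_iff True if_True mult_1_right of_bool_eq)
        finally show "?e * (?a j * ?b k) = ennreal (K * c j k) * f (j + k) z" .
      qed
      finally show ?thesis using True by simp
    qed (simp add: f_def)
  qed
  also have "\<dots> = (\<Sum>j. \<Sum>k. ennreal (K * c j k) * (\<integral>\<^sup>+z. f (j + k) z \<partial>lborel))"
    by (simp add: nn_integral_suminf nn_integral_cmult)
  \<comment> \<open>The integral of \<open>f (j + k)\<close> supplies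
    \<open>Gamma (j + k + ?m)\<close>, and its quotient by \<open>Gamma ?m\<close> is the Pochhammer
    symbol in the numerator that \<open>bessel_series_convolution\<close> expects.\<close>
  also have "\<dots> = (\<Sum>j. \<Sum>k. ennreal (K * (Gamma ?m / 2 * (v + w) powr (- ?m))) *
      ennreal (pochhammer ?m (j + k) / (fact j * fact k * pochhammer ?m j * pochhammer ?m k)
         * ((v * x)^2 / (v + w)) ^ j * ((w * y)^2 / (v + w)) ^ k))"
  proof (intro suminf_cong)
    fix j k
    have G: "Gamma (real (j + k) + ?m) = pochhammer ?m (j + k) * Gamma ?m"
    proof -
      have "?m \<notin> \<int>\<^sub>\<le>\<^sub>0" using m by (auto elim!: nonpos_Ints_cases)
      from pochhammer_Gamma[OF this, of "j + k"] show ?thesis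
        using Gamma_real_pos[OF m] by (simp add: add_ac)
    qed
    have P: "(v + w) powr (- (real (j + k) + ?m)) = (v + w) powr (- ?m) / ((v + w) ^ j * (v + w) ^ k)"
    proof -
      have "(v + w) powr (- (real (j + k) + ?m)) = (v + w) powr (- ?m - real (j + k))"
        by (simp add: algebra_simps)
      thus ?thesis using vw by (simp only: powr_diff powr_realpow power_add)
    qed
    have "(\<integral>\<^sup>+z. f (j + k) z \<partial>lborel) = ennreal (Gamma (real (j + k) + ?m) / 2 * (v + w) powr (- (real (j + k) + ?m)))"
      unfolding f_def using m vw by (intro nn_integral_gaussian_powr) auto
    hence "ennreal (K * c j k) * (\<integral>\<^sup>+z. f (j + k) z \<partial>lborel)
       = ennreal (K * c j k * (Gamma (real (j + k) + ?m) / 2 * (v + w) powr (- (real (j + k) + ?m))))"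
      using K c0 by (subst ennreal_mult') auto
    also have "K * c j k * (Gamma (real (j + k) + ?m) / 2 * (v + w) powr (- (real (j + k) + ?m)))
       = (K * (Gamma ?m / 2 * (v + w) powr (- ?m))) * (pochhammer ?m (j + k) / (fact j * fact k * pochhammer ?m j * pochhammer ?m k)
         * ((v * x)^2 / (v + w)) ^ j * ((w * y)^2 / (v + w)) ^ k)"
      unfolding G P c_def power_mult by (simp add: power_divide mult_ac)
    also have "ennreal \<dots> = ennreal (K * (Gamma ?m / 2 * (v + w) powr (- ?m))) *
      ennreal (pochhammer ?m (j + k) / (fact j * fact k * pochhammer ?m j * pochhammer ?m k)
         * ((v * x)^2 / (v + w)) ^ j * ((w * y)^2 / (v + w)) ^ k)"
      using K Gamma_real_pos[OF m] by (subst ennreal_mult') auto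
    finally show "ennreal (K * c j k) * (\<integral>\<^sup>+z. f (j + k) z \<partial>lborel) = \<dots>" .
  qed
  also have "\<dots> = ennreal (K * (Gamma ?m / 2 * (v + w) powr (- ?m))) *
      (ennreal (exp ((v * x)^2 / (v + w) + (w * y)^2 / (v + w))) * bessel_series ?m ((v * x)^2 / (v + w) * ((w * y)^2 / (v + w))))"
    using vw by (subst bessel_series_convolution[OF m, symmetric]) auto
  also have "(v * x)^2 / (v + w) * ((w * y)^2 / (v + w)) = (v * w / (v + w) * x * y)^2"
    by (simp add: power_divide power_mult_distrib power2_eq_square)
  also have "ennreal (K * (Gamma ?m / 2 * (v + w) powr (- ?m))) *
      (ennreal (exp ((v * x)^2 / (v + w) + (w * y)^2 / (v + w))) * bessel_series ?m ((v * w / (v + w) * x * y)^2))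
     = ennreal (Gamma ?m / 2 * (v + w) powr (- ?m)) *
      (ennreal (K * exp ((v * x)^2 / (v + w) + (w * y)^2 / (v + w))) * bessel_series ?m ((v * w / (v + w) * x * y)^2))"
  proof -
    have alg: "ennreal (K * g) * (ennreal e * S) = ennreal g * (ennreal (K * e) * S)" if "g \<ge> 0" "e \<ge> 0" for g e S
      using K that by (simp add: ennreal_mult mult_ac)
    show ?thesis by (rule alg) (use Gamma_real_pos[OF m] in auto)
  qed
  \<comment> \<open>Both coefficients reduce by \<open>v - v^2 / (v + w) = v * w / (v + w)\<close>,
    which is symmetric in \<open>v\<close> and \<open>w\<close>.\<close>
  also have "K * exp ((v * x)^2 / (v + w) + (w * y)^2 / (v + w)) = exp (- (v * w / (v + w) * (x^2 + y^2)))"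
  proof -
    have "- (v * x^2) + - (w * y^2) + ((v * x)^2 / (v + w) + (w * y)^2 / (v + w))
       = - (v * w / (v + w) * (x^2 + y^2))"
    proof -
      define S where "S = v + w"
      have S: "S \<noteq> 0" and w_eq: "w = S - v" using vw by (simp_all add: S_def)
      show ?thesis unfolding S_def[symmetric] unfolding w_eq using S by (simp add: field_simps power2_eq_square)
    qed
    thus ?thesis unfolding K_def exp_add[symmetric] by simp
  qed
  finally show ?thesis by (simp add: heat_def)
qed

end

section \<open>Subordination and the Poisson semigroup\<close>

lemma nn_integral_gaussian: "(\<integral>\<^sup>+w. ennreal (exp (- (w^2))) \<partial>lborel) = ennreal (sqrt pi)"
proof -
  let ?h = "\<integral>\<^sup>+w. ennreal (exp (- (w^2))) * indicator {0<..} w \<partial>lborel"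
  have "?h = (\<integral>\<^sup>+w. ennreal (w powr (2 * (1/2) - 1) * exp (- (1 * w^2))) * indicator {0<..} w \<partial>lborel)"
    by (intro nn_integral_cong) (auto simp: indicator_def)
  also have "\<dots> = ennreal (sqrt pi / 2)"
    by (subst nn_integral_gaussian_powr) (auto simp: Gamma_one_half_real)
  finally have h: "?h = ennreal (sqrt pi / 2)" .
  have r: "?h = (\<integral>\<^sup>+w. ennreal (exp (- (w^2))) * indicator {..<0} w \<partial>lborel)"
  proof -
    have "?h = ennreal \<bar>-1\<bar> * (\<integral>\<^sup>+w. ennreal (exp (- ((0 + (-1) * w)^2))) * indicator {0<..} (0 + (-1) * w) \<partial>lborel)"
      by (rule nn_integral_real_affine) measurable
    also have "\<dots> = (\<integral>\<^sup>+w. ennreal (exp (- (w^2))) * indicator {..<0} w \<partial>lborel)"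
      by (simp, intro nn_integral_cong) (auto simp: indicator_def)
    finally show ?thesis .
  qed
  have "(\<integral>\<^sup>+w. ennreal (exp (- (w^2))) \<partial>lborel)
     = (\<integral>\<^sup>+w. ennreal (exp (- (w^2))) * indicator {0<..} w + ennreal (exp (- (w^2))) * indicator {..<0} w \<partial>lborel)"
  proof (rule nn_integral_cong_AE)
    show "AE w in lborel. ennreal (exp (- (w^2))) = ennreal (exp (- (w^2))) * indicator {0<..} w + ennreal (exp (- (w^2))) * indicator {..<0} w"
      using AE_lborel_singleton[of "0::real"] by eventually_elim (auto simp: indicator_def)
  qed
  also have "\<dots> = ?h + ?h" unfolding r by (subst nn_integral_add) (auto simp: r)
  also have "\<dots> = ennreal (sqrt pi)" unfolding h by (simp flip: ennreal_plus)
  finally show ?thesis .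
qed

text \<open>With \<open>g p = a / sqrt p - b * sqrt p\<close> the exponent is
  \<open>- ((g p)^2 + 2 * a * b)\<close>, and \<open>g\<close> maps the half-line decreasingly onto
  the real line. Its derivative combines the weights \<open>p powr (- 1/2)\<close> and
  \<open>p powr (- 3/2)\<close>, so the substitution yields one relation between the integrals
  \<open>A\<close> and \<open>B\<close>; an inversion of the half-line yields the second.\<close>

lemma nn_integral_exp_quotient:
  assumes a: "a > 0" and b: "b > 0"
  shows "(\<integral>\<^sup>+p. ennreal (p powr (- 1/2) * (1 + 1 / p) * exp (- (a^2 / p + b^2 * p))) * indicator {0<..} p \<partial>lborel)
    = ennreal (sqrt pi * (1 / a + 1 / b) * exp (- (2 * a * b)))"
proof -
  define g where "g = (\<lambda>p. a / sqrt p - b * sqrt p)"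
  have [measurable]: "g \<in> borel_measurable borel" unfolding g_def by measurable
  define A where "A = (\<integral>\<^sup>+p. ennreal (exp (- ((g p)^2)) / (p * sqrt p)) * indicator {0<..} p \<partial>lborel)"
  define B where "B = (\<integral>\<^sup>+p. ennreal (exp (- ((g p)^2)) / sqrt p) * indicator {0<..} p \<partial>lborel)"
  have mono: "g p < g q" if "0 < q" "q < p" for p q
  proof -
    have "a / sqrt p < a / sqrt q" using that a by (intro divide_strict_left_mono) auto
    moreover have "b * sqrt q < b * sqrt p" using that b by simp
    ultimately show ?thesis by (simp add: g_def)
  qed
  hence inj: "inj_on g {0<..}"
    by (intro linorder_inj_onI) (auto, metis less_irrefl)
  have im: "g ` {0<..} = UNIV"
  proof (intro equalityI subset_UNIV subsetI)
    fix w :: real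
    \<comment> \<open>With \<open>q = 1 / sqrt p\<close>, the equation \<open>g p = w\<close>
      becomes \<open>a * q^2 - w * q - b = 0\<close>; this is its positive root.\<close>
    define q where "q = (w + sqrt (w^2 + 4 * a * b)) / (2 * a)"
    have r: "\<bar>w\<bar> < sqrt (w^2 + 4 * a * b)"
      by (rule real_less_rsqrt) (use a b in simp)
    have q: "q > 0" using a r unfolding q_def by (intro divide_pos_pos) auto
    have "2 * a * q - w = sqrt (w^2 + 4 * a * b)" using a by (simp add: q_def)
    hence "(2 * a * q - w)^2 = w^2 + 4 * a * b" using a b by simp
    hence "4 * a * (a * q^2 - w * q - b) = 0" by (simp add: power2_eq_square algebra_simps)
    hence "a * q^2 - w * q - b = 0" using a by simp
    hence "a * q - b / q = w" using q by (simp add: power2_eq_square field_simps)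
    moreover have "g (1 / q^2) = a * q - b / q" using q by (simp add: g_def real_sqrt_divide)
    ultimately show "w \<in> g ` {0<..}" using q by (intro image_eqI[of _ _ "1 / q^2"]) auto
  qed
  have der: "(g has_field_derivative - (a / (2 * p * sqrt p)) - b / (2 * sqrt p)) (at p)" if "p \<in> {0<..}" for p
    unfolding g_def using that
    by (auto intro!: derivative_eq_intros simp: field_simps)
  have "ennreal (sqrt pi) = (\<integral>\<^sup>+w. ennreal (exp (- (w^2))) * indicator (g ` {0<..}) w \<partial>lborel)"
    by (simp add: im nn_integral_gaussian)
  also have "\<dots> = (\<integral>\<^sup>+p. ennreal (\<bar>- (a / (2 * p * sqrt p)) - b / (2 * sqrt p)\<bar> * exp (- ((g p)^2))) * indicator {0<..} p \<partial>lborel)"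
    by (rule nn_integral_change_of_variables[OF _ _ der inj]) (auto simp: im)
  also have "\<dots> = (\<integral>\<^sup>+p. ennreal (a / 2) * (ennreal (exp (- ((g p)^2)) / (p * sqrt p)) * indicator {0<..} p)
      + ennreal (b / 2) * (ennreal (exp (- ((g p)^2)) / sqrt p) * indicator {0<..} p) \<partial>lborel)"
  proof (intro nn_integral_cong)
    fix p :: real
    show "ennreal (\<bar>- (a / (2 * p * sqrt p)) - b / (2 * sqrt p)\<bar> * exp (- ((g p)^2))) * indicator {0<..} p
      = ennreal (a / 2) * (ennreal (exp (- ((g p)^2)) / (p * sqrt p)) * indicator {0<..} p)
      + ennreal (b / 2) * (ennreal (exp (- ((g p)^2)) / sqrt p) * indicator {0<..} p)"
    proof (cases "p > 0")
      case True
      have "\<bar>- (a / (2 * p * sqrt p)) - b / (2 * sqrt p)\<bar> * exp (- ((g p)^2))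
        = (a / 2) * (exp (- ((g p)^2)) / (p * sqrt p)) + (b / 2) * (exp (- ((g p)^2)) / sqrt p)"
      proof -
        have "a / (2 * p * sqrt p) > 0" "b / (2 * sqrt p) > 0" using True a b by simp_all
        hence "\<bar>- (a / (2 * p * sqrt p)) - b / (2 * sqrt p)\<bar> = a / (2 * p * sqrt p) + b / (2 * sqrt p)"
          by linarith
        thus ?thesis by (simp add: distrib_right)
      qed
      thus ?thesis using True a b by (simp only: ennreal_plus ennreal_mult) (simp add: ennreal_mult[symmetric] ennreal_plus[symmetric] del: ennreal_plus times_divide_eq_left times_divide_eq_right)
    qed simp
  qed
  also have "\<dots> = ennreal (a / 2) * A + ennreal (b / 2) * B"
    unfolding A_def B_def by (subst nn_integral_add) (auto simp: nn_integral_cmult)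
  finally have 1: "ennreal (sqrt pi) = ennreal (a / 2) * A + ennreal (b / 2) * B" .
  \<comment> \<open>The inversion taking \<open>p\<close> to \<open>k / p\<close> turns
    \<open>g\<close> into \<open>- g\<close>; its fixed point \<open>a / b\<close> is the zero of
    \<open>g\<close>. It exchanges the two weights up to the factor \<open>a / b\<close>.\<close>
  define k where "k = (a / b)^2"
  have k: "k > 0" "sqrt k = a / b" using a b by (simp_all add: k_def)
  have imk: "(\<lambda>p. k / p) ` {0<..} = {0<..}"
    by (rule image_Ioi_self[where h = "\<lambda>p. k / p"]) (use k in auto)
  have "B = (\<integral>\<^sup>+p. ennreal (exp (- ((g p)^2)) / sqrt p * indicator {0<..} p) * indicator ((\<lambda>p. k / p) ` {0<..}) p \<partial>lborel)"
    unfolding B_def imk by (intro nn_integral_cong) (auto simp: indicator_def)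
  also have "\<dots> = (\<integral>\<^sup>+p. ennreal (\<bar>- k / p^2\<bar> * (exp (- ((g (k / p))^2)) / sqrt (k / p) * indicator {0<..} (k / p))) * indicator {0<..} p \<partial>lborel)"
    by (rule nn_integral_change_of_variables)
       (use k in \<open>auto simp: imk power2_eq_square inj_on_def indicator_def intro!: derivative_eq_intros\<close>)
  also have "\<dots> = (\<integral>\<^sup>+p. ennreal (a / b) * (ennreal (exp (- ((g p)^2)) / (p * sqrt p)) * indicator {0<..} p) \<partial>lborel)"
  proof (intro nn_integral_cong)
    fix p :: real
    show "ennreal (\<bar>- k / p^2\<bar> * (exp (- ((g (k / p))^2)) / sqrt (k / p) * indicator {0<..} (k / p))) * indicator {0<..} p
      = ennreal (a / b) * (ennreal (exp (- ((g p)^2)) / (p * sqrt p)) * indicator {0<..} p)"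
    proof (cases "p > 0")
      case True
      have s: "sqrt (k / p) = a / (b * sqrt p)" using k by (simp add: real_sqrt_divide)
      have "g (k / p) = - g p" unfolding g_def s using a b True by (simp add: field_simps)
      hence g2: "(g (k / p))^2 = (g p)^2" by simp
      have "\<bar>- k / p^2\<bar> / sqrt (k / p) = a / b * (1 / (p * sqrt p))"
      proof -
        show ?thesis unfolding s unfolding k_def using a b True by (simp add: power2_eq_square field_simps)
      qed
      hence "\<bar>- k / p^2\<bar> * (exp (- ((g (k / p))^2)) / sqrt (k / p)) = a / b * (exp (- ((g p)^2)) / (p * sqrt p))"
        unfolding g2 by (metis (no_types, lifting) mult.commute mult.left_commute mult.right_neutral times_divide_eq_right)
      thus ?thesis using True k a b by (simp add: ennreal_mult[symmetric] del: times_divide_eq_left times_divide_eq_right)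
    qed simp
  qed
  also have "\<dots> = ennreal (a / b) * A" unfolding A_def by (rule nn_integral_cmult) measurable
  finally have 2: "B = ennreal (a / b) * A" .
  have "ennreal (b / 2) * B = ennreal (a / 2) * A"
    unfolding 2 using a b by (simp add: mult.assoc[symmetric] ennreal_mult[symmetric])
  hence "ennreal (sqrt pi) = ennreal (a / 2) * A + ennreal (a / 2) * A" using 1 by simp
  also have "\<dots> = (ennreal (a / 2) + ennreal (a / 2)) * A" by (simp only: distrib_right)
  also have "ennreal (a / 2) + ennreal (a / 2) = ennreal a" using a by (simp flip: ennreal_plus)
  finally have A: "A = ennreal (sqrt pi / a)" by (rule ennreal_eq_cmultD) (use a in auto)
  have B: "B = ennreal (sqrt pi / b)"
    unfolding 2 A using a b by (simp add: ennreal_mult[symmetric])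
  have "(\<integral>\<^sup>+p. ennreal (p powr (- 1/2) * (1 + 1 / p) * exp (- (a^2 / p + b^2 * p))) * indicator {0<..} p \<partial>lborel)
     = (\<integral>\<^sup>+p. ennreal (exp (- (2 * a * b))) * (ennreal (exp (- ((g p)^2)) / (p * sqrt p)) * indicator {0<..} p
        + ennreal (exp (- ((g p)^2)) / sqrt p) * indicator {0<..} p) \<partial>lborel)"
  proof (intro nn_integral_cong)
    fix p :: real
    show "ennreal (p powr (- 1/2) * (1 + 1 / p) * exp (- (a^2 / p + b^2 * p))) * indicator {0<..} p
     = ennreal (exp (- (2 * a * b))) * (ennreal (exp (- ((g p)^2)) / (p * sqrt p)) * indicator {0<..} p
        + ennreal (exp (- ((g p)^2)) / sqrt p) * indicator {0<..} p)"
    proof (cases "p > 0")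
      case True
      have "(g p)^2 = a^2 / p + b^2 * p - 2 * a * b"
        using True by (simp add: g_def power2_diff power_divide power_mult_distrib)
      hence e: "exp (- (a^2 / p + b^2 * p)) = exp (- (2 * a * b)) * exp (- ((g p)^2))"
        by (simp add: exp_add[symmetric])
      have r: "p powr (- 1/2) = 1 / sqrt p"
        using True by (simp add: powr_minus_divide powr_half_sqrt)
      have "p powr (- 1/2) * (1 + 1 / p) * exp (- (a^2 / p + b^2 * p))
         = exp (- (2 * a * b)) * (exp (- ((g p)^2)) / (p * sqrt p) + exp (- ((g p)^2)) / sqrt p)"
        unfolding e r using True by (simp add: field_simps)
      thus ?thesis using True by (simp add: ennreal_mult ennreal_plus)
    qed simp
  qed
  also have "\<dots> = ennreal (exp (- (2 * a * b))) * (A + B)"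
    unfolding A_def B_def by (subst nn_integral_cmult, simp) (subst nn_integral_add, auto)
  also have "\<dots> = ennreal (sqrt pi * (1 / a + 1 / b) * exp (- (2 * a * b)))"
    unfolding A B using a b by (simp add: ennreal_mult[symmetric] ennreal_plus[symmetric] algebra_simps del: ennreal_plus)
  finally show ?thesis .
qed

context
  fixes lam :: real
  assumes lam: "lam > 0"
begin

definition subordination_const :: real where
  "subordination_const = 2 * lam / pi / Gamma (lam + 1) * sin_cos_moment lam 0"

text \<open>The power \<open>- (lam + 1)\<close> of the denominator is a Gamma integral over
  \<open>v\<close>; after exchanging integrals, the angular integral of
  \<open>exp (2 * v * x * y * cos \<theta>)\<close> is a Bessel series. Apart from the factor
  \<open>v powr (lam + 1/2)\<close> that belongs to the heat kernel, the weight is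
  \<open>v powr (- 1/2) * exp (- (v * t^2))\<close>, up to constants the one-sided stable density of
  index 1/2 in the time \<open>1 / (4 * v)\<close>.\<close>

lemma poisson_kernel_subordination:
  assumes t: "t > 0"
  shows "ennreal (poisson_kernel lam t x y) = ennreal (subordination_const * t) *
    (\<integral>\<^sup>+v. ennreal (v powr lam * exp (- (v * t^2))) * heat lam v x y * indicator {0<..} v \<partial>lborel)"
proof -
  let ?G = "Gamma (lam + 1)" and ?M = "sin_cos_moment lam 0"
  note [measurable] = measurable_heat[of lam]
  have G: "?G > 0" using lam by (intro Gamma_real_pos) simp
  hence G0: "?G \<noteq> 0" by (metis less_irrefl)
  have M: "?M \<ge> 0" using sin_cos_moment_nonneg[OF lam, of 0] by simp
  define I where "I = (\<integral>\<^sup>+\<theta>. ennreal (sin \<theta> powr (2 * lam - 1) / poisson_denom t x y \<theta> powr (lam + 1))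
         * indicator {0<..<pi} \<theta> \<partial>lborel)"
  define H where "H = (\<integral>\<^sup>+v. ennreal (v powr lam * exp (- (v * t^2))) * heat lam v x y * indicator {0<..} v \<partial>lborel)"
  have [measurable]: "(\<lambda>\<theta>. poisson_denom t x y \<theta>) \<in> borel_measurable borel"
    unfolding poisson_denom_def by measurable
  have "ennreal ?G * I = (\<integral>\<^sup>+\<theta>. ennreal ?G * (ennreal (sin \<theta> powr (2 * lam - 1) / poisson_denom t x y \<theta> powr (lam + 1))
         * indicator {0<..<pi} \<theta>) \<partial>lborel)"
    unfolding I_def by (rule nn_integral_cmult[symmetric]) measurable
  also have "\<dots> = (\<integral>\<^sup>+\<theta>. (\<integral>\<^sup>+v. ennreal (sin \<theta> powr (2 * lam - 1)) * indicator {0<..<pi} \<theta> *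
       (ennreal (v powr lam * exp (- (poisson_denom t x y \<theta> * v))) * indicator {0<..} v) \<partial>lborel) \<partial>lborel)"
  proof (intro nn_integral_cong)
    fix \<theta> :: real
    let ?D = "poisson_denom t x y \<theta>"
    have D: "?D > 0" using t by (rule poisson_denom_pos)
    have e: "(\<integral>\<^sup>+v. ennreal (v powr lam * exp (- (?D * v))) * indicator {0<..} v \<partial>lborel) = ennreal (?G * ?D powr (- (lam + 1)))"
      using nn_integral_exp_powr[of "lam + 1" ?D] D lam by simp
    have "(\<integral>\<^sup>+v. ennreal (sin \<theta> powr (2 * lam - 1)) * indicator {0<..<pi} \<theta> *
       (ennreal (v powr lam * exp (- (?D * v))) * indicator {0<..} v) \<partial>lborel)
       = ennreal (sin \<theta> powr (2 * lam - 1)) * indicator {0<..<pi} \<theta> * ennreal (?G * ?D powr (- (lam + 1)))"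
      unfolding e[symmetric] by (rule nn_integral_cmult) measurable
    also have "\<dots> = ennreal ?G * (ennreal (sin \<theta> powr (2 * lam - 1) / ?D powr (lam + 1)) * indicator {0<..<pi} \<theta>)"
      unfolding powr_minus_divide using G by (auto simp: indicator_def ennreal_mult[symmetric] mult_ac)
    finally show "ennreal ?G * (ennreal (sin \<theta> powr (2 * lam - 1) / ?D powr (lam + 1)) * indicator {0<..<pi} \<theta>)
      = (\<integral>\<^sup>+v. ennreal (sin \<theta> powr (2 * lam - 1)) * indicator {0<..<pi} \<theta> *
       (ennreal (v powr lam * exp (- (?D * v))) * indicator {0<..} v) \<partial>lborel)" by (rule sym)
  qed
  also have "\<dots> = (\<integral>\<^sup>+v. (\<integral>\<^sup>+\<theta>. ennreal (sin \<theta> powr (2 * lam - 1)) * indicator {0<..<pi} \<theta> *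
       (ennreal (v powr lam * exp (- (poisson_denom t x y \<theta> * v))) * indicator {0<..} v) \<partial>lborel) \<partial>lborel)"
    by (rule lborel_pair.Fubini'[symmetric]) measurable
  also have "\<dots> = (\<integral>\<^sup>+v. ennreal ?M * (ennreal (v powr lam * exp (- (v * t^2))) * heat lam v x y * indicator {0<..} v) \<partial>lborel)"
  proof (intro nn_integral_cong)
    fix v :: real
    let ?c = "ennreal (v powr lam * exp (- (v * t^2)) * exp (- (v * (x^2 + y^2)))) * indicator {0<..} v"
    have "exp (- (poisson_denom t x y \<theta> * v)) = exp (- (v * t^2)) * exp (- (v * (x^2 + y^2))) * exp ((2 * v * x * y) * cos \<theta>)" for \<theta>
      by (simp add: poisson_denom_def exp_add[symmetric] algebra_simps)
    hence "(\<integral>\<^sup>+\<theta>. ennreal (sin \<theta> powr (2 * lam - 1)) * indicator {0<..<pi} \<theta> *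
       (ennreal (v powr lam * exp (- (poisson_denom t x y \<theta> * v))) * indicator {0<..} v) \<partial>lborel)
      = (\<integral>\<^sup>+\<theta>. ?c * (ennreal (sin \<theta> powr (2 * lam - 1) * exp ((2 * v * x * y) * cos \<theta>)) * indicator {0<..<pi} \<theta>) \<partial>lborel)"
      by (intro nn_integral_cong) (auto simp: indicator_def ennreal_mult[symmetric] mult_ac)
    also have "\<dots> = ?c * (\<integral>\<^sup>+\<theta>. ennreal (sin \<theta> powr (2 * lam - 1) * exp ((2 * v * x * y) * cos \<theta>)) * indicator {0<..<pi} \<theta> \<partial>lborel)"
      by (rule nn_integral_cmult) measurable
    also have "\<dots> = ?c * (ennreal ?M * bessel_series (lam + 1/2) ((2 * v * x * y)^2 / 4))"
      by (subst nn_integral_sin_exp_cos[OF lam]) simp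
    also have "(2 * v * x * y)^2 / 4 = (v * x * y)^2" by (simp add: power2_eq_square)
    also have "?c * (ennreal ?M * bessel_series (lam + 1/2) ((v * x * y)^2))
       = ennreal ?M * (ennreal (v powr lam * exp (- (v * t^2))) * heat lam v x y * indicator {0<..} v)"
      by (simp add: heat_def[OF lam] ennreal_mult mult_ac)
    finally show "(\<integral>\<^sup>+\<theta>. ennreal (sin \<theta> powr (2 * lam - 1)) * indicator {0<..<pi} \<theta> *
       (ennreal (v powr lam * exp (- (poisson_denom t x y \<theta> * v))) * indicator {0<..} v) \<partial>lborel) = \<dots>" .
  qed
  also have "\<dots> = ennreal ?M * H"
    unfolding H_def by (rule nn_integral_cmult) (use lam in measurable)
  finally have GI: "ennreal ?G * I = ennreal ?M * H" .
  have "ennreal (poisson_kernel lam t x y) = ennreal (2 * lam * t / pi) * I"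
    unfolding I_def by (rule poisson_kernel_nn_integral[OF lam t])
  also have "ennreal (2 * lam * t / pi) = ennreal (2 * lam * t / pi / ?G) * ennreal ?G"
    using G lam t by (subst ennreal_mult[symmetric]) (auto simp: G0)
  also have "\<dots> * I = ennreal (2 * lam * t / pi / ?G) * ennreal ?M * H"
    by (simp only: mult.assoc GI)
  also have "ennreal (2 * lam * t / pi / ?G) * ennreal ?M = ennreal (subordination_const * t)"
    using G lam t M by (simp add: ennreal_mult[symmetric] subordination_const_def mult_ac)
  finally show ?thesis by (simp add: H_def)
qed

text \<open>Once the heat semigroup has removed \<open>z\<close>, it remains to convolve two
  subordination densities. Suitable variables are \<open>p = w / v\<close> and
  \<open>V = v * w / (v + w)\<close>: the heat kernel depends on \<open>V\<close> alone, and the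
  integral over \<open>p\<close> is \<open>nn_integral_exp_quotient\<close>.\<close>

lemma poisson_kernel_semigroup:
  assumes t: "t > 0" and s: "s > 0"
  shows "(\<integral>\<^sup>+z. ennreal (poisson_kernel lam t x z) * ennreal (poisson_kernel lam s z y) \<partial>bessel_measure lam)
    = ennreal (subordination_const * (Gamma (lam + 1/2) / 2) * sqrt pi) * ennreal (poisson_kernel lam (t + s) x y)"
proof -
  let ?m = "bessel_measure lam" and ?c = "subordination_const"
  note [measurable] = measurable_heat[of lam, OF lam]
  define \<kappa> where "\<kappa> = (\<lambda>z. ennreal (z powr (2 * lam)) * indicator {0::real<..} z)"
  have [measurable]: "\<kappa> \<in> borel_measurable borel" unfolding \<kappa>_def by measurable
  have bessel: "(\<integral>\<^sup>+z. f z \<partial>?m) = (\<integral>\<^sup>+z. \<kappa> z * f z \<partial>lborel)" if "f \<in> borel_measurable borel" for f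
    unfolding nn_integral_bessel[OF that] \<kappa>_def by (simp add: mult_ac)
  note [measurable] = measurable_poisson_kernel[OF lam t] measurable_poisson_kernel[OF lam s]
  have G: "Gamma (lam + 1/2) > 0" using lam by (intro Gamma_real_pos) simp
  have c: "?c \<ge> 0"
    using sin_cos_moment_nonneg[OF lam, of 0] lam Gamma_real_pos[of "lam + 1"]
    by (auto simp: subordination_const_def intro!: mult_nonneg_nonneg divide_nonneg_nonneg)
  define \<phi> where "\<phi> = (\<lambda>t v. ennreal (v powr lam * exp (- (v * t^2))) * indicator {0::real<..} v)"
  have [measurable]: "(\<lambda>v. \<phi> r v) \<in> borel_measurable borel" for r unfolding \<phi>_def by measurable
  have kern: "ennreal (poisson_kernel lam r a b) = ennreal (?c * r) * (\<integral>\<^sup>+v. \<phi> r v * heat lam v a b \<partial>lborel)"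
    if "r > 0" for r a b
    unfolding poisson_kernel_subordination[OF that] \<phi>_def by (simp add: mult_ac)
  \<comment> \<open>What remains of the integrand in \<open>v\<close> and \<open>w\<close> after
    integration over \<open>z\<close>, apart from the constants in front.\<close>
  define Q where "Q = (\<lambda>v w. ennreal ((v powr lam * exp (- (v * t^2))) * (w powr lam * exp (- (w * s^2)))
      * (Gamma (lam + 1/2) / 2 * (v + w) powr (- (lam + 1/2)))) * heat lam (v * w / (v + w)) x y
      * indicator {0<..} v * indicator {0<..} w)"
  have [measurable (raw)]: "(\<lambda>z. Q (f z) (g z)) \<in> borel_measurable M"
    if [measurable]: "f \<in> borel_measurable M" "g \<in> borel_measurable M" for f g and M :: "'m measure"
    unfolding Q_def by measurable
  let ?F = "\<lambda>v w z. \<phi> t v * \<phi> s w * (heat lam v x z * heat lam w z y)"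
  have "(\<integral>\<^sup>+z. ennreal (poisson_kernel lam t x z) * ennreal (poisson_kernel lam s z y) \<partial>?m)
    = (\<integral>\<^sup>+z. \<kappa> z * (ennreal (poisson_kernel lam t x z) * ennreal (poisson_kernel lam s z y)) \<partial>lborel)"
    by (rule bessel) measurable
  also have "\<dots> = (\<integral>\<^sup>+z. ennreal (?c * t) * ennreal (?c * s) * (\<integral>\<^sup>+v. (\<integral>\<^sup>+w. \<kappa> z * ?F v w z \<partial>lborel) \<partial>lborel) \<partial>lborel)"
  proof (rule nn_integral_cong)
    fix z
    have "(\<integral>\<^sup>+v. (\<integral>\<^sup>+w. \<kappa> z * ?F v w z \<partial>lborel) \<partial>lborel)
       = (\<integral>\<^sup>+v. (\<kappa> z * (\<phi> t v * heat lam v x z)) * (\<integral>\<^sup>+w. \<phi> s w * heat lam w z y \<partial>lborel) \<partial>lborel)"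
      by (rule nn_integral_cong, subst nn_integral_cmult[symmetric]) (auto simp: mult_ac)
    also have "\<dots> = (\<integral>\<^sup>+v. \<kappa> z * (\<phi> t v * heat lam v x z) \<partial>lborel) * (\<integral>\<^sup>+w. \<phi> s w * heat lam w z y \<partial>lborel)"
      by (rule nn_integral_multc) measurable
    also have "(\<integral>\<^sup>+v. \<kappa> z * (\<phi> t v * heat lam v x z) \<partial>lborel) = \<kappa> z * (\<integral>\<^sup>+v. \<phi> t v * heat lam v x z \<partial>lborel)"
      by (rule nn_integral_cmult) measurable
    finally show "\<kappa> z * (ennreal (poisson_kernel lam t x z) * ennreal (poisson_kernel lam s z y))
      = ennreal (?c * t) * ennreal (?c * s) * (\<integral>\<^sup>+v. (\<integral>\<^sup>+w. \<kappa> z * ?F v w z \<partial>lborel) \<partial>lborel)"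
      unfolding kern[OF t] kern[OF s] by (simp only: mult_ac)
  qed
  also have "\<dots> = ennreal (?c * t) * ennreal (?c * s) *
      (\<integral>\<^sup>+z. (\<integral>\<^sup>+v. (\<integral>\<^sup>+w. \<kappa> z * ?F v w z \<partial>lborel) \<partial>lborel) \<partial>lborel)"
    by (rule nn_integral_cmult) measurable
  also have "(\<integral>\<^sup>+z. (\<integral>\<^sup>+v. (\<integral>\<^sup>+w. \<kappa> z * ?F v w z \<partial>lborel) \<partial>lborel) \<partial>lborel)
    = (\<integral>\<^sup>+v. (\<integral>\<^sup>+z. (\<integral>\<^sup>+w. \<kappa> z * ?F v w z \<partial>lborel) \<partial>lborel) \<partial>lborel)"
    by (rule lborel_pair.Fubini') measurable
  also have "\<dots> = (\<integral>\<^sup>+v. (\<integral>\<^sup>+w. (\<integral>\<^sup>+z. \<kappa> z * ?F v w z \<partial>lborel) \<partial>lborel) \<partial>lborel)"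
    by (rule nn_integral_cong, rule lborel_pair.Fubini') measurable
  also have "\<dots> = (\<integral>\<^sup>+v. (\<integral>\<^sup>+w. Q v w \<partial>lborel) \<partial>lborel)"
  proof (rule nn_integral_cong, rule nn_integral_cong)
    fix v w :: real
    have "(\<integral>\<^sup>+z. \<kappa> z * ?F v w z \<partial>lborel) = (\<integral>\<^sup>+z. \<phi> t v * \<phi> s w * (\<kappa> z * (heat lam v x z * heat lam w z y)) \<partial>lborel)"
      by (simp only: mult_ac)
    also have "\<dots> = \<phi> t v * \<phi> s w * (\<integral>\<^sup>+z. \<kappa> z * (heat lam v x z * heat lam w z y) \<partial>lborel)"
      by (rule nn_integral_cmult) measurable
    also have "(\<integral>\<^sup>+z. \<kappa> z * (heat lam v x z * heat lam w z y) \<partial>lborel) = (\<integral>\<^sup>+z. heat lam v x z * heat lam w z y \<partial>?m)"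
      by (rule bessel[symmetric]) measurable
    also have "\<phi> t v * \<phi> s w * \<dots> = Q v w"
    proof (cases "v > 0 \<and> w > 0")
      case True
      hence v: "v > 0" and w: "w > 0" by auto
      have alg: "ennreal a * ennreal b * (ennreal d * h) = ennreal (a * b * d) * h" if "a \<ge> 0" "b \<ge> 0" "d \<ge> 0" for a b d h
        using that by (simp add: ennreal_mult mult_ac)
      have "\<phi> t v * \<phi> s w * (\<integral>\<^sup>+z. heat lam v x z * heat lam w z y \<partial>?m) =
        ennreal (v powr lam * exp (- (v * t^2))) * ennreal (w powr lam * exp (- (w * s^2))) *
          (ennreal (Gamma (lam + 1/2) / 2 * (v + w) powr (- (lam + 1/2))) * heat lam (v * w / (v + w)) x y)"
        unfolding heat_semigroup[OF lam v w] \<phi>_def using v w by simp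
      also have "\<dots> = Q v w"
        using v w G by (subst alg) (auto simp: Q_def)
      finally show ?thesis .
    qed (auto simp: \<phi>_def Q_def)
    finally show "(\<integral>\<^sup>+z. \<kappa> z * ?F v w z \<partial>lborel) = Q v w" .
  qed
  \<comment> \<open>Substitution \<open>w = v * p\<close>; the parameter of the heat kernel becomes
    \<open>v * p / (1 + p)\<close>.\<close>
  also have "\<dots> = (\<integral>\<^sup>+v. (\<integral>\<^sup>+p. ennreal v * Q v (v * p) \<partial>lborel) \<partial>lborel)"
  proof (rule nn_integral_cong)
    fix v :: real
    show "(\<integral>\<^sup>+w. Q v w \<partial>lborel) = (\<integral>\<^sup>+p. ennreal v * Q v (v * p) \<partial>lborel)"
    proof (cases "v > 0")
      case True
      have "(\<integral>\<^sup>+w. Q v w \<partial>lborel) = ennreal \<bar>v\<bar> * (\<integral>\<^sup>+p. Q v (0 + v * p) \<partial>lborel)"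
        by (rule nn_integral_real_affine) (use True in auto)
      also have "\<dots> = (\<integral>\<^sup>+p. ennreal v * Q v (v * p) \<partial>lborel)"
        using True by (subst nn_integral_cmult) auto
      finally show ?thesis .
    qed (simp add: Q_def)
  qed
  also have "\<dots> = (\<integral>\<^sup>+p. (\<integral>\<^sup>+v. ennreal v * Q v (v * p) \<partial>lborel) \<partial>lborel)"
    by (rule lborel_pair.Fubini'[symmetric]) measurable
  also have "\<dots> = (\<integral>\<^sup>+p. (\<integral>\<^sup>+V. ennreal (Gamma (lam + 1/2) / 2) * (ennreal (V powr (lam + 1/2) * exp (- (V * (t^2 + s^2)))) * heat lam V x y * indicator {0<..} V)
      * (ennreal (p powr (- 1/2) * (1 + 1 / p) * exp (- (V * t^2 / p + V * s^2 * p))) * indicator {0<..} p) \<partial>lborel) \<partial>lborel)"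
  proof (rule nn_integral_cong)
    fix p :: real
    show "(\<integral>\<^sup>+v. ennreal v * Q v (v * p) \<partial>lborel) = (\<integral>\<^sup>+V. ennreal (Gamma (lam + 1/2) / 2) * (ennreal (V powr (lam + 1/2) * exp (- (V * (t^2 + s^2)))) * heat lam V x y * indicator {0<..} V)
      * (ennreal (p powr (- 1/2) * (1 + 1 / p) * exp (- (V * t^2 / p + V * s^2 * p))) * indicator {0<..} p) \<partial>lborel)"
    proof (cases "p > 0")
      case False
      hence "Q v (v * p) = 0" for v by (auto simp: Q_def indicator_def zero_less_mult_iff)
      thus ?thesis using False by simp
    next
      case True
      \<comment> \<open>Chosen so that \<open>v = k * V\<close> makes this parameter equal to
        \<open>V\<close>, whatever \<open>p\<close> is.\<close>
      define k where "k = (1 + p) / p"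
      have k: "k > 0" using True by (simp add: k_def)
      have "(\<integral>\<^sup>+v. ennreal v * Q v (v * p) \<partial>lborel) = ennreal \<bar>k\<bar> * (\<integral>\<^sup>+V. ennreal (0 + k * V) * Q (0 + k * V) ((0 + k * V) * p) \<partial>lborel)"
        by (rule nn_integral_real_affine) (use k in auto)
      also have "\<dots> = (\<integral>\<^sup>+V. ennreal k * (ennreal (k * V) * Q (k * V) (k * V * p)) \<partial>lborel)"
        using k by (subst nn_integral_cmult) auto
      also have "\<dots> = (\<integral>\<^sup>+V. ennreal (Gamma (lam + 1/2) / 2) * (ennreal (V powr (lam + 1/2) * exp (- (V * (t^2 + s^2)))) * heat lam V x y * indicator {0<..} V)
      * (ennreal (p powr (- 1/2) * (1 + 1 / p) * exp (- (V * t^2 / p + V * s^2 * p))) * indicator {0<..} p) \<partial>lborel)"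
      proof (rule nn_integral_cong)
        fix V :: real
        show "ennreal k * (ennreal (k * V) * Q (k * V) (k * V * p))
          = ennreal (Gamma (lam + 1/2) / 2) * (ennreal (V powr (lam + 1/2) * exp (- (V * (t^2 + s^2)))) * heat lam V x y * indicator {0<..} V)
          * (ennreal (p powr (- 1/2) * (1 + 1 / p) * exp (- (V * t^2 / p + V * s^2 * p))) * indicator {0<..} p)"
        proof (cases "V > 0")
          case False
          hence "\<not> 0 < k * V" using k by (simp add: zero_less_mult_iff)
          thus ?thesis using False by (simp add: Q_def)
        next
          case V: True
          have pp: "1 + p > 0" using True by simp
          have sum: "k * V + k * V * p = V * (1 + p)^2 / p"
            using True by (simp add: k_def field_simps power2_eq_square)
          have quot: "(k * V) * (k * V * p) / (k * V + k * V * p) = V"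
          proof -
            have n1: "(k * V) * (k * V * p) = V * (k * V + k * V * p)"
              unfolding sum using True by (simp add: k_def field_simps power2_eq_square)
            have n2: "k * V + k * V * p \<noteq> 0" unfolding sum using True V by simp
            show ?thesis unfolding n1 using n2 by (rule nonzero_mult_div_cancel_right)
          qed
          have e: "exp (- (k * V * t^2)) * exp (- (k * V * p * s^2)) = exp (- (V * (t^2 + s^2))) * exp (- (V * t^2 / p + V * s^2 * p))"
          proof -
            have "- (k * V * t^2) + - (k * V * p * s^2) = - (V * (t^2 + s^2)) + - (V * t^2 / p + V * s^2 * p)"
              using True by (simp add: k_def field_simps)
            thus ?thesis by (simp only: exp_add[symmetric])
          qed
          have pw: "k * (k * V * ((k * V) powr lam * (k * V * p) powr lam * (k * V + k * V * p) powr (- (lam + 1/2))))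
            = V powr (lam + 1/2) * (p powr (- 1/2) * (1 + 1 / p))"
          proof -
            \<comment> \<open>Both sides are products of powers of \<open>p\<close>,
              \<open>1 + p\<close> and \<open>V\<close>, so logarithms turn the claim into a linear
              identity between exponents.\<close>
            let ?L = "ln p" and ?M = "ln (1 + p)" and ?N = "ln V"
            have lk: "ln k = ?M - ?L" using True pp by (simp add: k_def ln_div)
            have l1: "ln (k * V) = ?M - ?L + ?N" using k V lk by (simp add: ln_mult)
            have l2: "ln (k * V * p) = ?M + ?N" using k V True l1 by (simp add: ln_mult)
            have l3: "ln (k * V + k * V * p) = ?N + 2 * ?M - ?L"
              unfolding sum using V True pp by (simp add: ln_mult ln_div ln_realpow)
            have pos: "k * V > 0" "k * V * p > 0" "k * V + k * V * p > 0" using k V True by (simp_all add: add_pos_pos)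
            have kM: "k = exp (?M - ?L)" using lk k by (metis exp_ln)
            have VM: "V = exp ?N" using V by simp
            have "1 + 1 / p = exp (?M - ?L)" using kM True by (simp add: k_def field_simps)
            hence R: "V powr (lam + 1/2) * (p powr (- 1/2) * (1 + 1 / p))
              = exp ((lam + 1/2) * ?N + (- 1/2) * ?L + (?M - ?L))"
              using V True by (simp add: powr_def exp_add[symmetric] algebra_simps)
            have "k * V = exp (?M - ?L + ?N)" using l1 pos(1) by (metis exp_ln)
            hence "k * (k * V * ((k * V) powr lam * (k * V * p) powr lam * (k * V + k * V * p) powr (- (lam + 1/2))))
              = exp (?M - ?L) * (exp (?M - ?L + ?N) * (exp (lam * (?M - ?L + ?N)) * exp (lam * (?M + ?N)) * exp (- (lam + 1/2) * (?N + 2 * ?M - ?L))))"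
              using pos kM l1 l2 l3 True by (simp add: powr_def)
            also have "\<dots> = exp ((lam + 1/2) * ?N + (- 1/2) * ?L + (?M - ?L))"
              unfolding exp_add[symmetric] by (rule arg_cong[of _ _ exp]) (simp add: algebra_simps)
            finally show ?thesis unfolding R .
          qed
          have "ennreal k * (ennreal (k * V) * Q (k * V) (k * V * p))
            = ennreal (k * (k * V * ((k * V) powr lam * exp (- (k * V * t^2)) * ((k * V * p) powr lam * exp (- (k * V * p * s^2)))
               * (Gamma (lam + 1/2) / 2 * (k * V + k * V * p) powr (- (lam + 1/2)))))) * heat lam V x y"
          proof -
            have "ennreal a * (ennreal b * (ennreal d * h)) = ennreal (a * (b * d)) * h" if "a \<ge> 0" "b \<ge> 0" "d \<ge> 0" for a b d h
              using that by (simp add: ennreal_mult mult.assoc)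
            note this[of k "k * V" "(k * V) powr lam * exp (- (k * V * t^2)) * ((k * V * p) powr lam * exp (- (k * V * p * s^2)))
               * (Gamma (lam + 1/2) / 2 * (k * V + k * V * p) powr (- (lam + 1/2)))" "heat lam V x y"]
            moreover have "Q (k * V) (k * V * p) = ennreal ((k * V) powr lam * exp (- (k * V * t^2)) * ((k * V * p) powr lam * exp (- (k * V * p * s^2)))
               * (Gamma (lam + 1/2) / 2 * (k * V + k * V * p) powr (- (lam + 1/2)))) * heat lam V x y"
              unfolding Q_def quot using k V True by simp
            ultimately show ?thesis using k V G by simp
          qed
          also have "k * (k * V * ((k * V) powr lam * exp (- (k * V * t^2)) * ((k * V * p) powr lam * exp (- (k * V * p * s^2)))
               * (Gamma (lam + 1/2) / 2 * (k * V + k * V * p) powr (- (lam + 1/2)))))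
            = Gamma (lam + 1/2) / 2 * (k * (k * V * ((k * V) powr lam * (k * V * p) powr lam * (k * V + k * V * p) powr (- (lam + 1/2)))))
               * (exp (- (k * V * t^2)) * exp (- (k * V * p * s^2)))"
            by (simp only: mult_ac)
          also have "\<dots> = Gamma (lam + 1/2) / 2 * (V powr (lam + 1/2) * exp (- (V * (t^2 + s^2))))
               * (p powr (- 1/2) * (1 + 1 / p) * exp (- (V * t^2 / p + V * s^2 * p)))"
            unfolding pw e by (simp only: mult_ac)
          also have "ennreal \<dots> * heat lam V x y = ennreal (Gamma (lam + 1/2) / 2) * (ennreal (V powr (lam + 1/2) * exp (- (V * (t^2 + s^2)))) * heat lam V x y * indicator {0<..} V)
          * (ennreal (p powr (- 1/2) * (1 + 1 / p) * exp (- (V * t^2 / p + V * s^2 * p))) * indicator {0<..} p)"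
          proof -
            have "ennreal (g * a * b) * h = ennreal g * (ennreal a * h * 1) * (ennreal b * 1)"
              if "g \<ge> 0" "a \<ge> 0" "b \<ge> 0" for g a b h
              using that by (simp add: ennreal_mult mult_ac)
            note this[of "Gamma (lam + 1/2) / 2" "V powr (lam + 1/2) * exp (- (V * (t^2 + s^2)))"
               "p powr (- 1/2) * (1 + 1 / p) * exp (- (V * t^2 / p + V * s^2 * p))" "heat lam V x y"]
            moreover have "indicator {0<..} V = (1::ennreal)" "indicator {0<..} p = (1::ennreal)" using V True by simp_all
            ultimately show ?thesis using G True by simp
          qed
          finally show ?thesis .
        qed
      qed
      finally show ?thesis .
    qed
  qed
  also have "\<dots> = (\<integral>\<^sup>+V. (\<integral>\<^sup>+p. ennreal (Gamma (lam + 1/2) / 2) * (ennreal (V powr (lam + 1/2) * exp (- (V * (t^2 + s^2)))) * heat lam V x y * indicator {0<..} V)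
      * (ennreal (p powr (- 1/2) * (1 + 1 / p) * exp (- (V * t^2 / p + V * s^2 * p))) * indicator {0<..} p) \<partial>lborel) \<partial>lborel)"
    by (rule lborel_pair.Fubini') measurable
  also have "\<dots> = (\<integral>\<^sup>+V. ennreal (Gamma (lam + 1/2) / 2 * sqrt pi * (1 / t + 1 / s)) * (\<phi> (t + s) V * heat lam V x y) \<partial>lborel)"
  proof (rule nn_integral_cong)
    fix V :: real
    let ?A = "ennreal (Gamma (lam + 1/2) / 2) * (ennreal (V powr (lam + 1/2) * exp (- (V * (t^2 + s^2)))) * heat lam V x y * indicator {0<..} V)"
    have "(\<integral>\<^sup>+p. ?A * (ennreal (p powr (- 1/2) * (1 + 1 / p) * exp (- (V * t^2 / p + V * s^2 * p))) * indicator {0<..} p) \<partial>lborel)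
      = ?A * (\<integral>\<^sup>+p. ennreal (p powr (- 1/2) * (1 + 1 / p) * exp (- (V * t^2 / p + V * s^2 * p))) * indicator {0<..} p \<partial>lborel)"
      by (rule nn_integral_cmult) measurable
    also have "\<dots> = ennreal (Gamma (lam + 1/2) / 2 * sqrt pi * (1 / t + 1 / s)) * (\<phi> (t + s) V * heat lam V x y)"
    proof (cases "V > 0")
      case True
      \<comment> \<open>The integral over \<open>p\<close> is taken with \<open>a = ?q * t\<close>
        and \<open>b = ?q * s\<close>. Its cross term \<open>2 * V * t * s\<close> completes
        \<open>t^2 + s^2\<close> to \<open>(t + s)^2\<close>, and its factor \<open>1 / ?q\<close>
        lowers the power \<open>lam + 1/2\<close> to \<open>lam\<close>.\<close>
      let ?q = "V powr (1/2)"
      have q: "?q > 0" "?q^2 = V" using True by (auto simp: powr_half_sqrt)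
      have "(\<integral>\<^sup>+p. ennreal (p powr (- 1/2) * (1 + 1 / p) * exp (- (V * t^2 / p + V * s^2 * p))) * indicator {0<..} p \<partial>lborel)
        = ennreal (sqrt pi * (1 / (?q * t) + 1 / (?q * s)) * exp (- (2 * (?q * t) * (?q * s))))"
        using nn_integral_exp_quotient[of "?q * t" "?q * s"] q t s by (simp add: power_mult_distrib)
      moreover have "V powr (lam + 1/2) * exp (- (V * (t^2 + s^2))) * (sqrt pi * (1 / (?q * t) + 1 / (?q * s)) * exp (- (2 * (?q * t) * (?q * s))))
        = sqrt pi * (1 / t + 1 / s) * (V powr lam * exp (- (V * (t + s)^2)))"
      proof -
        have "(?q * t) * (?q * s) = ?q^2 * t * s" by (simp only: power2_eq_square mult_ac)
        hence "(?q * t) * (?q * s) = V * t * s" by (simp only: q(2))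
        hence m: "2 * (?q * t) * (?q * s) = 2 * (V * t * s)" by (simp only: mult.assoc)
        have "exp (- (V * (t^2 + s^2))) * exp (- (2 * (?q * t) * (?q * s))) = exp (- (V * (t + s)^2))"
          unfolding m exp_add[symmetric] by (simp add: power2_sum algebra_simps)
        moreover have "V powr (lam + 1/2) = V powr lam * ?q" by (rule powr_add)
        moreover have "?q * (1 / (?q * t) + 1 / (?q * s)) = 1 / t + 1 / s" using q t s by (simp add: field_simps)
        moreover have "V powr lam * q * e1 * (r * d * e2) = r * (q * d) * (V powr lam * (e1 * e2))" for q d r e1 e2 :: real
          by (simp only: mult_ac)
        ultimately show ?thesis by metis
      qed
      moreover have "ennreal g * (ennreal a * h * 1) * ennreal b = ennreal (g * r * d) * (ennreal u * 1 * h)"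
        if "a * b = r * d * u" "g \<ge> 0" "a \<ge> 0" "b \<ge> 0" "r \<ge> 0" "d \<ge> 0" "u \<ge> 0" for g a h b r d u
      proof -
        have "ennreal g * (ennreal a * h * 1) * ennreal b = ennreal g * ennreal (a * b) * h"
          using that(2-) by (simp add: ennreal_mult mult_ac)
        also have "\<dots> = ennreal g * ennreal (r * d * u) * h" by (simp only: that(1))
        also have "\<dots> = ennreal (g * r * d) * (ennreal u * 1 * h)"
          using that(2-) by (simp add: ennreal_mult mult_ac)
        finally show ?thesis .
      qed
      note this[of "V powr (lam + 1/2) * exp (- (V * (t^2 + s^2)))" "sqrt pi * (1 / (?q * t) + 1 / (?q * s)) * exp (- (2 * (?q * t) * (?q * s)))"
         "sqrt pi" "1 / t + 1 / s" "V powr lam * exp (- (V * (t + s)^2))" "Gamma (lam + 1/2) / 2" "heat lam V x y"]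
      moreover have "indicator {0<..} V = (1::ennreal)" using True by simp
      ultimately show ?thesis unfolding \<phi>_def using G t s q by simp
    qed (simp add: \<phi>_def)
    finally show "(\<integral>\<^sup>+p. ?A * (ennreal (p powr (- 1/2) * (1 + 1 / p) * exp (- (V * t^2 / p + V * s^2 * p))) * indicator {0<..} p) \<partial>lborel)
      = ennreal (Gamma (lam + 1/2) / 2 * sqrt pi * (1 / t + 1 / s)) * (\<phi> (t + s) V * heat lam V x y)" .
  qed
  also have "\<dots> = ennreal (Gamma (lam + 1/2) / 2 * sqrt pi * (1 / t + 1 / s)) * (\<integral>\<^sup>+V. \<phi> (t + s) V * heat lam V x y \<partial>lborel)"
    by (rule nn_integral_cmult) measurable
  also have "ennreal (?c * t) * ennreal (?c * s) * \<dots>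
     = ennreal (?c * (Gamma (lam + 1/2) / 2) * sqrt pi) * (ennreal (?c * (t + s)) * (\<integral>\<^sup>+V. \<phi> (t + s) V * heat lam V x y \<partial>lborel))"
  proof -
    \<comment> \<open>The identity \<open>t * s * (1 / t + 1 / s) = t + s\<close> restores the
      prefactor of the kernel at time \<open>t + s\<close>.\<close>
    have eq: "(?c * t) * (?c * s) * (Gamma (lam + 1/2) / 2 * sqrt pi * (1 / t + 1 / s))
       = (?c * (Gamma (lam + 1/2) / 2) * sqrt pi) * (?c * (t + s))"
      using t s by (simp add: field_simps)
    have alg: "ennreal a * ennreal b * ennreal d = ennreal e * ennreal g"
      if "a * b * d = e * g" "a \<ge> 0" "b \<ge> 0" "d \<ge> 0" "e \<ge> 0" "g \<ge> 0" for a b d e g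
    proof -
      have "ennreal a * ennreal b * ennreal d = ennreal (a * b * d)" using that(2-) by (simp add: ennreal_mult)
      also have "\<dots> = ennreal e * ennreal g" unfolding that(1) using that(2-) by (simp add: ennreal_mult)
      finally show ?thesis .
    qed
    have "ennreal (?c * t) * ennreal (?c * s) * ennreal (Gamma (lam + 1/2) / 2 * sqrt pi * (1 / t + 1 / s))
       = ennreal (?c * (Gamma (lam + 1/2) / 2) * sqrt pi) * ennreal (?c * (t + s))"
      by (rule alg[OF eq]) (use c t s G in \<open>auto intro!: mult_nonneg_nonneg\<close>)
    thus ?thesis by (simp only: mult.assoc[symmetric])
  qed
  also have "ennreal (?c * (t + s)) * (\<integral>\<^sup>+V. \<phi> (t + s) V * heat lam V x y \<partial>lborel) = ennreal (poisson_kernel lam (t + s) x y)"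
    using kern[of "t + s" x y] t s by simp
  finally show ?thesis .
qed

end

section \<open>Poisson integrals\<close>

context
  fixes lam :: real
  assumes lam: "lam > 0"
begin

text \<open>With \<open>\<sigma> = s + \<bar>x - z\<bar>\<close> the weight is
  \<open>(s / \<sigma>) powr (1/2)\<close> divided by \<open>ball_vol lam x \<sigma>\<close>. On the
  shell where \<sigma> is about \<open>2 ^ k * s\<close> the average of \<open>g\<close> is
  controlled by \<open>M\<close>, and the remaining half order of decay makes the sum over shells
  geometric.\<close>

lemma nn_integral_dyadic_kernel_le:
  fixes g :: "real \<Rightarrow> real"
  assumes g: "g \<in> borel_measurable (bessel_measure lam)" "\<And>z. 0 \<le> g z"
    and x: "x > 0" and s: "s > 0" and M: "M \<ge> 0"
    and ball: "\<And>r. r > 0 \<Longrightarrow> (\<integral>\<^sup>+z. ennreal (g z) * indicator (ball x r) z \<partial>bessel_measure lam) \<le> ennreal (M * ball_vol lam x r)"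
  shows "(\<integral>\<^sup>+z. ennreal (s powr (1/2) * (s + \<bar>x - z\<bar>) powr (- (3/2)) * (x + (s + \<bar>x - z\<bar>)) powr (- (2 * lam)) * g z) \<partial>bessel_measure lam)
    \<le> ennreal (2 * 2 powr (2 * lam) / (1 - 2 powr (- 1/2)) * M)"
proof -
  let ?m = "bessel_measure lam"
  define c where "c = (\<lambda>k. s powr (1/2) * (2 ^ k * s) powr (- (3/2)) * (x + 2 ^ k * s) powr (- (2 * lam)))"
  have c0: "c k \<ge> 0" for k by (simp add: c_def)
  have mb: "(\<lambda>z. indicator (ball x r) z :: ennreal) \<in> borel_measurable ?m" for r :: real
    by (intro borel_measurable_bessel_of_borel borel_measurable_indicator) simp
  have mg: "(\<lambda>z. ennreal (g z) * indicator (ball x r) z) \<in> borel_measurable ?m" for r :: real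
    using g(1) mb by simp
  have "(\<integral>\<^sup>+z. ennreal (s powr (1/2) * (s + \<bar>x - z\<bar>) powr (- (3/2)) * (x + (s + \<bar>x - z\<bar>)) powr (- (2 * lam)) * g z) \<partial>?m)
    \<le> (\<integral>\<^sup>+z. (\<Sum>k. ennreal (c k) * (ennreal (g z) * indicator (ball x (2 * (2 ^ k * s))) z)) \<partial>?m)"
  proof (rule nn_integral_mono)
    fix z
    let ?\<sigma> = "s + \<bar>x - z\<bar>"
    \<comment> \<open>The index of the shell of \<open>z\<close>, with
      \<open>2 ^ k * s \<le> ?\<sigma> < 2 * (2 ^ k * s)\<close>: the lower bound controls the
      weight, the upper one puts \<open>z\<close> into the ball.\<close>
    define k where "k = (LEAST k. ?\<sigma> < 2 * (2 ^ k * s))"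
    obtain n where "?\<sigma> / s < 2 ^ n" using real_arch_pow[of 2 "?\<sigma> / s"] by auto
    hence "?\<sigma> < 2 ^ n * s" using s by (simp add: field_simps)
    also have "\<dots> \<le> 2 * (2 ^ n * s)" using s by simp
    finally have k1: "?\<sigma> < 2 * (2 ^ k * s)" unfolding k_def by (rule LeastI)
    have k2: "2 ^ k * s \<le> ?\<sigma>"
    proof (cases k)
      case (Suc j)
      hence "\<not> ?\<sigma> < 2 * (2 ^ j * s)" using not_less_Least[of j "\<lambda>k. ?\<sigma> < 2 * (2 ^ k * s)"] by (simp add: k_def)
      thus ?thesis using Suc by simp
    qed simp
    have zb: "z \<in> ball x (2 * (2 ^ k * s))" using k1 s by (simp add: dist_real_def)
    have "s powr (1/2) * ?\<sigma> powr (- (3/2)) * (x + ?\<sigma>) powr (- (2 * lam)) \<le> c k"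
    proof -
      have "?\<sigma> powr (- (3/2)) \<le> (2 ^ k * s) powr (- (3/2))"
        using k2 s by (intro powr_mono2') auto
      moreover have "(x + ?\<sigma>) powr (- (2 * lam)) \<le> (x + 2 ^ k * s) powr (- (2 * lam))"
        using k2 s x lam by (intro powr_mono2') (auto intro: add_pos_pos)
      ultimately show ?thesis unfolding c_def by (intro mult_mono) auto
    qed
    hence "s powr (1/2) * ?\<sigma> powr (- (3/2)) * (x + ?\<sigma>) powr (- (2 * lam)) * g z \<le> c k * g z"
      by (intro mult_right_mono g)
    hence "ennreal (s powr (1/2) * ?\<sigma> powr (- (3/2)) * (x + ?\<sigma>) powr (- (2 * lam)) * g z)
      \<le> ennreal (c k) * (ennreal (g z) * indicator (ball x (2 * (2 ^ k * s))) z)"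
      using zb c0 g(2) by (simp add: ennreal_mult[symmetric] ennreal_leI)
    \<comment> \<open>The single term belonging to the shell of \<open>z\<close> already dominates;
      the other terms are nonnegative.\<close>
    also have "\<dots> \<le> (\<Sum>k. ennreal (c k) * (ennreal (g z) * indicator (ball x (2 * (2 ^ k * s))) z))"
      using sum_le_suminf[of "\<lambda>k. ennreal (c k) * (ennreal (g z) * indicator (ball x (2 * (2 ^ k * s))) z)" "{k}"] by simp
    finally show "ennreal (s powr (1/2) * ?\<sigma> powr (- (3/2)) * (x + ?\<sigma>) powr (- (2 * lam)) * g z) \<le> \<dots>" .
  qed
  also have "\<dots> = (\<Sum>k. ennreal (c k) * (\<integral>\<^sup>+z. ennreal (g z) * indicator (ball x (2 * (2 ^ k * s))) z \<partial>?m))"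
    using mg by (subst nn_integral_suminf) (auto simp: nn_integral_cmult)
  also have "\<dots> \<le> (\<Sum>k. ennreal (2 * 2 powr (2 * lam) * M * (2 powr (- 1/2)) ^ k))"
  proof (rule suminf_le)
    fix k
    let ?R = "2 ^ k * s"
    have R: "?R > 0" using s by simp
    have "ennreal (c k) * (\<integral>\<^sup>+z. ennreal (g z) * indicator (ball x (2 * ?R)) z \<partial>?m)
        \<le> ennreal (c k) * ennreal (M * ball_vol lam x (2 * ?R))"
      using R by (intro mult_left_mono ball) auto
    also have "\<dots> = ennreal (c k * (M * ball_vol lam x (2 * ?R)))"
      using c0 by (simp add: ennreal_mult')
    also have "c k * (M * ball_vol lam x (2 * ?R)) \<le> c k * (M * (2 * 2 powr (2 * lam) * ball_vol lam x ?R))"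
      using x R by (intro mult_left_mono c0 M ball_vol_mult_le[OF lam]) auto
    also have "\<dots> = 2 * 2 powr (2 * lam) * M * (c k * ball_vol lam x ?R)" by (simp only: mult_ac)
    also have "c k * ball_vol lam x ?R = (2 powr (- 1/2)) ^ k"
    proof -
      have 1: "(x + ?R) powr (- (2 * lam)) * (x + ?R) powr (2 * lam) = 1"
        using x R by (simp add: powr_add[symmetric])
      have 2: "?R powr (- (3/2)) * ?R = ?R powr (- (1/2))"
        using R powr_add[of ?R "- (3/2)" 1] by simp
      have 3: "s powr (1/2) * ?R powr (- (1/2)) = (2 ^ k) powr (- (1/2))"
        using s by (simp add: powr_mult powr_add[symmetric] mult.left_commute)
      have "c k * ball_vol lam x ?R = (s powr (1/2) * (?R powr (- (3/2)) * ?R)) * ((x + ?R) powr (- (2 * lam)) * (x + ?R) powr (2 * lam))"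
        by (simp only: c_def ball_vol_def[OF lam] mult_ac)
      also have "\<dots> = (2 ^ k) powr (- (1/2))" unfolding 1 2 3 by simp
      also have "\<dots> = (2 powr (- 1/2)) ^ k"
        by (simp add: powr_realpow[symmetric] powr_powr powr_power mult.commute)
      finally show ?thesis .
    qed
    finally show "ennreal (c k) * (\<integral>\<^sup>+z. ennreal (g z) * indicator (ball x (2 * ?R)) z \<partial>?m)
      \<le> ennreal (2 * 2 powr (2 * lam) * M * (2 powr (- 1/2)) ^ k)" by (simp add: ennreal_leI)
  qed auto
  also have "\<dots> = ennreal (2 * 2 powr (2 * lam) * M * (1 / (1 - 2 powr (- 1/2))))"
  proof (rule suminf_ennreal_eq)
    have "(2::real) powr (- 1/2) < 2 powr 0" by (rule powr_less_mono) auto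
    hence "(2::real) powr (- 1/2) < 1" by simp
    thus "(\<lambda>k. 2 * 2 powr (2 * lam) * M * (2 powr (- 1/2)) ^ k) sums (2 * 2 powr (2 * lam) * M * (1 / (1 - 2 powr (- 1/2))))"
      by (intro sums_mult geometric_sums) auto
  qed (use M in auto)
  finally show ?thesis by (simp add: mult_ac)
qed

text \<open>This makes the constant in the semigroup law positive, so that the law can be solved for
  the Poisson integral.\<close>

lemma sin_cos_moment_0_pos: "sin_cos_moment lam 0 > 0"
proof (rule ccontr)
  assume "\<not> ?thesis"
  hence 0: "sin_cos_moment lam 0 = 0" using sin_cos_moment_nonneg[OF lam, of 0] by simp
  have "(\<integral>\<^sup>+\<theta>. ennreal (sin \<theta> powr (2 * lam - 1) * cos \<theta> ^ 0) * indicator {0<..<pi} \<theta> \<partial>lborel) = ennreal (sin_cos_moment lam 0)"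
    by (rule nn_integral_has_integral_lebesgue'[OF _ has_integral_sin_cos[OF lam]]) auto
  hence "(\<integral>\<^sup>+\<theta>. ennreal (sin \<theta> powr (2 * lam - 1) * cos \<theta> ^ 0) * indicator {0<..<pi} \<theta> \<partial>lborel) = 0"
    by (simp only: 0 ennreal_0)
  hence "AE \<theta> in lborel. ennreal (sin \<theta> powr (2 * lam - 1) * cos \<theta> ^ 0) * indicator {0<..<pi} \<theta> = 0"
    by (subst (asm) nn_integral_0_iff_AE) auto
  hence "AE \<theta> in lborel. \<theta> \<notin> {0<..<pi}"
    by eventually_elim (auto simp: indicator_def split: if_splits dest: sin_gt_zero)
  hence "emeasure lborel {0<..<pi} = 0" by (subst (asm) AE_iff_measurable[of "{0<..<pi}"]) auto
  thus False by simp
qed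

text \<open>The denominator is at least \<open>t^2\<close>, which leaves
  \<open>t powr (- (2 * lam + 1))\<close>, a decreasing function of \<open>t\<close>. Uniformity in
  \<open>x\<close> and \<open>y\<close> makes Poisson integrals of integrable functions converge and
  stay bounded away from the boundary.\<close>

lemma poisson_kernel_bounded:
  assumes \<delta>: "\<delta> > 0"
  obtains B where "B \<ge> 0" "\<And>t x y. \<delta> \<le> t \<Longrightarrow> poisson_kernel lam t x y \<le> B"
proof
  let ?S = "LBINT \<theta>:{0<..<pi}. sin \<theta> powr (2 * lam - 1)"
  have S: "?S \<ge> 0" using sin_cos_moment_nonneg[OF lam, of 0] by (simp add: sin_cos_moment_def[OF lam])
  show "2 * lam / pi * ?S * \<delta> powr (- (2 * lam + 1)) \<ge> 0" using S lam by simp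
  fix t x y :: real assume t: "\<delta> \<le> t"
  hence t0: "t > 0" using \<delta> by simp
  have "(LBINT \<theta>:{0<..<pi}. sin \<theta> powr (2 * lam - 1) / poisson_denom t x y \<theta> powr (lam + 1))
     \<le> (LBINT \<theta>:{0<..<pi}. sin \<theta> powr (2 * lam - 1) / (t^2) powr (lam + 1))"
  proof (rule set_integral_mono)
    show "set_integrable lborel {0<..<pi} (\<lambda>\<theta>. sin \<theta> powr (2 * lam - 1) / (t^2) powr (lam + 1))"
      using set_integrable_sin_powr[OF lam] by (simp add: set_integrable_def)
  qed (use set_integrable_poisson_integrand[OF lam t0] poisson_integrand_le[OF lam t0] in auto)
  also have "\<dots> = ?S / (t^2) powr (lam + 1)" by (simp add: set_lebesgue_integral_def)
  finally have "poisson_kernel lam t x y \<le> 2 * lam * t / pi * (?S / (t^2) powr (lam + 1))"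
    unfolding poisson_kernel_eq[OF lam] using lam t0 by (intro mult_left_mono) auto
  also have "\<dots> = 2 * lam / pi * ?S * (t / (t^2) powr (lam + 1))" by simp
  also have "t / (t^2) powr (lam + 1) = t powr (- (2 * lam + 1))"
  proof -
    have "(t^2) powr (lam + 1) = t powr (2 * lam + 2)"
      using t0 by (simp add: powr_powr algebra_simps flip: powr_numeral)
    thus ?thesis using t0 powr_diff[of t 1 "2 * lam + 2"] by (simp add: algebra_simps)
  qed
  also have "2 * lam / pi * ?S * t powr (- (2 * lam + 1)) \<le> 2 * lam / pi * ?S * \<delta> powr (- (2 * lam + 1))"
    using S lam t \<delta> by (intro mult_left_mono powr_mono2') auto
  finally show "poisson_kernel lam t x y \<le> 2 * lam / pi * ?S * \<delta> powr (- (2 * lam + 1))" .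
qed

section \<open>Boundedness and continuity of Poisson integrals\<close>

lemma integrable_poisson_integrand:
  assumes t: "t > 0" and f: "integrable (bessel_measure lam) f"
  shows "integrable (bessel_measure lam) (\<lambda>y. poisson_kernel lam t x y *\<^sub>R (f y :: complex))"
proof -
  obtain B where B: "B \<ge> 0" "\<And>s x y. t \<le> s \<Longrightarrow> poisson_kernel lam s x y \<le> B"
    using poisson_kernel_bounded[OF t] by blast
  have [measurable]: "f \<in> borel_measurable (bessel_measure lam)" using f by simp
  have [measurable]: "(\<lambda>y. poisson_kernel lam t x y) \<in> borel_measurable (bessel_measure lam)"
    by (intro measurable_poisson_kernel[OF lam t] borel_measurable_bessel_id) simp
  show ?thesis
  proof (rule Bochner_Integration.integrable_bound)
    show "integrable (bessel_measure lam) (\<lambda>y. B * norm (f y))" using f by simp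
    show "AE y in bessel_measure lam. norm (poisson_kernel lam t x y *\<^sub>R f y) \<le> norm (B * norm (f y))"
      using B poisson_kernel_nonneg[OF lam t] by (intro AE_I2) (auto intro!: mult_right_mono)
  qed measurable
qed

lemma poisson_bounded:
  assumes \<delta>: "\<delta> > 0" and f: "integrable (bessel_measure lam) f"
  obtains B where "B \<ge> 0" "\<And>t x. \<delta> \<le> t \<Longrightarrow> norm (poisson lam t f x) \<le> B"
proof -
  obtain B where B: "B \<ge> 0" "\<And>s x y. \<delta> \<le> s \<Longrightarrow> poisson_kernel lam s x y \<le> B"
    using poisson_kernel_bounded[OF \<delta>] by blast
  show ?thesis
  proof
    show "0 \<le> (\<integral>y. B * norm (f y) \<partial>bessel_measure lam)" using B by (intro integral_nonneg_AE AE_I2) auto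
    fix t x assume t: "\<delta> \<le> t"
    hence t0: "t > 0" using \<delta> by simp
    show "norm (poisson lam t f x) \<le> (\<integral>y. B * norm (f y) \<partial>bessel_measure lam)"
      unfolding poisson_def
    proof (rule order.trans[OF integral_norm_bound], rule integral_mono_AE)
      show "AE y in bessel_measure lam. norm (poisson_kernel lam t x y *\<^sub>R f y) \<le> B * norm (f y)"
        using B(2)[OF t] poisson_kernel_nonneg[OF lam t0] by (intro AE_I2) (auto intro!: mult_right_mono)
    qed (use f integrable_norm[OF integrable_poisson_integrand[OF t0 f]] in auto)
  qed
qed

lemma continuous_poisson:
  assumes t: "t > 0" and f: "integrable (bessel_measure lam) f"
  shows "continuous_on UNIV (poisson lam t f)"
proof -
  obtain B where B: "B \<ge> 0" "\<And>s x y. t \<le> s \<Longrightarrow> poisson_kernel lam s x y \<le> B"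
    using poisson_kernel_bounded[OF t] by blast
  have [measurable]: "f \<in> borel_measurable (bessel_measure lam)" using f by simp
  have [measurable]: "(\<lambda>y. poisson_kernel lam t x y) \<in> borel_measurable (bessel_measure lam)" for x
    by (intro measurable_poisson_kernel[OF lam t] borel_measurable_bessel_id) simp
  have "(\<lambda>n. poisson lam t f (s n)) \<longlonglongrightarrow> poisson lam t f x" if s: "s \<longlonglongrightarrow> x" for s x
    unfolding poisson_def
  proof (rule integral_dominated_convergence)
    show "integrable (bessel_measure lam) (\<lambda>y. B * norm (f y))" using f by simp
    show "AE y in bessel_measure lam. (\<lambda>n. poisson_kernel lam t (s n) y *\<^sub>R f y) \<longlonglongrightarrow> poisson_kernel lam t x y *\<^sub>R f y"
    proof (rule AE_I2)
      fix y :: real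
      have "(\<lambda>n. (s n, y)) \<longlonglongrightarrow> (x, y)" using s by (intro tendsto_intros)
      from continuous_on_tendsto_compose[OF continuous_poisson_kernel[OF lam t] this]
      have "(\<lambda>n. poisson_kernel lam t (s n) y) \<longlonglongrightarrow> poisson_kernel lam t x y" by simp
      thus "(\<lambda>n. poisson_kernel lam t (s n) y *\<^sub>R f y) \<longlonglongrightarrow> poisson_kernel lam t x y *\<^sub>R f y"
        by (intro tendsto_intros)
    qed
    show "AE y in bessel_measure lam. norm (poisson_kernel lam t (s n) y *\<^sub>R f y) \<le> B * norm (f y)" for n
      using B poisson_kernel_nonneg[OF lam t] by (intro AE_I2) (auto intro!: mult_right_mono)
  qed measurable
  thus ?thesis by (auto simp: continuous_on_sequentially comp_def)
qed

section \<open>Measurability and comparison of the maximal functions\<close>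

lemma open_norm_poisson_gt:
  assumes "t > 0" "integrable (bessel_measure lam) f"
  shows "open {x. a < norm (poisson lam t f x)}"
  using continuous_poisson[OF assms]
  by (intro open_Collect_less continuous_intros)

text \<open>The supremum is uncountable, but it is lower semicontinuous: continuity in
  \<open>x\<close> at each fixed \<open>t\<close> makes every superlevel set a union of open
  sets.\<close>

lemma measurable_radial_max:
  assumes f: "integrable (bessel_measure lam) f"
  shows "radial_max lam f \<in> borel_measurable borel"
proof (rule borel_measurableI_greater)
  fix a :: ennreal
  have "open {x. a < radial_max lam f x}"
  proof -
    have "{x. a < radial_max lam f x} = (\<Union>t\<in>{0<..}. {x. a < ennreal (norm (poisson lam t f x))})"
      by (auto simp: radial_max_def less_SUP_iff)
    moreover have "open {x. a < ennreal (norm (poisson lam t f x))}" if "t > 0" for t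
      using continuous_poisson[OF that f]
      by (intro open_Collect_less continuous_on_ennreal continuous_intros)
    ultimately show ?thesis by auto
  qed
  thus "{x \<in> space borel. a < radial_max lam f x} \<in> sets borel" by simp
qed

text \<open>A value attained at \<open>(y, t)\<close> counts for all \<open>x\<close> in the
  interval of radius \<open>t\<close> about \<open>y\<close>, so superlevel sets are unions of open
  intervals.\<close>

lemma measurable_nontangential_max: "nontangential_max lam f \<in> borel_measurable borel"
proof (rule borel_measurableI_greater)
  fix a :: ennreal
  have "open {x. a < nontangential_max lam f x}"
  proof -
    have "{x. a < nontangential_max lam f x}
      = (\<Union>(y, t)\<in>{(y, t). 0 < y \<and> 0 < t \<and> a < ennreal (norm (poisson lam t f y))}. {x. \<bar>x - y\<bar> < t})"
      by (auto simp: nontangential_max_def less_SUP_iff)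
    moreover have "open {x. \<bar>x - y\<bar> < t}" for y t :: real
      by (intro open_Collect_less continuous_intros)
    ultimately show ?thesis by auto
  qed
  thus "{x \<in> space borel. a < nontangential_max lam f x} \<in> sets borel" by simp
qed

text \<open>The point \<open>(x, t)\<close> belongs to the cone at \<open>x\<close>.\<close>

lemma radial_max_le_nontangential_max:
  "x > 0 \<Longrightarrow> radial_max lam f x \<le> nontangential_max lam f x"
  unfolding radial_max_def nontangential_max_def
  by (rule SUP_mono) force

end

section \<open>The reproducing formula\<close>

context
  fixes lam :: real
  assumes lam: "lam > 0"
begin

definition semigroup_const :: real where
  "semigroup_const = subordination_const lam * (Gamma (lam + 1/2) / 2) * sqrt pi"

lemma semigroup_const_pos: "semigroup_const > 0"
  unfolding semigroup_const_def subordination_const_def[OF lam]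
  using lam sin_cos_moment_0_pos[OF lam] by (auto intro!: mult_pos_pos divide_pos_pos Gamma_real_pos)

lemma has_bochner_integral_poisson_kernel:
  assumes t: "t > 0" and s: "s > 0"
  shows "has_bochner_integral (bessel_measure lam) (\<lambda>z. poisson_kernel lam t x z * poisson_kernel lam s z y)
    (semigroup_const * poisson_kernel lam (t + s) x y)"
proof (rule has_bochner_integral_nn_integral)
  note mk = measurable_poisson_kernel[OF lam t] measurable_poisson_kernel[OF lam s]
  show "(\<lambda>z. poisson_kernel lam t x z * poisson_kernel lam s z y) \<in> borel_measurable (bessel_measure lam)"
    by (intro borel_measurable_times mk borel_measurable_bessel_id) auto
  have p: "poisson_kernel lam (t + s) x y \<ge> 0" using t s by (intro poisson_kernel_nonneg[OF lam]) simp
  show "0 \<le> semigroup_const * poisson_kernel lam (t + s) x y"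
    using semigroup_const_pos p by simp
  show "AE z in bessel_measure lam. 0 \<le> poisson_kernel lam t x z * poisson_kernel lam s z y"
    using poisson_kernel_nonneg[OF lam] t s by (intro AE_I2) simp
  show "(\<integral>\<^sup>+z. ennreal (poisson_kernel lam t x z * poisson_kernel lam s z y) \<partial>bessel_measure lam)
    = ennreal (semigroup_const * poisson_kernel lam (t + s) x y)"
    using poisson_kernel_semigroup[OF lam t s, of x y] semigroup_const_pos p poisson_kernel_nonneg[OF lam t]
    by (simp add: ennreal_mult'[symmetric] semigroup_const_def)
qed

text \<open>Fubini's theorem. Its integrability condition follows from the semigroup law of the
  nonnegative kernels, which evaluates the inner integral of norms as a multiple of the kernel at
  time \<open>t + s\<close> times \<open>norm (f y)\<close>.\<close>

lemma poisson_semigroup: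
  assumes t: "t > 0" and s: "s > 0" and f: "integrable (bessel_measure lam) f"
  shows "(LINT z|bessel_measure lam. poisson_kernel lam t x z *\<^sub>R poisson lam s f z)
    = semigroup_const *\<^sub>R poisson lam (t + s) f x"
proof -
  let ?m = "bessel_measure lam"
  interpret m: sigma_finite_measure ?m by (rule sigma_finite_bessel)
  interpret P: pair_sigma_finite ?m ?m ..
  note mk = measurable_poisson_kernel[OF lam t] measurable_poisson_kernel[OF lam s]
  have [measurable]: "f \<in> borel_measurable ?m" using f by simp
  note hb = has_bochner_integral_poisson_kernel[OF t s]
  have ts: "t + s > 0" using t s by simp
  let ?F = "\<lambda>y z. (poisson_kernel lam t x z * poisson_kernel lam s z y) *\<^sub>R f y"
  have id1: "(\<lambda>p. fst p) \<in> borel_measurable (?m \<Otimes>\<^sub>M ?m)" "(\<lambda>p. snd p) \<in> borel_measurable (?m \<Otimes>\<^sub>M ?m)"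
    using measurable_compose[OF measurable_fst borel_measurable_bessel_id]
      measurable_compose[OF measurable_snd borel_measurable_bessel_id] by auto
  have k1: "(\<lambda>p. poisson_kernel lam t x (snd p) * poisson_kernel lam s (snd p) (fst p)) \<in> borel_measurable (?m \<Otimes>\<^sub>M ?m)"
    by (intro borel_measurable_times mk id1) auto
  have Fm: "case_prod ?F \<in> borel_measurable (?m \<Otimes>\<^sub>M ?m)"
    unfolding case_prod_beta by (intro borel_measurable_scaleR k1) measurable
  have int: "integrable (?m \<Otimes>\<^sub>M ?m) (case_prod ?F)"
  proof (rule P.Fubini_integrable[OF Fm])
    have eq: "(\<integral>z. norm (?F y z) \<partial>?m) = semigroup_const * norm (poisson_kernel lam (t + s) x y *\<^sub>R f y)" for y
    proof -
      have "(\<integral>z. norm (?F y z) \<partial>?m) = (\<integral>z. (poisson_kernel lam t x z * poisson_kernel lam s z y) * norm (f y) \<partial>?m)"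
        using poisson_kernel_nonneg[OF lam t] poisson_kernel_nonneg[OF lam s] by (simp add: abs_mult)
      also have "\<dots> = semigroup_const * poisson_kernel lam (t + s) x y * norm (f y)"
        using has_bochner_integral_integral_eq[OF hb] by simp
      finally show ?thesis using poisson_kernel_nonneg[OF lam ts] by simp
    qed
    have "integrable ?m (\<lambda>y. semigroup_const * norm (poisson_kernel lam (t + s) x y *\<^sub>R f y))"
      by (intro integrable_mult_right integrable_norm integrable_poisson_integrand[OF lam ts f])
    thus "integrable ?m (\<lambda>y. \<integral>z. norm (case (y, z) of (y, z) \<Rightarrow> ?F y z) \<partial>?m)"
      by (simp only: prod.case eq)
    show "AE y in ?m. integrable ?m (\<lambda>z. case (y, z) of (y, z) \<Rightarrow> ?F y z)"
      using hb by (intro AE_I2) (auto simp: has_bochner_integral_iff)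
  qed
  have "(LINT z|?m. poisson_kernel lam t x z *\<^sub>R poisson lam s f z) = (LINT z|?m. (LINT y|?m. ?F y z))"
  proof (rule Bochner_Integration.integral_cong[OF refl])
    fix z
    have "(LINT y|?m. ?F y z) = (LINT y|?m. poisson_kernel lam t x z *\<^sub>R (poisson_kernel lam s z y *\<^sub>R f y))"
      by simp
    also have "\<dots> = poisson_kernel lam t x z *\<^sub>R poisson lam s f z"
      unfolding poisson_def by (rule integral_scaleR_right)
    finally show "poisson_kernel lam t x z *\<^sub>R poisson lam s f z = (LINT y|?m. ?F y z)" by (rule sym)
  qed
  also have "\<dots> = (LINT y|?m. (LINT z|?m. ?F y z))"
    by (rule P.Fubini_integral[OF int])
  also have "\<dots> = (LINT y|?m. semigroup_const *\<^sub>R (poisson_kernel lam (t + s) x y *\<^sub>R f y))"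
  proof (rule Bochner_Integration.integral_cong[OF refl])
    fix y
    have "(LINT z|?m. ?F y z) = (LINT z|?m. poisson_kernel lam t x z * poisson_kernel lam s z y) *\<^sub>R f y"
      by (rule integral_scaleR_left) (use hb in \<open>auto simp: has_bochner_integral_iff\<close>)
    thus "(LINT z|?m. ?F y z) = semigroup_const *\<^sub>R (poisson_kernel lam (t + s) x y *\<^sub>R f y)"
      using has_bochner_integral_integral_eq[OF hb] by simp
  qed
  also have "\<dots> = semigroup_const *\<^sub>R poisson lam (t + s) f x"
    unfolding poisson_def by (rule integral_scaleR_right)
  finally show ?thesis .
qed

lemma poisson_reproducing_le:
  assumes t: "t > 0" and s: "s > 0" and f: "integrable (bessel_measure lam) f"
  shows "ennreal (semigroup_const * norm (poisson lam (t + s) f x))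
    \<le> (\<integral>\<^sup>+z. ennreal (poisson_kernel lam t x z * norm (poisson lam s f z)) \<partial>bessel_measure lam)"
proof (cases "integrable (bessel_measure lam) (\<lambda>z. poisson_kernel lam t x z *\<^sub>R poisson lam s f z)")
  case True
  have "semigroup_const * norm (poisson lam (t + s) f x)
    = norm (LINT z|bessel_measure lam. poisson_kernel lam t x z *\<^sub>R poisson lam s f z)"
    unfolding poisson_semigroup[OF assms] using semigroup_const_pos by simp
  also have "ennreal \<dots> \<le> (\<integral>\<^sup>+z. norm (poisson_kernel lam t x z *\<^sub>R poisson lam s f z) \<partial>bessel_measure lam)"
    by (rule integral_norm_bound_ennreal[OF True])
  finally show ?thesis using poisson_kernel_nonneg[OF lam t] by simp
next
  case False
  \<comment> \<open>The Bochner integral of a non-integrable function is 0 by convention, and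
    \<open>poisson_semigroup\<close> carries this value over to the left side.\<close>
  hence "semigroup_const *\<^sub>R poisson lam (t + s) f x = 0"
    unfolding poisson_semigroup[OF assms, symmetric] by (rule not_integrable_integral_eq)
  thus ?thesis using semigroup_const_pos by simp
qed

text \<open>Changing the centre of the kernel estimate from \<open>y\<close> to \<open>x\<close> costs a power of
  \<open>\<beta> = 1 + \<bar>x - y\<bar> / s\<close>; this fixes the exponent \<open>2 lam + 2\<close> used below.\<close>

lemma kernel_recentre:
  assumes x: "x > 0" and y: "y > 0" and s: "s > 0"
  shows "s / ((s + \<bar>y - z\<bar>)^2 * (y + (s + \<bar>y - z\<bar>)) powr (2 * lam))
    \<le> 2 powr (2 * lam) * (1 + \<bar>x - y\<bar> / s) powr (2 * lam + 2)
       * (s / ((s + \<bar>x - z\<bar>)^2 * (x + (s + \<bar>x - z\<bar>)) powr (2 * lam)))"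
proof -
  define \<rho> \<sigma> \<beta> where "\<rho> = s + \<bar>y - z\<bar>" and "\<sigma> = s + \<bar>x - z\<bar>" and "\<beta> = 1 + \<bar>x - y\<bar> / s"
  have \<rho>: "\<rho> \<ge> s" "\<rho> > 0" and \<sigma>: "\<sigma> > 0" using s by (auto simp: \<rho>_def \<sigma>_def)
  have \<beta>: "\<beta> \<ge> 1" using s by (simp add: \<beta>_def)
  have d: "\<bar>x - y\<bar> = (\<beta> - 1) * s" using s by (simp add: \<beta>_def)
  have d2: "(\<beta> - 1) * s \<le> (\<beta> - 1) * \<rho>" using \<rho> \<beta> by (intro mult_left_mono) auto
  \<comment> \<open>Moving the centre changes the radius by \<open>(\<beta> - 1) * s\<close>, and
    \<open>s \<le> \<rho>\<close>.\<close>
  have e1: "\<sigma> \<le> \<beta> * \<rho>"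
  proof -
    have "\<sigma> \<le> \<rho> + \<bar>x - y\<bar>" by (simp add: \<rho>_def \<sigma>_def)
    also have "\<dots> \<le> \<rho> + (\<beta> - 1) * \<rho>" using d d2 by simp
    finally show ?thesis by (simp add: algebra_simps)
  qed
  have e2: "x + \<sigma> \<le> 2 * \<beta> * (y + \<rho>)"
  proof -
    have "x + \<sigma> \<le> y + (\<beta> - 1) * \<rho> + \<beta> * \<rho>" using e1 d d2 by linarith
    also have "\<dots> \<le> 2 * \<beta> * \<rho> + y" using \<rho> by (simp add: algebra_simps)
    also have "y \<le> 2 * \<beta> * y" using \<beta> y by simp
    finally show ?thesis by (simp add: algebra_simps)
  qed
  have "\<sigma>^2 \<le> (\<beta> * \<rho>)^2" using e1 \<sigma> by (intro power_mono) auto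
  moreover have "(x + \<sigma>) powr (2 * lam) \<le> (2 * \<beta> * (y + \<rho>)) powr (2 * lam)"
    using e2 x \<sigma> lam by (intro powr_mono2) auto
  ultimately have "\<sigma>^2 * (x + \<sigma>) powr (2 * lam) \<le> (\<beta> * \<rho>)^2 * (2 * \<beta> * (y + \<rho>)) powr (2 * lam)"
    by (intro mult_mono) auto
  also have "\<dots> = 2 powr (2 * lam) * \<beta> powr (2 * lam + 2) * (\<rho>^2 * (y + \<rho>) powr (2 * lam))"
    using \<beta> y \<rho> by (simp add: powr_mult powr_add power_mult_distrib powr_numeral)
  finally have m: "\<sigma>^2 * (x + \<sigma>) powr (2 * lam) \<le> 2 powr (2 * lam) * \<beta> powr (2 * lam + 2) * (\<rho>^2 * (y + \<rho>) powr (2 * lam))" .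
  have p1: "\<rho>^2 * (y + \<rho>) powr (2 * lam) > 0" "\<sigma>^2 * (x + \<sigma>) powr (2 * lam) > 0"
    using \<rho> \<sigma> x y by simp_all
  have "1 / (\<rho>^2 * (y + \<rho>) powr (2 * lam)) \<le> 2 powr (2 * lam) * \<beta> powr (2 * lam + 2) / (\<sigma>^2 * (x + \<sigma>) powr (2 * lam))"
    using m p1 by (simp add: divide_le_eq le_divide_eq mult_ac)
  hence "s * (1 / (\<rho>^2 * (y + \<rho>) powr (2 * lam))) \<le> s * (2 powr (2 * lam) * \<beta> powr (2 * lam + 2) / (\<sigma>^2 * (x + \<sigma>) powr (2 * lam)))"
    using s by (intro mult_left_mono) auto
  thus ?thesis by (simp add: \<rho>_def \<sigma>_def \<beta>_def mult_ac)
qed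

end

section \<open>Radial control of the nontangential maximal function\<close>

context
  fixes lam :: real
  assumes lam: "lam > 0"
begin

text \<open>The shift by \<open>\<delta>\<close> makes the extension bounded, so that the suprema are real numbers.\<close>

definition shifted_radial :: "real \<Rightarrow> (real \<Rightarrow> complex) \<Rightarrow> real \<Rightarrow> real" where
  "shifted_radial \<delta> f x = (SUP s\<in>{0<..}. norm (poisson lam (s + \<delta>) f x))"

definition shifted_nontangential :: "real \<Rightarrow> (real \<Rightarrow> complex) \<Rightarrow> real \<Rightarrow> real" where
  "shifted_nontangential \<delta> f x =
     (SUP (y, s)\<in>{(y, s). 0 < y \<and> 0 < s \<and> \<bar>x - y\<bar> < s}. norm (poisson lam (s + \<delta>) f y))"

lemma cone_nonempty: "{(y, s). 0 < y \<and> 0 < s \<and> \<bar>x - y\<bar> < s} \<noteq> {}" for x :: real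
proof -
  have "(1, \<bar>x - 1\<bar> + 1) \<in> {(y, s). 0 < y \<and> 0 < s \<and> \<bar>x - y\<bar> < s}" by simp
  thus ?thesis by blast
qed

context
  fixes f :: "real \<Rightarrow> complex" and \<delta> :: real
  assumes f: "integrable (bessel_measure lam) f" and \<delta>: "\<delta> > 0"
begin

lemma bdd_above_shifted_radial: "bdd_above ((\<lambda>s. norm (poisson lam (s + \<delta>) f x)) ` {0<..})"
proof -
  obtain B where "\<And>t x. \<delta> \<le> t \<Longrightarrow> norm (poisson lam t f x) \<le> B" using poisson_bounded[OF lam \<delta> f] by blast
  thus ?thesis by (intro bdd_aboveI2[of _ _ B]) auto
qed

lemma bdd_above_shifted_nontangential:
  "bdd_above ((\<lambda>(y, s). norm (poisson lam (s + \<delta>) f y)) ` {(y, s). 0 < y \<and> 0 < s \<and> \<bar>x - y\<bar> < s})"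
proof -
  obtain B where "\<And>t x. \<delta> \<le> t \<Longrightarrow> norm (poisson lam t f x) \<le> B" using poisson_bounded[OF lam \<delta> f] by blast
  thus ?thesis by (intro bdd_aboveI2[of _ _ B]) auto
qed

lemma norm_le_shifted_radial: "s > 0 \<Longrightarrow> norm (poisson lam (s + \<delta>) f x) \<le> shifted_radial \<delta> f x"
  unfolding shifted_radial_def by (rule cSUP_upper[OF _ bdd_above_shifted_radial]) simp

lemma norm_le_shifted_nontangential:
  "y > 0 \<Longrightarrow> s > 0 \<Longrightarrow> \<bar>x - y\<bar> < s \<Longrightarrow> norm (poisson lam (s + \<delta>) f y) \<le> shifted_nontangential \<delta> f x"
  unfolding shifted_nontangential_def
  using cSUP_upper[OF _ bdd_above_shifted_nontangential, of "(y, s)" x] by simp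

lemma shifted_radial_nonneg: "0 \<le> shifted_radial \<delta> f x"
  using norm_le_shifted_radial[of 1 x] norm_ge_zero order.trans zero_less_one by blast

lemma shifted_nontangential_nonneg: "0 \<le> shifted_nontangential \<delta> f x"
proof -
  obtain y s where "(y, s) \<in> {(y, s). 0 < y \<and> 0 < s \<and> \<bar>x - y\<bar> < s}" using cone_nonempty[of x] by auto
  hence "norm (poisson lam (s + \<delta>) f y) \<le> shifted_nontangential \<delta> f x"
    by (intro norm_le_shifted_nontangential) auto
  thus ?thesis using norm_ge_zero order.trans by blast
qed

lemma measurable_shifted_radial: "shifted_radial \<delta> f \<in> borel_measurable borel"
proof (rule borel_measurableI_greater)
  fix a
  have "{x. a < shifted_radial \<delta> f x} = (\<Union>s\<in>{0<..}. {x. a < norm (poisson lam (s + \<delta>) f x)})"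
    using less_cSUP_iff[OF _ bdd_above_shifted_radial] by (auto simp: shifted_radial_def)
  moreover have "open {x. a < norm (poisson lam (s + \<delta>) f x)}" if "s > 0" for s
    using open_norm_poisson_gt[OF lam _ f] that \<delta> by simp
  ultimately have "open {x. a < shifted_radial \<delta> f x}" by auto
  thus "{x \<in> space borel. a < shifted_radial \<delta> f x} \<in> sets borel" by simp
qed

lemma measurable_shifted_nontangential: "shifted_nontangential \<delta> f \<in> borel_measurable borel"
proof (rule borel_measurableI_greater)
  fix a
  have "{x. a < shifted_nontangential \<delta> f x}
    = (\<Union>(y, s)\<in>{(y, s). 0 < y \<and> 0 < s \<and> a < norm (poisson lam (s + \<delta>) f y)}. {x. \<bar>x - y\<bar> < s})"
    using less_cSUP_iff[OF cone_nonempty bdd_above_shifted_nontangential]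
    by (auto simp: shifted_nontangential_def)
  moreover have "open {x. \<bar>x - y\<bar> < s}" for y s :: real
    by (intro open_Collect_less continuous_intros)
  ultimately have "open {x. a < shifted_nontangential \<delta> f x}" by auto
  thus "{x \<in> space borel. a < shifted_nontangential \<delta> f x} \<in> sets borel" by simp
qed

lemma shifted_radial_le_radial_max: "ennreal (shifted_radial \<delta> f x) \<le> radial_max lam f x"
proof (cases "radial_max lam f x")
  case (real R)
  have "shifted_radial \<delta> f x \<le> R"
    unfolding shifted_radial_def
  proof (rule cSUP_least)
    fix s :: real assume "s \<in> {0<..}"
    hence "ennreal (norm (poisson lam (s + \<delta>) f x)) \<le> radial_max lam f x"
      unfolding radial_max_def using \<delta> by (intro SUP_upper) simp
    thus "norm (poisson lam (s + \<delta>) f x) \<le> R" using real by simp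
  qed simp
  thus ?thesis using real by (simp add: ennreal_leI)
qed simp

end

text \<open>The cone is open: a point \<open>(y, t)\<close> with
  \<open>\<bar>x - y\<bar> < t\<close> stays in it when lowered by a small \<delta>, and the upward
  shift by \<delta> brings it back.\<close>

lemma nontangential_max_le_SUP:
  assumes f: "integrable (bessel_measure lam) f"
  shows "nontangential_max lam f x \<le> (SUP n. ennreal (shifted_nontangential (1 / real (Suc n)) f x))"
  unfolding nontangential_max_def
proof (rule SUP_least, clarify)
  fix y t :: real assume y: "0 < y" "0 < t" "\<bar>x - y\<bar> < t"
  obtain n where n: "1 / real (Suc n) < t - \<bar>x - y\<bar>"
    using reals_Archimedean[of "t - \<bar>x - y\<bar>"] y by (auto simp: inverse_eq_divide)
  let ?d = "1 / real (Suc n)"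
  have d: "?d > 0" by simp
  have "norm (poisson lam ((t - ?d) + ?d) f y) \<le> shifted_nontangential ?d f x"
    using n y by (intro norm_le_shifted_nontangential[OF f d]) auto
  hence "ennreal (norm (poisson lam t f y)) \<le> ennreal (shifted_nontangential ?d f x)" by (simp add: ennreal_leI)
  also have "\<dots> \<le> (SUP n. ennreal (shifted_nontangential (1 / real (Suc n)) f x))" by (rule SUP_upper) simp
  finally show "ennreal (norm (poisson lam t f y)) \<le> \<dots>" .
qed

text \<open>A point at height \<open>s + e\<close> is seen under the smaller shift \<open>d\<close>
  from height \<open>s + e - d \<ge> s\<close>, still inside the cone.\<close>

lemma shifted_nontangential_antimono:
  assumes f: "integrable (bessel_measure lam) f" and "0 < d" "d \<le> e"
  shows "shifted_nontangential e f x \<le> shifted_nontangential d f x"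
  unfolding shifted_nontangential_def[of e]
proof (rule cSUP_least[OF cone_nonempty], clarify)
  fix y s :: real assume "0 < y" "0 < s" "\<bar>x - y\<bar> < s"
  thus "norm (poisson lam (s + e) f y) \<le> shifted_nontangential d f x"
    using norm_le_shifted_nontangential[OF f assms(2), of y "s + e - d" x] assms by simp
qed

text \<open>The tangential maximal function is \<open>u\<^sup>*(x) = sup\<^bsub>y,s\<^esub> \<bar>u(y, s)\<bar> (1 + \<bar>x - y\<bar> / s)\<^bsup>-N\<^esup>\<close> with
  \<open>N = 2 lam + 2\<close>. Its power \<open>u\<^sup>*(x)\<^bsup>1-r\<^esup>\<close> can be absorbed because the shift makes it finite. The value of
  \<open>r\<close> makes the loss \<open>N (1 - r) = 1/2\<close>, less than the order \<open>1\<close> of decay of the kernel.\<close>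

lemma shifted_nontangential_powr_le:
  defines "r \<equiv> 1 - 1 / (4 * lam + 4)"
  obtains C where "C > 0" "\<And>f \<delta> x M y s. integrable (bessel_measure lam) f \<Longrightarrow> \<delta> > 0 \<Longrightarrow> x > 0 \<Longrightarrow> M \<ge> 0 \<Longrightarrow>
    (\<And>\<rho>. \<rho> > 0 \<Longrightarrow> (\<integral>\<^sup>+z. ennreal (shifted_radial \<delta> f z powr r) * indicator (ball x \<rho>) z \<partial>bessel_measure lam)
        \<le> ennreal (M * ball_vol lam x \<rho>)) \<Longrightarrow>
    y > 0 \<Longrightarrow> s > 0 \<Longrightarrow> \<bar>x - y\<bar> < s \<Longrightarrow> norm (poisson lam (s + \<delta>) f y) powr r \<le> C * M"
proof -
  obtain C1 where C1: "C1 > 0" "\<And>t x y. t > 0 \<Longrightarrow> x > 0 \<Longrightarrow> y > 0 \<Longrightarrow>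
    poisson_kernel lam t x y \<le> C1 * (t / ((t + \<bar>x - y\<bar>)^2 * (x + (t + \<bar>x - y\<bar>)) powr (2 * lam)))"
    using poisson_kernel_le[OF lam] by blast
  \<comment> \<open>\<open>e\<close> is the exponent of the factor to be absorbed and
    \<open>D\<close> the constant of the dyadic estimate. The factor \<open>2 powr N\<close> in
    \<open>C5\<close> pays for halving the height.\<close>
  define N e K D C5 where "N = 2 * lam + 2" and "e = 1 / (4 * lam + 4)" and "K = semigroup_const lam"
    and "D = 2 * 2 powr (2 * lam) / (1 - 2 powr (- 1/2 :: real))"
    and "C5 = 2 powr N * (C1 * 2 powr (2 * lam) * D / K)"
  have N: "N > 0" "N * e = 1/2" using lam by (simp_all add: N_def e_def field_simps)
  have e: "0 < e" "e < 1" "r = 1 - e" "0 < r" using lam by (simp_all add: e_def r_def field_simps)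
  have K: "K > 0" unfolding K_def by (rule semigroup_const_pos[OF lam])
  have D: "D > 0"
  proof -
    have "(2::real) powr (- 1/2) < 2 powr 0" by (rule powr_less_mono) auto
    thus ?thesis by (simp add: D_def)
  qed
  have C5: "C5 > 0" using C1 K D by (simp add: C5_def)
  show ?thesis
  proof (rule that[of "2 powr (N * r) * C5"])
    show "2 powr (N * r) * C5 > 0" using C5 by simp
    fix f \<delta> x M y0 s0
    assume f: "integrable (bessel_measure lam) f" and \<delta>: "\<delta> > 0" and x: "(x::real) > 0" and M: "M \<ge> 0"
      and ball: "\<And>\<rho>. \<rho> > 0 \<Longrightarrow> (\<integral>\<^sup>+z. ennreal (shifted_radial \<delta> f z powr r) * indicator (ball x \<rho>) z \<partial>bessel_measure lam)
        \<le> ennreal (M * ball_vol lam x \<rho>)"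
      and y0: "y0 > 0" "s0 > 0" "\<bar>x - y0\<bar> < s0"
    define v where "v = (\<lambda>s y. norm (poisson lam (s + \<delta>) f y))"
    define \<beta> where "\<beta> = (\<lambda>y s. 1 + \<bar>x - y\<bar> / s)"
    define G where "G = shifted_radial \<delta> f"
    have v0: "v s y \<ge> 0" for s y by (simp add: v_def)
    have \<beta>1: "\<beta> y s \<ge> 1" if "s > 0" for y s using that by (simp add: \<beta>_def)
    have "\<exists>B. \<forall>t y. \<delta> \<le> t \<longrightarrow> norm (poisson lam t f y) \<le> B"
      by (rule poisson_bounded[OF lam \<delta> f]) blast
    then obtain B where B: "\<And>t y. \<delta> \<le> t \<Longrightarrow> norm (poisson lam t f y) \<le> B" by blast
    define S where "S = {(y, s). (0::real) < y \<and> (0::real) < s}"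
    \<comment> \<open>The tangential supremum at the fixed point \<open>x\<close>. It is a real
      number because the shifted extension is bounded and the weight is at most 1.\<close>
    define U where "U = (SUP (y, s)\<in>S. v s y * \<beta> y s powr (- N))"
    have bdd: "bdd_above ((\<lambda>(y, s). v s y * \<beta> y s powr (- N)) ` S)"
    proof (rule bdd_aboveI2[of _ _ B], clarify)
      fix y s assume "(y, s) \<in> S"
      hence s: "s > 0" by (simp add: S_def)
      have "v s y * \<beta> y s powr (- N) \<le> v s y * 1"
        using \<beta>1[OF s, of y] N powr_mono2'[of "- N" 1 "\<beta> y s"] by (intro mult_left_mono v0) auto
      also have "\<dots> \<le> B" using s by (simp add: v_def B)
      finally show "v s y * \<beta> y s powr (- N) \<le> B" .
    qed
    have S_ne: "S \<noteq> {}" by (auto simp: S_def intro: exI[of _ 1])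
    have U_upper: "v s y * \<beta> y s powr (- N) \<le> U" if "y > 0" "s > 0" for y s
      unfolding U_def using cSUP_upper[OF _ bdd, of "(y, s)"] that by (simp add: S_def)
    have U0: "U \<ge> 0"
      using U_upper[of 1 1] v0[of 1 1] by (meson mult_nonneg_nonneg order.trans powr_ge_zero zero_less_one)
    have vU: "v s y \<le> U * \<beta> y s powr N" if "y > 0" "s > 0" for y s
    proof -
      have "v s y * \<beta> y s powr (- N) * \<beta> y s powr N \<le> U * \<beta> y s powr N"
        by (intro mult_right_mono U_upper that) auto
      moreover have "\<beta> y s powr (- N) * \<beta> y s powr N = 1"
        using \<beta>1[OF that(2), of y] by (simp add: powr_add[symmetric])
      ultimately show ?thesis by (simp add: mult.assoc)
    qed
    have key: "K * v (2 * s) y \<le> C1 * 2 powr (2 * lam) * \<beta> y s powr N * U powr e * (D * M)"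
      if y: "y > 0" and s: "s > 0" for y s
    proof -
      let ?A = "C1 * 2 powr (2 * lam) * \<beta> y s powr N * U powr e"
      let ?k = "\<lambda>z. s powr (1/2) * (s + \<bar>x - z\<bar>) powr (- (3/2)) * (x + (s + \<bar>x - z\<bar>)) powr (- (2 * lam)) * G z powr r"
      have A: "?A \<ge> 0" using C1 by simp
      have Gm: "(\<lambda>z. G z powr r) \<in> borel_measurable (bessel_measure lam)"
        unfolding G_def using measurable_shifted_radial[OF f \<delta>] by (intro borel_measurable_bessel_of_borel) measurable
      \<comment> \<open>Of the two heights \<open>s\<close> only the second carries the shift, so
        the semigroup law leads from level \<open>s + \<delta>\<close> to level
        \<open>2 * s + \<delta>\<close>.\<close>
      have "2 * s + \<delta> = s + (s + \<delta>)" by simp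
      hence "ennreal (K * v (2 * s) y) = ennreal (semigroup_const lam * norm (poisson lam (s + (s + \<delta>)) f y))"
        by (simp only: K_def v_def)
      also have "\<dots> \<le> (\<integral>\<^sup>+z. ennreal (poisson_kernel lam s y z * norm (poisson lam (s + \<delta>) f z)) \<partial>bessel_measure lam)"
        using s \<delta> by (intro poisson_reproducing_le[OF lam _ _ f]) auto
      also have "\<dots> \<le> (\<integral>\<^sup>+z. ennreal (?A * ?k z) \<partial>bessel_measure lam)"
      proof (rule nn_integral_mono, rule ennreal_leI)
        fix z assume "z \<in> space (bessel_measure lam)"
        hence z: "z > 0" by simp
        define \<sigma> where "\<sigma> = s + \<bar>x - z\<bar>"
        have \<sigma>: "\<sigma> > 0" using s by (simp add: \<sigma>_def)
        have b: "\<beta> z s = \<sigma> / s" using s by (simp add: \<beta>_def \<sigma>_def field_simps)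
        have "poisson_kernel lam s y z \<le> C1 * (s / ((s + \<bar>y - z\<bar>)^2 * (y + (s + \<bar>y - z\<bar>)) powr (2 * lam)))"
          by (rule C1(2)[OF s y z])
        also have "\<dots> \<le> C1 * (2 powr (2 * lam) * \<beta> y s powr N * (s / (\<sigma>^2 * (x + \<sigma>) powr (2 * lam))))"
          using kernel_recentre[OF lam x y s, of z] C1(1)
          by (intro mult_left_mono) (auto simp: \<beta>_def \<sigma>_def N_def)
        finally have 1: "poisson_kernel lam s y z \<le> C1 * (2 powr (2 * lam) * \<beta> y s powr N * (s / (\<sigma>^2 * (x + \<sigma>) powr (2 * lam))))" .
        \<comment> \<open>The power \<open>r\<close> goes to the radial bound at \<open>z\<close>,
          the power \<open>e\<close> to \<open>U\<close> with its weight. The case of value 0 is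
          separate because adding exponents of \<open>powr\<close> needs a nonzero base.\<close>
        have "v s z = v s z powr r * v s z powr e"
          using v0[of s z] e by (cases "v s z = 0") (auto simp: powr_add[symmetric])
        also have "\<dots> \<le> G z powr r * (U * \<beta> z s powr N) powr e"
          using norm_le_shifted_radial[OF f \<delta> s, of z] vU[OF z s] v0[of s z] e
          by (intro mult_mono powr_mono2) (auto simp: v_def G_def)
        also have "(U * \<beta> z s powr N) powr e = U powr e * (\<sigma> / s) powr (1/2)"
          using U0 by (simp only: b powr_mult powr_powr N(2))
        finally have 2: "v s z \<le> G z powr r * (U powr e * (\<sigma> / s) powr (1/2))" .
        have "poisson_kernel lam s y z * v s z
          \<le> (C1 * (2 powr (2 * lam) * \<beta> y s powr N * (s / (\<sigma>^2 * (x + \<sigma>) powr (2 * lam))))) * (G z powr r * (U powr e * (\<sigma> / s) powr (1/2)))"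
          using 1 2 v0 poisson_kernel_nonneg[OF lam s] C1(1) s \<sigma> x by (intro mult_mono) auto
        also have "\<dots> = ?A * ((s * (\<sigma> / s) powr (1/2) / \<sigma>^2) * (1 / (x + \<sigma>) powr (2 * lam)) * G z powr r)"
          by simp
        also have "s * (\<sigma> / s) powr (1/2) / \<sigma>^2 = s powr (1/2) * \<sigma> powr (- (3/2))"
        proof -
          have "s = s powr (1/2) * s powr (1/2)" using s by (simp add: powr_add[symmetric])
          hence "s / s powr (1/2) = s powr (1/2)" using s by (simp add: field_simps)
          moreover have "\<sigma> powr (1/2) / \<sigma>^2 = \<sigma> powr (- (3/2))"
            using \<sigma> powr_diff[of \<sigma> "1/2" 2] by simp
          moreover have "s * (\<sigma> / s) powr (1/2) / \<sigma>^2 = (s / s powr (1/2)) * (\<sigma> powr (1/2) / \<sigma>^2)"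
            using s \<sigma> by (simp add: powr_divide)
          ultimately show ?thesis by simp
        qed
        also have "1 / (x + \<sigma>) powr (2 * lam) = (x + \<sigma>) powr (- (2 * lam))" by (simp add: powr_minus_divide)
        finally show "poisson_kernel lam s y z * norm (poisson lam (s + \<delta>) f z) \<le> ?A * ?k z"
          by (simp add: v_def \<sigma>_def)
      qed
      also have "\<dots> = (\<integral>\<^sup>+z. ennreal ?A * ennreal (?k z) \<partial>bessel_measure lam)"
        using A by (simp add: ennreal_mult')
      also have "\<dots> = ennreal ?A * (\<integral>\<^sup>+z. ennreal (?k z) \<partial>bessel_measure lam)"
      proof (rule nn_integral_cmult)
        have "(\<lambda>z. s powr (1/2) * (s + \<bar>x - z\<bar>) powr (- (3/2)) * (x + (s + \<bar>x - z\<bar>)) powr (- (2 * lam))) \<in> borel_measurable (bessel_measure lam)"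
          by (intro borel_measurable_bessel_of_borel) measurable
        with Gm show "(\<lambda>z. ennreal (?k z)) \<in> borel_measurable (bessel_measure lam)" by measurable
      qed
      also have "\<dots> \<le> ennreal ?A * ennreal (D * M)"
        unfolding D_def
        by (intro mult_left_mono nn_integral_dyadic_kernel_le[OF lam Gm _ x s M]) (use ball in \<open>auto simp: G_def\<close>)
      also have "\<dots> = ennreal (?A * (D * M))" using A by (simp add: ennreal_mult')
      finally show ?thesis using A D M by (subst (asm) ennreal_le_iff) auto
    qed
    have "v s y * \<beta> y s powr (- N) \<le> C5 * U powr e * M" if y: "y > 0" and s: "s > 0" for y s
    proof -
      \<comment> \<open>The estimate at doubled height is used at \<open>s / 2\<close>, where the
        weight satisfies \<open>\<beta> y (s / 2) \<le> 2 * \<beta> y s\<close>.\<close>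
      have s2: "s / 2 > 0" using s by simp
      have "K * v s y \<le> C1 * 2 powr (2 * lam) * \<beta> y (s/2) powr N * U powr e * (D * M)"
        using key[OF y s2] by simp
      hence "v s y \<le> C1 * 2 powr (2 * lam) * \<beta> y (s/2) powr N * U powr e * (D * M) / K"
        using K by (simp add: field_simps)
      also have "\<dots> \<le> C1 * 2 powr (2 * lam) * (2 * \<beta> y s) powr N * U powr e * (D * M) / K"
      proof -
        have "\<beta> y (s/2) \<le> 2 * \<beta> y s" by (simp add: \<beta>_def mult.commute)
        thus ?thesis using N \<beta>1[OF s2, of y] C1(1) D M K
          by (intro divide_right_mono mult_right_mono mult_left_mono powr_mono2) auto
      qed
      also have "\<dots> = C5 * U powr e * M * \<beta> y s powr N"
        using \<beta>1[OF s, of y] by (simp add: powr_mult C5_def)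
      finally have "v s y * \<beta> y s powr (- N) \<le> C5 * U powr e * M * \<beta> y s powr N * \<beta> y s powr (- N)"
        by (intro mult_right_mono) auto
      moreover have "\<beta> y s powr N * \<beta> y s powr (- N) = 1"
        using \<beta>1[OF s, of y] by (simp add: powr_add[symmetric])
      ultimately show ?thesis by (simp add: mult.assoc)
    qed
    \<comment> \<open>Taking the supremum closes the loop: \<open>U\<close> occurs on the right only
      to the power \<open>e < 1\<close>, and for finite \<open>U > 0\<close> division leaves
      \<open>U powr r\<close>.\<close>
    hence "U \<le> C5 * U powr e * M"
      unfolding U_def[of] by (intro cSUP_least[OF S_ne]) (auto simp: S_def)
    hence Ur: "U powr r \<le> C5 * M"
    proof (cases "U = 0")
      case False
      hence U: "U > 0" using U0 by simp
      assume le: "U \<le> C5 * U powr e * M"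
      have "U powr r = U / U powr e" using U by (simp add: e powr_diff)
      also have "\<dots> \<le> C5 * M" using le U by (simp add: field_simps)
      finally show ?thesis .
    qed (use C5 M in simp)
    have "v s0 y0 powr r \<le> (U * \<beta> y0 s0 powr N) powr r"
      using vU[OF y0(1,2)] v0 e by (intro powr_mono2) auto
    \<comment> \<open>Inside the cone the weight \<open>\<beta> y0 s0\<close> is less than
      2.\<close>
    also have "\<dots> \<le> (U * 2 powr N) powr r"
      using y0 N U0 e by (intro powr_mono2 mult_left_mono) (auto simp: \<beta>_def)
    also have "\<dots> = 2 powr (N * r) * U powr r" using U0 by (simp add: powr_mult powr_powr)
    also have "\<dots> \<le> 2 powr (N * r) * (C5 * M)" by (intro mult_left_mono Ur) simp
    finally show "norm (poisson lam (s0 + \<delta>) f y0) powr r \<le> 2 powr (N * r) * C5 * M"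
      by (simp add: v_def mult.assoc)
  qed
qed

text \<open>The strong type bound with exponent \<open>1 / r\<close> is applied to
  \<open>shifted_radial\<close> to the power \<open>r\<close> and to the minorant
  \<open>shifted_nontangential\<close> to the power \<open>r\<close>, divided by \<open>A\<close>,
  of its maximal function; the exponent then removes \<open>r\<close> on both sides. The constants
  depend on \<open>lam\<close> only, neither on \<open>f\<close> nor on the shift.\<close>

lemma nn_integral_nontangential_max_le:
  obtains C where "C > 0" "\<And>f. integrable (bessel_measure lam) f \<Longrightarrow>
    (\<integral>\<^sup>+x. nontangential_max lam f x \<partial>bessel_measure lam) \<le> ennreal C * (\<integral>\<^sup>+x. radial_max lam f x \<partial>bessel_measure lam)"
proof -
  let ?m = "bessel_measure lam"
  define r where "r = 1 - 1 / (4 * lam + 4)"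
  define p where "p = 1 / r"
  have r: "0 < r" "r < 1" using lam by (simp_all add: r_def field_simps)
  have p: "p > 1" "r * p = 1" using r by (simp_all add: p_def)
  obtain A where A: "A > 0" "\<And>f \<delta> x M y s. integrable ?m f \<Longrightarrow> \<delta> > 0 \<Longrightarrow> x > 0 \<Longrightarrow> M \<ge> 0 \<Longrightarrow>
    (\<And>\<rho>. \<rho> > 0 \<Longrightarrow> (\<integral>\<^sup>+z. ennreal (shifted_radial \<delta> f z powr r) * indicator (ball x \<rho>) z \<partial>?m)
        \<le> ennreal (M * ball_vol lam x \<rho>)) \<Longrightarrow>
    y > 0 \<Longrightarrow> s > 0 \<Longrightarrow> \<bar>x - y\<bar> < s \<Longrightarrow> norm (poisson lam (s + \<delta>) f y) powr r \<le> A * M"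
    using shifted_nontangential_powr_le unfolding r_def by blast
  define C where "C = 20 * 5 powr (2 * lam) * p * 4 powr (p - 1) / (p - 1)"
  have C: "C > 0" using p by (simp add: C_def)
  have main: "(\<integral>\<^sup>+x. ennreal (shifted_nontangential \<delta> f x) \<partial>?m) \<le> ennreal (A powr p * C) * (\<integral>\<^sup>+x. radial_max lam f x \<partial>?m)"
    if f: "integrable ?m f" and \<delta>: "\<delta> > 0" for f \<delta>
  proof -
    let ?G = "shifted_radial \<delta> f" and ?H = "shifted_nontangential \<delta> f"
    note G0 = shifted_radial_nonneg[OF f \<delta>] and H0 = shifted_nontangential_nonneg[OF f \<delta>]
    have [measurable]: "?G \<in> borel_measurable borel" "?H \<in> borel_measurable borel"
      by (rule measurable_shifted_radial[OF f \<delta>], rule measurable_shifted_nontangential[OF f \<delta>])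
    have "(\<integral>\<^sup>+x. ennreal ((?H x powr r / A) powr p) \<partial>?m)
       \<le> ennreal C * (\<integral>\<^sup>+x. ennreal ((?G x powr r) powr p) \<partial>?m)"
      unfolding C_def
    proof (rule maximal_strong_type[OF lam p(1)])
      fix x a :: real assume x: "x > 0" and a: "a > 0" "a < ?H x powr r / A"
      show "\<exists>\<rho>>0. ennreal (a * ball_vol lam x \<rho>) < (\<integral>\<^sup>+z. ennreal (?G z powr r) * indicator (ball x \<rho>) z \<partial>?m)"
      proof (rule ccontr)
        assume "\<not> ?thesis"
        \<comment> \<open>If every average is at most \<open>a\<close>, the pointwise estimate with
          \<open>M = a\<close> bounds all values in the cone at \<open>x\<close>, contrary to
          \<open>a < ?H x powr r / A\<close>.\<close>
        hence nn: "(\<integral>\<^sup>+z. ennreal (?G z powr r) * indicator (ball x \<rho>) z \<partial>?m) \<le> ennreal (a * ball_vol lam x \<rho>)" if "\<rho> > 0" for \<rho>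
          using that by (meson not_less)
        have "?H x \<le> (A * a) powr p"
          unfolding shifted_nontangential_def
        proof (rule cSUP_least[OF cone_nonempty], clarify)
          fix y s :: real assume ys: "0 < y" "0 < s" "\<bar>x - y\<bar> < s"
          have "norm (poisson lam (s + \<delta>) f y) powr r \<le> A * a"
            using a nn by (intro A(2)[OF f \<delta> x _ _ ys]) auto
          hence "(norm (poisson lam (s + \<delta>) f y) powr r) powr p \<le> (A * a) powr p"
            using p by (intro powr_mono2) auto
          thus "norm (poisson lam (s + \<delta>) f y) \<le> (A * a) powr p" by (simp add: powr_powr p)
        qed
        hence "?H x powr r \<le> ((A * a) powr p) powr r" using H0 r by (intro powr_mono2) auto
        also have "\<dots> = A * a" using p A(1) a by (simp add: powr_powr mult.commute)
        finally show False using a A(1) by (simp add: field_simps)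
      qed
    qed (use A(1) in \<open>auto intro!: borel_measurable_bessel_of_borel\<close>)
    also have "(\<integral>\<^sup>+x. ennreal ((?G x powr r) powr p) \<partial>?m) = (\<integral>\<^sup>+x. ennreal (?G x) \<partial>?m)"
      using G0 by (simp add: powr_powr p)
    also have "(\<integral>\<^sup>+x. ennreal ((?H x powr r / A) powr p) \<partial>?m) = (\<integral>\<^sup>+x. ennreal (?H x / A powr p) \<partial>?m)"
      using H0 A(1) by (simp add: powr_divide powr_powr p)
    finally have "ennreal (A powr p) * (\<integral>\<^sup>+x. ennreal (?H x / A powr p) \<partial>?m)
      \<le> ennreal (A powr p) * (ennreal C * (\<integral>\<^sup>+x. ennreal (?G x) \<partial>?m))"
      by (rule mult_left_mono) simp
    moreover have "ennreal (A powr p) * (\<integral>\<^sup>+x. ennreal (?H x / A powr p) \<partial>?m) = (\<integral>\<^sup>+x. ennreal (?H x) \<partial>?m)"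
    proof -
      have "(\<lambda>x. ennreal (?H x / A powr p)) \<in> borel_measurable ?m"
        by (intro borel_measurable_bessel_of_borel) measurable
      hence "ennreal (A powr p) * (\<integral>\<^sup>+x. ennreal (?H x / A powr p) \<partial>?m)
        = (\<integral>\<^sup>+x. ennreal (A powr p) * ennreal (?H x / A powr p) \<partial>?m)"
        by (rule nn_integral_cmult[symmetric])
      thus ?thesis using A(1) by (simp add: ennreal_mult'[symmetric])
    qed
    ultimately have "(\<integral>\<^sup>+x. ennreal (?H x) \<partial>?m) \<le> ennreal (A powr p * C) * (\<integral>\<^sup>+x. ennreal (?G x) \<partial>?m)"
      using C by (simp add: ennreal_mult mult.assoc)
    also have "\<dots> \<le> ennreal (A powr p * C) * (\<integral>\<^sup>+x. radial_max lam f x \<partial>?m)"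
      by (intro mult_left_mono nn_integral_mono shifted_radial_le_radial_max[OF f \<delta>]) simp
    finally show ?thesis .
  qed
  show ?thesis
  proof (rule that[of "A powr p * C"])
    show "A powr p * C > 0" using A(1) C by simp
    fix f :: "real \<Rightarrow> complex" assume f: "integrable ?m f"
    let ?h = "\<lambda>n x. ennreal (shifted_nontangential (1 / real (Suc n)) f x)"
    have "(\<integral>\<^sup>+x. nontangential_max lam f x \<partial>?m) \<le> (\<integral>\<^sup>+x. (SUP n. ?h n x) \<partial>?m)"
      by (intro nn_integral_mono nontangential_max_le_SUP f)
    \<comment> \<open>The shifts \<open>1 / (n + 1)\<close> decrease, so the shifted maximal
      functions increase, and the bound uniform in the shift survives the limit.\<close>
    also have "\<dots> = (SUP n. \<integral>\<^sup>+x. ?h n x \<partial>?m)"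
    proof (rule nn_integral_monotone_convergence_SUP)
      show "incseq ?h"
        by (intro incseq_SucI le_funI ennreal_leI shifted_nontangential_antimono[OF f]) (auto simp: field_simps)
      show "?h n \<in> borel_measurable ?m" for n
      proof -
        have "0 < 1 / real (Suc n)" by simp
        note [measurable] = measurable_shifted_nontangential[OF f this]
        show ?thesis by (intro borel_measurable_bessel_of_borel) measurable
      qed
    qed
    also have "\<dots> \<le> ennreal (A powr p * C) * (\<integral>\<^sup>+x. radial_max lam f x \<partial>?m)"
      by (intro SUP_least main f) simp
    finally show "(\<integral>\<^sup>+x. nontangential_max lam f x \<partial>?m) \<le> \<dots>" .
  qed
qed

end

theorem theorem3p2:
  fixes lam :: real
  assumes "lam > 0"
  shows "(\<forall>f \<in> L1_bessel lam. f \<in> H1_max lam \<longleftrightarrow> f \<in> H1_nmax lam) \<and>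
         (\<exists>C::real. C \<ge> 1 \<and>
            (\<forall>f \<in> H1_max lam.
               ennreal (1 / C) * H1_max_norm lam f \<le> H1_nmax_norm lam f \<and>
               H1_nmax_norm lam f \<le> ennreal C * H1_max_norm lam f))"
proof -
  let ?m = "bessel_measure lam"
  obtain C where C: "C > 0" "\<And>f. integrable ?m f \<Longrightarrow>
    (\<integral>\<^sup>+x. nontangential_max lam f x \<partial>?m) \<le> ennreal C * (\<integral>\<^sup>+x. radial_max lam f x \<partial>?m)"
    using nn_integral_nontangential_max_le[OF assms] by blast
  have le: "(\<integral>\<^sup>+x. radial_max lam f x \<partial>?m) \<le> (\<integral>\<^sup>+x. nontangential_max lam f x \<partial>?m)" for f
    using radial_max_le_nontangential_max[OF assms] by (intro nn_integral_mono) simp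
  have meas: "radial_max lam f \<in> borel_measurable ?m" "nontangential_max lam f \<in> borel_measurable ?m"
    if "integrable ?m f" for f
    using measurable_radial_max[OF assms that] measurable_nontangential_max[OF assms]
    by (auto intro: borel_measurable_bessel_of_borel)
  have equiv: "f \<in> H1_max lam \<longleftrightarrow> f \<in> H1_nmax lam" if "f \<in> L1_bessel lam" for f
  proof -
    have f: "integrable ?m f" using that by (simp add: L1_bessel_def)
    have "(\<integral>\<^sup>+x. nontangential_max lam f x \<partial>?m) < \<infinity>" if "(\<integral>\<^sup>+x. radial_max lam f x \<partial>?m) < \<infinity>"
      using C(2)[OF f] that by (auto simp: ennreal_mult_less_top intro: le_less_trans)
    thus ?thesis using that meas[OF f] le[of f] by (auto simp: H1_max_def H1_nmax_def intro: le_less_trans)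
  qed
  \<comment> \<open>The summand \<open>L1_norm\<close> is common to both norms and forces a constant
    of at least 1.\<close>
  let ?D = "max 1 C"
  have norms: "ennreal (1 / ?D) * H1_max_norm lam f \<le> H1_nmax_norm lam f \<and>
     H1_nmax_norm lam f \<le> ennreal ?D * H1_max_norm lam f" if "f \<in> H1_max lam" for f
  proof
    have f: "integrable ?m f" using that by (simp add: H1_max_def L1_bessel_def)
    have "ennreal (1 / ?D) * H1_max_norm lam f \<le> 1 * H1_max_norm lam f"
      by (intro mult_right_mono) (auto simp: ennreal_le_1)
    also have "\<dots> \<le> H1_nmax_norm lam f"
      unfolding H1_max_norm_def H1_nmax_norm_def using le[of f] by (simp add: add_left_mono)
    finally show "ennreal (1 / ?D) * H1_max_norm lam f \<le> H1_nmax_norm lam f" .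
    have "H1_nmax_norm lam f \<le> 1 * L1_norm lam f + ennreal C * (\<integral>\<^sup>+x. radial_max lam f x \<partial>?m)"
      unfolding H1_nmax_norm_def using C(2)[OF f] by (simp add: add_left_mono)
    also have "\<dots> \<le> ennreal ?D * L1_norm lam f + ennreal ?D * (\<integral>\<^sup>+x. radial_max lam f x \<partial>?m)"
      by (intro add_mono mult_right_mono) (auto intro: ennreal_leI simp flip: ennreal_1)
    also have "\<dots> = ennreal ?D * H1_max_norm lam f"
      by (simp add: H1_max_norm_def distrib_left)
    finally show "H1_nmax_norm lam f \<le> ennreal ?D * H1_max_norm lam f" .
  qed
  show ?thesis
    using equiv norms by (intro conjI ballI exI[of _ ?D]) auto
qed

end
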